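(* There are absolute constants $A>0$ and $m_0\in\mathbb N$ such that for every integer $m\ge m_0$, every real $p\ge2m+A$, every $n\in\mathbb N$, and every symmetric complex $m$-linear form $T:(\mathbb C^n)^m\to\mathbb C$, \[ \Bigl(\sum_{i_1,\ldots,i_m=1}^n|T(e_{i_1},\ldots,e_{i_m})|^{\frac{2mp}{mp+p-2m}}\Bigr)^{\frac{mp+p-2m}{2mp}} \le\sup_{\|z\|_{\ell_p^n}\le1}|T(z,\ldots,z)|, \] and, if $T$ is nonzero, equality holds in this estimate if and only if there exist $j\in\{1,\ldots,n\}$ and $c\in\mathbb C\setminus\{0\}$ such that $T(z,\ldots,z)=c\,z_j^m$ for all $z\in\mathbb C^n$.
   Context: $e_1,\ldots,e_n$ is the canonical basis of $\mathbb C^n$; the supremum on the right is over $z\in\mathbb C^n$ with $\ell_p^n$ norm at most $1$. "Absolute constant" means independent of $m,n,p,T$. *)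

theory Defs
  imports
    Complex_Main
    "HOL-Combinatorics.Permutations"
    "Jordan_Normal_Form.Matrix"
begin

text \<open>
  The dimension \<open>n\<close> and the degree \<open>m\<close> are quantified after the absolute constants, so neither
  can be a type parameter. Hence \<open>\<complex>\<^sup>n\<close> is \<open>carrier_vec n\<close>, with coordinates and canonical
  basis \<open>unit_vec n i\<close> indexed from \<open>0\<close>, and an element of \<open>(\<complex>\<^sup>n)\<^sup>m\<close> is a list of \<open>m\<close> such vectors.
  The values of a form outside \<open>tuples m (carrier_vec n)\<close> are irrelevant.
\<close>

definition tuples :: "nat \<Rightarrow> 'a set \<Rightarrow> 'a list set" where
  "tuples m S = {xs. length xs = m \<and> set xs \<subseteq> S}"

definition multilinear_form :: "nat \<Rightarrow> nat \<Rightarrow> (complex vec list \<Rightarrow> complex) \<Rightarrow> bool" where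
  "multilinear_form m n T \<longleftrightarrow>
     (\<forall>xs \<in> tuples m (carrier_vec n). \<forall>k < m. \<forall>u \<in> carrier_vec n. \<forall>v \<in> carrier_vec n. \<forall>c.
        T (xs[k := u + v]) = T (xs[k := u]) + T (xs[k := v]) \<and>
        T (xs[k := c \<cdot>\<^sub>v u]) = c * T (xs[k := u]))"

definition symmetric_form :: "nat \<Rightarrow> nat \<Rightarrow> (complex vec list \<Rightarrow> complex) \<Rightarrow> bool" where
  "symmetric_form m n T \<longleftrightarrow>
     (\<forall>xs \<in> tuples m (carrier_vec n). \<forall>\<pi>. \<pi> permutes {..<m} \<longrightarrow> T (permute_list \<pi> xs) = T xs)"

definition lp_norm :: "real \<Rightarrow> complex vec \<Rightarrow> real" where
  "lp_norm p z = (\<Sum>i<dim_vec z. cmod (z $ i) powr p) powr (1 / p)"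

text \<open>The supremum is taken over a nonempty set of reals, which is bounded when \<open>p > 0\<close> and
  \<open>T\<close> is multilinear.\<close>

definition diag_sup :: "real \<Rightarrow> nat \<Rightarrow> nat \<Rightarrow> (complex vec list \<Rightarrow> complex) \<Rightarrow> real" where
  "diag_sup p m n T =
     (SUP z \<in> {z \<in> carrier_vec n. lp_norm p z \<le> 1}. cmod (T (replicate m z)))"

definition coeff_norm :: "real \<Rightarrow> nat \<Rightarrow> nat \<Rightarrow> (complex vec list \<Rightarrow> complex) \<Rightarrow> real" where
  "coeff_norm p m n T =
     (\<Sum>is \<in> tuples m {..<n}. cmod (T (map (unit_vec n) is))
         powr (2 * real m * p / (real m * p + p - 2 * real m)))
       powr ((real m * p + p - 2 * real m) / (2 * real m * p))"

end

theory Submission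
  imports Defs "HOL-Analysis.L2_Norm"
begin

text \<open>
  Normalise the supremum to 1, let \<open>P(z) = T(z, \<dots>, z)\<close>, and let \<open>q\<close> be the exponent of the statement
  and \<open>r = p / (p - m)\<close>. Averaging over \<open>m\<close>-th roots of unity gives \<open>\<Sum> |T(e\<^sub>i, \<dots>, e\<^sub>i)|\<^sup>r \<le> 1\<close>.
  If \<open>1 - \<epsilon>\<close> is the largest of the numbers \<open>|T(e\<^sub>i, \<dots>, e\<^sub>i)|\<close>, then \<open>\<Sum> |T(e\<^sub>i, \<dots>, e\<^sub>i)|\<^sup>q\<close> is at most
  \<open>(1 - \<epsilon>)\<close> to the power \<open>q - r\<close>, where \<open>q - r \<ge> A / (4 m)\<close> because \<open>p \<ge> 2 m + A\<close>. So it suffices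
  that the remaining coefficients contribute at most \<open>C \<epsilon> / m\<close>, with \<open>C\<close> absolute.

  A general bound for the coefficients follows in two steps. Jensen's inequality and the subadditivity
  of entropy produce a point \<open>x\<close> of the unit ball at which
  \<open>\<Sum>\<^sub>i sqrt (\<Sum>\<^sub>J |T(e\<^sub>i, e\<^sub>J) x\<^sub>i x\<^sub>J|\<^sup>2)\<close> dominates the \<open>q\<close>-norm of the coefficients; this reduces the
  problem to the polydisc. There the inner sum is split by the number \<open>k\<close> of entries equal to \<open>i\<close>.
  Coordinates that are independently 0 or a random root of unity decouple the variable \<open>i\<close> from the
  others, and an inequality between the mean of a polynomial and the weighted 2-norm of its
  coefficients, proved in one variable and tensorised, shows that the \<open>k\<close>-th parts add up to
  \<open>O(1 / sqrt (m choose k))\<close>. Hence the whole sum is \<open>O(1)\<close>, and it is \<open>O(1 / sqrt m)\<close> without the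
  terms \<open>k = m\<close>.

  The factor \<open>\<epsilon>\<close> appears by expanding \<open>P\<close> in powers of the variable with the largest pure
  coefficient: giving mass \<open>\<epsilon>\<close> to the other variables shows that the part of degree \<open>l\<close> in them has
  supremum at most 8 times \<open>\<epsilon>\<close> to the power \<open>1 - l / p\<close>, and \<open>q (1 - l / p) \<ge> 1\<close>.
\<close>

section \<open>Symmetric coefficients on tuples\<close>

text \<open>For symmetric \<open>t\<close> this is the diagonal of the \<open>d\<close>-linear form
  with coefficients \<open>t\<close>. Each monomial is listed once per ordering of its letters, so
  multinomial factors are implicit.\<close>

definition hpoly :: "nat \<Rightarrow> 'i set \<Rightarrow> ('i list \<Rightarrow> complex) \<Rightarrow> ('i \<Rightarrow> complex) \<Rightarrow> complex" where
  "hpoly d I t z = (\<Sum>J\<in>tuples d I. t J * prod_list (map z J))"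

text \<open>Comparing multisets avoids carrying permutations, and it places \<open>J'\<close> in
  \<open>tuples d I\<close> automatically.\<close>

definition symmetric_on :: "nat \<Rightarrow> 'i set \<Rightarrow> ('i list \<Rightarrow> 'b) \<Rightarrow> bool" where
  "symmetric_on d I t \<longleftrightarrow> (\<forall>J\<in>tuples d I. \<forall>J'. mset J' = mset J \<longrightarrow> t J' = t J)"

lemma symmetric_onD: "symmetric_on d I t \<Longrightarrow> J \<in> tuples d I \<Longrightarrow> mset J' = mset J \<Longrightarrow> t J' = t J"
  unfolding symmetric_on_def by blast

lemma tuples_0 [simp]: "tuples 0 I = {[]}"
  by (auto simp: tuples_def)

lemma tuples_Suc: "tuples (Suc d) I = (\<lambda>(i, J). i # J) ` (I \<times> tuples d I)"
  by (auto simp: tuples_def length_Suc_conv image_iff)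

lemma finite_tuples [simp]: "finite I \<Longrightarrow> finite (tuples d I)"
  by (induction d) (auto simp: tuples_Suc)

lemma tuples_mono: "A \<subseteq> B \<Longrightarrow> tuples d A \<subseteq> tuples d B"
  by (auto simp: tuples_def)

lemma tuples_empty: "0 < d \<Longrightarrow> tuples d {} = {}"
  by (auto simp: tuples_def)

lemma tuples_singleton: "tuples d {i} = {replicate d i}"
proof (induction d)
  case (Suc d) then show ?case by (auto simp: tuples_Suc)
qed auto

lemma Cons_in_tuples [simp]: "i # J \<in> tuples (Suc d) I \<longleftrightarrow> i \<in> I \<and> J \<in> tuples d I"
  by (auto simp: tuples_def)

lemma append_in_tuples: "K \<in> tuples k I \<Longrightarrow> J \<in> tuples l I \<Longrightarrow> K @ J \<in> tuples (k + l) I"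
  by (auto simp: tuples_def)

lemma replicate_in_tuples [simp]: "replicate d i \<in> tuples d I \<longleftrightarrow> d = 0 \<or> i \<in> I"
  by (auto simp: tuples_def)

lemma sum_tuples_Suc:
  fixes F :: "'i list \<Rightarrow> 'b::comm_monoid_add"
  shows "(\<Sum>J\<in>tuples (Suc d) I. F J) = (\<Sum>i\<in>I. \<Sum>J\<in>tuples d I. F (i # J))"
proof -
  have "(\<Sum>J\<in>tuples (Suc d) I. F J) = (\<Sum>(i, J)\<in>I \<times> tuples d I. F (i # J))"
    unfolding tuples_Suc by (subst sum.reindex) (auto simp: inj_on_def case_prod_unfold)
  thus ?thesis by (simp add: sum.cartesian_product)
qed

lemma tuples_mset: "J \<in> tuples d I \<Longrightarrow> mset J' = mset J \<Longrightarrow> J' \<in> tuples d I"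
  by (auto simp: tuples_def dest: mset_eq_setD mset_eq_length)

lemma symmetric_on_append:
  assumes "symmetric_on d I F" "A \<subseteq> I" "K \<in> tuples k I" "k + l = d"
  shows "symmetric_on l A (\<lambda>J. F (K @ J))"
  unfolding symmetric_on_def
proof (intro ballI allI impI)
  fix J J' assume "J \<in> tuples l A" "mset J' = mset J"
  thus "F (K @ J') = F (K @ J)"
    using append_in_tuples[OF assms(3), of J l] tuples_mono[OF assms(2), of l] assms(4)
    by (intro symmetric_onD[OF assms(1)]) auto
qed

lemma symmetric_on_Cons: "symmetric_on (Suc d) I F \<Longrightarrow> i \<in> I \<Longrightarrow> symmetric_on d I (\<lambda>J. F (i # J))"
  using symmetric_on_append[of "Suc d" I F I "[i]" 1 d] by (simp add: tuples_def)

text \<open>A word over \<open>A \<union> B\<close> is sorted into its letters from \<open>B\<close> followed by those from \<open>A\<close>; for a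
  symmetric summand only the positions, counted by the binomial coefficient, are lost.\<close>

lemma sum_tuples_Un:
  fixes F :: "'i list \<Rightarrow> 'b::comm_semiring_1"
  assumes "finite A" "finite B" "A \<inter> B = {}"
  shows "symmetric_on d (A \<union> B) F \<Longrightarrow>
    (\<Sum>J\<in>tuples d (A \<union> B). F J) =
    (\<Sum>k\<le>d. of_nat (d choose k) * (\<Sum>K\<in>tuples k B. \<Sum>J\<in>tuples (d - k) A. F (K @ J)))"
proof (induction d arbitrary: F)
  case 0
  show ?case by simp
next
  case (Suc d)
  define G where "G k = (\<Sum>K\<in>tuples k B. \<Sum>J\<in>tuples (Suc d - k) A. F (K @ J))" for k
  have B: "(\<Sum>i\<in>B. \<Sum>J\<in>tuples d (A \<union> B). F (i # J)) = (\<Sum>k\<le>d. of_nat (d choose k) * G (Suc k))"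
  proof -
    have "(\<Sum>i\<in>B. \<Sum>J\<in>tuples d (A \<union> B). F (i # J)) =
      (\<Sum>i\<in>B. \<Sum>k\<le>d. of_nat (d choose k) * (\<Sum>K\<in>tuples k B. \<Sum>J\<in>tuples (d - k) A. F (i # K @ J)))"
      by (intro sum.cong refl, subst Suc.IH) (auto intro!: symmetric_on_Cons Suc.prems)
    also have "\<dots> = (\<Sum>k\<le>d. of_nat (d choose k) * G (Suc k))"
      unfolding G_def sum_tuples_Suc by (subst sum.swap) (simp add: sum_distrib_left)
    finally show ?thesis .
  qed
  have A: "(\<Sum>i\<in>A. \<Sum>J\<in>tuples d (A \<union> B). F (i # J)) = (\<Sum>k\<le>d. of_nat (d choose k) * G k)"
  proof -
    have "(\<Sum>i\<in>A. \<Sum>J\<in>tuples d (A \<union> B). F (i # J)) =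
      (\<Sum>i\<in>A. \<Sum>k\<le>d. of_nat (d choose k) * (\<Sum>K\<in>tuples k B. \<Sum>J\<in>tuples (d - k) A. F (i # K @ J)))"
      by (intro sum.cong refl, subst Suc.IH) (auto intro!: symmetric_on_Cons Suc.prems)
    also have "\<dots> = (\<Sum>k\<le>d. of_nat (d choose k) * (\<Sum>i\<in>A. \<Sum>K\<in>tuples k B. \<Sum>J\<in>tuples (d - k) A. F (i # K @ J)))"
      by (subst sum.swap) (simp add: sum_distrib_left)
    also have "\<dots> = (\<Sum>k\<le>d. of_nat (d choose k) * G k)"
    proof (intro sum.cong refl, goal_cases)
      case (1 k)
      hence k: "k \<le> d" by simp
      \<comment> \<open>The letter from \<open>A\<close> in front has to pass the block
        \<open>K\<close> before it joins the other letters of \<open>A\<close>; symmetry allows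
        this.\<close>
      have eq: "F (i # K @ J) = F (K @ i # J)"
        if "i \<in> A" "K \<in> tuples k B" "J \<in> tuples (d - k) A" for i K J
      proof (rule symmetric_onD[OF Suc.prems])
        have "K \<in> tuples k (A \<union> B)" "i # J \<in> tuples (Suc (d - k)) (A \<union> B)"
          using that tuples_mono[of B "A \<union> B" k] tuples_mono[of A "A \<union> B" "d - k"] by auto
        from append_in_tuples[OF this] show "K @ i # J \<in> tuples (Suc d) (A \<union> B)" using k by simp
      qed simp
      have "(\<Sum>i\<in>A. \<Sum>K\<in>tuples k B. \<Sum>J\<in>tuples (d - k) A. F (i # K @ J)) =
        (\<Sum>i\<in>A. \<Sum>K\<in>tuples k B. \<Sum>J\<in>tuples (d - k) A. F (K @ i # J))"
        by (intro sum.cong refl eq)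
      also have "\<dots> = G k"
        unfolding G_def using k by (subst sum.swap) (simp add: Suc_diff_le sum_tuples_Suc)
      finally show ?case by simp
    qed
    finally show ?thesis .
  qed
  have "(\<Sum>J\<in>tuples (Suc d) (A \<union> B). F J) =
    (\<Sum>k\<le>d. of_nat (d choose k) * G k) + (\<Sum>k\<le>d. of_nat (d choose k) * G (Suc k))"
    unfolding sum_tuples_Suc using assms by (subst sum.union_disjoint) (auto simp: A B)
  \<comment> \<open>The term \<open>k = Suc d\<close> can be added because its binomial coefficient
    is 0; the index shift then prepares Pascal's rule.\<close>
  also have "(\<Sum>k\<le>d. of_nat (d choose k) * G k) = (\<Sum>k\<le>Suc d. of_nat (d choose k) * G k)"
    by (simp add: binomial_eq_0)
  also have "\<dots> = G 0 + (\<Sum>k\<le>d. of_nat (d choose Suc k) * G (Suc k))"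
    by (subst sum.atMost_Suc_shift) simp
  also have "\<dots> + (\<Sum>k\<le>d. of_nat (d choose k) * G (Suc k)) =
    G 0 + (\<Sum>k\<le>d. of_nat (Suc d choose Suc k) * G (Suc k))"
    by (simp add: sum.distrib[symmetric] algebra_simps)
  also have "\<dots> = (\<Sum>k\<le>Suc d. of_nat (Suc d choose k) * G k)"
    by (subst sum.atMost_Suc_shift) simp
  finally show ?case unfolding G_def .
qed

lemma symmetric_on_comp: "symmetric_on d I F \<Longrightarrow> symmetric_on d I (\<lambda>J. h (F J))"
  unfolding symmetric_on_def by (intro ballI allI impI arg_cong[where f = h]) blast

lemma symmetric_on_mult:
  "symmetric_on d I f \<Longrightarrow> symmetric_on d I g \<Longrightarrow> symmetric_on d I (\<lambda>J. f J * g J)"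
  unfolding symmetric_on_def by (intro ballI allI impI arg_cong2[where f = "(*)"]) blast+

lemma symmetric_on_prod_list:
  fixes z :: "'i \<Rightarrow> 'b::comm_monoid_mult"
  shows "symmetric_on d I (\<lambda>J. prod_list (map z J))"
proof -
  have "prod_list (map z J') = prod_list (map z J)" if "mset J' = mset J" for J J'
    using that by (metis mset_map prod_mset_prod_list)
  thus ?thesis unfolding symmetric_on_def by blast
qed

lemma sum_tuples_insert:
  fixes F :: "'i list \<Rightarrow> 'b::comm_semiring_1"
  assumes "finite I" "i \<notin> I" "symmetric_on d (insert i I) F"
  shows "(\<Sum>J\<in>tuples d (insert i I). F J) =
    (\<Sum>k\<le>d. of_nat (d choose k) * (\<Sum>J\<in>tuples (d - k) I. F (replicate k i @ J)))"
  using sum_tuples_Un[of I "{i}" d F] assms by (simp add: tuples_singleton)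

text \<open>The splitting is by degree in the variables of \<open>B\<close>, so that rotating all of
  these by a common root of unity isolates a single \<open>k\<close>.\<close>

lemma hpoly_Un:
  assumes "finite A" "finite B" "A \<inter> B = {}" "symmetric_on d (A \<union> B) t"
  shows "hpoly d (A \<union> B) t z =
    (\<Sum>k\<le>d. hpoly k B (\<lambda>K. of_nat (d choose k) * hpoly (d - k) A (\<lambda>J. t (K @ J)) z) z)"
proof -
  have "hpoly d (A \<union> B) t z = (\<Sum>k\<le>d. of_nat (d choose k) *
    (\<Sum>K\<in>tuples k B. \<Sum>J\<in>tuples (d - k) A. t (K @ J) * prod_list (map z (K @ J))))"
    unfolding hpoly_def
    by (rule sum_tuples_Un) (intro assms symmetric_on_mult symmetric_on_prod_list)+
  also have "\<dots> = (\<Sum>k\<le>d. hpoly k B (\<lambda>K. of_nat (d choose k) * hpoly (d - k) A (\<lambda>J. t (K @ J)) z) z)"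
    unfolding hpoly_def sum_distrib_left sum_distrib_right
    by (intro sum.cong refl) (simp add: mult_ac)
  finally show ?thesis .
qed

lemma hpoly_scale_coeff: "hpoly d I (\<lambda>J. c * t J) z = c * hpoly d I t z"
  by (simp add: hpoly_def sum_distrib_left mult.assoc)

lemma hpoly_insert:
  assumes "finite I" "i \<notin> I" "symmetric_on d (insert i I) t"
  shows "hpoly d (insert i I) t z =
    (\<Sum>k\<le>d. z i ^ k * hpoly (d - k) I (\<lambda>J. of_nat (d choose k) * t (replicate k i @ J)) z)"
proof -
  have 1: "prod_list (map z (replicate k i)) = z i ^ k" for k by (induction k) auto
  have "hpoly d (I \<union> {i}) t z =
    (\<Sum>k\<le>d. hpoly k {i} (\<lambda>K. of_nat (d choose k) * hpoly (d - k) I (\<lambda>J. t (K @ J)) z) z)"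
    by (rule hpoly_Un) (use assms in auto)
  thus ?thesis
    by (simp add: hpoly_def[of _ "{i}"] tuples_singleton hpoly_scale_coeff 1 mult_ac)
qed

lemma hpoly_cong: "(\<And>i. i \<in> I \<Longrightarrow> z i = w i) \<Longrightarrow> hpoly d I t z = hpoly d I t w"
  unfolding hpoly_def
  by (intro sum.cong refl arg_cong2[where f = "(*)"] arg_cong[where f = prod_list] map_cong)
     (auto simp: tuples_def)

lemma hpoly_superset:
  assumes "finite I" "A \<subseteq> I" "\<And>i. i \<in> I - A \<Longrightarrow> z i = 0"
  shows "hpoly d I t z = hpoly d A t z"
  unfolding hpoly_def
proof (rule sum.mono_neutral_right)
  show "\<forall>J\<in>tuples d I - tuples d A. t J * prod_list (map z J) = 0"
  proof
    fix J assume "J \<in> tuples d I - tuples d A"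
    then obtain i where "i \<in> set J" "i \<in> I - A" by (auto simp: tuples_def)
    hence "0 \<in> set (map z J)" using assms(3) by force
    thus "t J * prod_list (map z J) = 0" by (simp add: prod_list_zero_iff)
  qed
next
  show "tuples d A \<subseteq> tuples d I" by (rule tuples_mono) fact
qed (use assms(1) in simp)

lemma hpoly_scale: "hpoly d I t (\<lambda>i. c * z i) = c ^ d * hpoly d I t z"
proof -
  have "prod_list (map (\<lambda>i. c * z i) J) = c ^ length J * prod_list (map z J)" for J
    by (induction J) auto
  thus ?thesis unfolding hpoly_def sum_distrib_left
    by (intro sum.cong) (auto simp: tuples_def mult_ac)
qed

section \<open>Averages over roots of unity\<close>

text \<open>Means over \<open>N\<close>-th roots of unity replace integrals over the circle. The two
  agree on trigonometric polynomials with frequencies below \<open>N\<close> in modulus, which is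
  why \<open>N\<close> is taken large compared with the degree.\<close>

definition root_pt :: "nat \<Rightarrow> nat \<Rightarrow> complex" where
  "root_pt N j = cis (2 * pi * real j / real N)"

lemma norm_root_pt [simp]: "cmod (root_pt N j) = 1"
  by (simp add: root_pt_def)

lemma root_pt_nonzero [simp]: "root_pt N j \<noteq> 0"
  using norm_root_pt[of N j] by (metis norm_zero zero_neq_one)

lemma sum_root_pt_powi:
  assumes "N > 0"
  shows "(\<Sum>j<N. root_pt N j powi l) = (if int N dvd l then of_nat N else 0)"
proof -
  define x where "x = cis (2 * pi * real_of_int l / real N)"
  have eq: "root_pt N j powi l = x ^ j" for j
    by (simp add: root_pt_def x_def cis_power_int Complex.DeMoivre mult_ac)
  have "x ^ N = 1" using assms
    by (simp add: x_def Complex.DeMoivre cis_multiple_2pi)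
  moreover have "x = 1 \<longleftrightarrow> int N dvd l"
  proof
    assume "x = 1"
    hence "cos (2 * pi * real_of_int l / real N) = 1" by (simp add: x_def complex_eq_iff)
    then obtain k :: int where "2 * pi * real_of_int l / real N = real_of_int k * (2 * pi)"
      using cos_one_2pi_int by (metis mult.assoc)
    hence "real_of_int l = real_of_int (k * int N)" using assms by (simp add: field_simps)
    hence "l = k * int N" by linarith
    thus "int N dvd l" by simp
  next
    assume "int N dvd l"
    then obtain k where "l = int N * k" by auto
    hence "2 * pi * real_of_int l / real N = 2 * pi * real_of_int k" using assms by simp
    thus "x = 1" unfolding x_def by (simp add: cis_multiple_2pi)
  qed
  ultimately show ?thesis unfolding eq by (simp add: sum_gp_strict)
qed

lemma root_pt_orthogonal:
  assumes "k < N" "l < N"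
  shows "(\<Sum>j<N. root_pt N j ^ k * cnj (root_pt N j) ^ l) = (if k = l then of_nat N else 0)"
proof -
  have "cnj (root_pt N j) = inverse (root_pt N j)" for j
    by (simp add: root_pt_def cis_cnj cis_inverse)
  hence "root_pt N j ^ k * cnj (root_pt N j) ^ l = root_pt N j powi (int k - int l)" for j
    by (simp add: power_int_diff power_inverse divide_inverse)
  moreover have "int N dvd int k - int l \<longleftrightarrow> k = l"
  proof
    assume "int N dvd int k - int l"
    hence "int k mod int N = int l mod int N" by (simp add: mod_eq_dvd_iff)
    thus "k = l" using assms by simp
  qed simp
  ultimately show ?thesis using assms by (simp add: sum_root_pt_powi)
qed

lemma root_pt_coeff:
  assumes "l \<le> d" "d < N"
  shows "(\<Sum>j<N. (\<Sum>k\<le>d. b k * root_pt N j ^ k) * cnj (root_pt N j) ^ l) = of_nat N * b l"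
proof -
  have "(\<Sum>j<N. (\<Sum>k\<le>d. b k * root_pt N j ^ k) * cnj (root_pt N j) ^ l) =
    (\<Sum>k\<le>d. b k * (\<Sum>j<N. root_pt N j ^ k * cnj (root_pt N j) ^ l))"
    unfolding sum_distrib_right sum_distrib_left by (subst sum.swap) (simp add: mult_ac)
  also have "\<dots> = (\<Sum>k\<le>d. if k = l then b k * of_nat N else 0)"
    using assms by (intro sum.cong) (auto simp: root_pt_orthogonal)
  finally show ?thesis using assms by (simp add: mult_ac)
qed

text \<open>All frequencies lie strictly between 0 and \<open>N\<close>, so each of them averages to
  0.\<close>

lemma root_pt_coeff_zero:
  assumes "0 < l" "d + l < N"
  shows "(\<Sum>j<N. (\<Sum>k\<le>d. b k * root_pt N j ^ k) * root_pt N j ^ l) = 0"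
proof -
  have "(\<Sum>j<N. (\<Sum>k\<le>d. b k * root_pt N j ^ k) * root_pt N j ^ l) =
    (\<Sum>k\<le>d. b k * (\<Sum>j<N. root_pt N j ^ (k + l) * cnj (root_pt N j) ^ 0))"
    unfolding sum_distrib_right sum_distrib_left by (subst sum.swap) (simp add: mult_ac power_add)
  also have "\<dots> = 0"
    using assms by (intro sum.neutral ballI, subst root_pt_orthogonal) auto
  finally show ?thesis .
qed

text \<open>Cauchy's estimate, with a mean over roots of unity in place of the contour
  integral.\<close>

lemma norm_root_pt_coeff_le:
  assumes "l \<le> d" "d < N" "\<And>j. j < N \<Longrightarrow> cmod (\<Sum>k\<le>d. b k * root_pt N j ^ k) \<le> M"
  shows "cmod (b l) \<le> M"
proof -
  have "real N * cmod (b l) = cmod (\<Sum>j<N. (\<Sum>k\<le>d. b k * root_pt N j ^ k) * cnj (root_pt N j) ^ l)"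
    using root_pt_coeff[OF assms(1,2), of b] by (simp add: norm_mult)
  also have "\<dots> \<le> (\<Sum>j<N. M)"
    by (rule sum_norm_le) (use assms(3) in \<open>simp add: norm_mult norm_power\<close>)
  finally show ?thesis using assms(2) by simp
qed

lemma exists_phase: "\<exists>e. cmod e = 1 \<and> e * w = of_real (cmod w)"
proof (cases "w = 0")
  case False
  thus ?thesis
    by (intro exI[of _ "of_real (cmod w) / w"]) (simp add: norm_divide)
qed (auto intro: exI[of _ 1])

text \<open>Pairing with \<open>1 + \<i> t cos\<close>, of modulus at most \<open>sqrt (1 + t\<^sup>2)\<close>; as \<open>f\<close> has no negative
  frequencies, the phase of the cosine can be chosen so that both coefficients add up.\<close>

lemma two_coeffs_le_L1:
  fixes b :: "nat \<Rightarrow> complex"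
  assumes l: "0 < l" "l \<le> d" and N: "2 * d < N"
  defines "m \<equiv> (\<Sum>j<N. cmod (\<Sum>k\<le>d. b k * root_pt N j ^ k)) / real N"
  shows "(cmod (b 0))\<^sup>2 + (cmod (b l))\<^sup>2 / 4 \<le> m\<^sup>2"
proof -
  define f where "f j = (\<Sum>k\<le>d. b k * root_pt N j ^ k)" for j
  have N0: "N > 0" using N by simp
  have m: "m = (\<Sum>j<N. cmod (f j)) / real N" by (simp add: m_def f_def)
  have m0: "m \<ge> 0" unfolding m by (simp add: sum_nonneg)
  have key: "cmod (b 0) + t / 2 * cmod (b l) \<le> sqrt (1 + t\<^sup>2) * m" if t: "t \<ge> 0" for t
  proof -
    obtain e0 where e0: "cmod e0 = 1" "e0 * b 0 = of_real (cmod (b 0))" using exists_phase by blast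
    obtain e1 where e1: "cmod e1 = 1" "e1 * (\<i> * b l) = of_real (cmod (\<i> * b l))"
      using exists_phase by blast
    \<comment> \<open>This phase compensates \<open>e0\<close>: the rotation that makes the
      contribution of \<open>b 0\<close> nonnegative then does the same for that of
      \<open>b l\<close>.\<close>
    define e where "e = e1 * cnj e0"
    have e: "cmod e = 1" by (simp add: e_def norm_mult e0 e1)
    define h where "h j = 1 + \<i> * of_real (t * Re (e * cnj (root_pt N j) ^ l))" for j
    have h: "h j = 1 + \<i> * of_real t / 2 * (e * cnj (root_pt N j) ^ l + cnj e * root_pt N j ^ l)" for j
    proof -
      have "2 * complex_of_real (Re w) = w + cnj w" for w by (simp add: complex_eq_iff)
      from this[of "e * cnj (root_pt N j) ^ l"] show ?thesis
        by (simp add: h_def field_simps)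
    qed
    have norm_h: "cmod (h j) \<le> sqrt (1 + t\<^sup>2)" for j
    proof -
      have "\<bar>Re (e * cnj (root_pt N j) ^ l)\<bar> \<le> 1"
        using abs_Re_le_cmod[of "e * cnj (root_pt N j) ^ l"] by (simp add: norm_mult norm_power e)
      hence "(Re (e * cnj (root_pt N j) ^ l))\<^sup>2 \<le> 1" by (simp add: abs_square_le_1)
      hence "t\<^sup>2 * (Re (e * cnj (root_pt N j) ^ l))\<^sup>2 \<le> t\<^sup>2 * 1" by (intro mult_left_mono) auto
      thus ?thesis by (simp add: h_def cmod_def power_mult_distrib)
    qed
    have "(\<Sum>j<N. f j * h j) = (\<Sum>j<N. f j * cnj (root_pt N j) ^ 0)
       + \<i> * of_real t / 2 * (e * (\<Sum>j<N. f j * cnj (root_pt N j) ^ l)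
       + cnj e * (\<Sum>j<N. f j * root_pt N j ^ l))"
      unfolding h by (simp add: algebra_simps sum.distrib sum_distrib_left)
    also have "\<dots> = of_nat N * (b 0 + of_real t / 2 * (e * (\<i> * b l)))"
      unfolding f_def using l N
      by (subst root_pt_coeff root_pt_coeff root_pt_coeff_zero; (simp add: root_pt_coeff_zero root_pt_coeff)?)
         (simp add: algebra_simps)
    finally have "e0 * (\<Sum>j<N. f j * h j) = of_nat N * (e0 * b 0 + of_real t / 2 * ((e0 * cnj e0) * (e1 * (\<i> * b l))))"
      by (simp add: e_def algebra_simps)
    also have "e0 * cnj e0 = 1" using e0(1) by (simp add: complex_norm_square[symmetric])
    finally have eq: "e0 * (\<Sum>j<N. f j * h j) = of_real (real N * (cmod (b 0) + t / 2 * cmod (b l)))"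
      by (simp add: e0 e1 norm_mult)
    have "real N * (cmod (b 0) + t / 2 * cmod (b l)) = cmod (e0 * (\<Sum>j<N. f j * h j))"
      unfolding eq norm_of_real using t by simp
    also have "\<dots> = cmod (\<Sum>j<N. f j * h j)" by (simp add: norm_mult e0)
    also have "\<dots> \<le> (\<Sum>j<N. cmod (f j) * sqrt (1 + t\<^sup>2))"
      by (rule sum_norm_le) (simp add: norm_mult mult_left_mono norm_h)
    also have "\<dots> = real N * (sqrt (1 + t\<^sup>2) * m)"
      using N0 by (simp add: m sum_distrib_right[symmetric])
    finally show ?thesis using N0 by simp
  qed
  show ?thesis
  \<comment> \<open>Optimisation of \<open>key\<close> over \<open>t\<close>. With \<open>a\<close>
    and \<open>c\<close> the moduli of \<open>b 0\<close> and \<open>b l\<close>, the quotient of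
    \<open>a + t * c / 2\<close> by \<open>sqrt (1 + t\<^sup>2)\<close> is largest at
    \<open>t = c / (2 * a)\<close>. For \<open>a = 0\<close> the maximiser escapes to infinity, and
    there the plain coefficient bound suffices.\<close>
  proof (cases "b 0 = 0")
    case True
    have "real N * cmod (b l) = cmod (\<Sum>j<N. f j * cnj (root_pt N j) ^ l)"
      unfolding f_def using l N by (subst root_pt_coeff) (auto simp: norm_mult)
    also have "\<dots> \<le> (\<Sum>j<N. cmod (f j))"
      by (rule sum_norm_le) (simp add: norm_mult norm_power)
    also have "\<dots> = real N * m" using N0 by (simp add: m)
    finally have "cmod (b l) \<le> m" using N0 by simp
    hence "(cmod (b l))\<^sup>2 \<le> m\<^sup>2" by (intro power_mono) auto
    thus ?thesis using True by (simp add: sum_power2_ge_zero) (smt (verit) zero_le_power2)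
  next
    case False
    define a where "a = cmod (b 0)"
    define c where "c = cmod (b l)"
    have a: "a > 0" using False by (simp add: a_def)
    have "a + c / (2 * a) / 2 * c \<le> sqrt (1 + (c / (2 * a))\<^sup>2) * m"
      unfolding a_def c_def by (rule key) simp
    also have "sqrt (1 + (c / (2 * a))\<^sup>2) = sqrt (a\<^sup>2 + c\<^sup>2 / 4) / a"
    proof -
      have "1 + (c / (2 * a))\<^sup>2 = (a\<^sup>2 + c\<^sup>2 / 4) / a\<^sup>2" using a by (simp add: field_simps)
      thus ?thesis using a by (simp add: real_sqrt_divide)
    qed
    finally have "a * (a + c / (2 * a) / 2 * c) \<le> a * (sqrt (a\<^sup>2 + c\<^sup>2 / 4) / a * m)"
      using a by (intro mult_left_mono) auto
    moreover have "a * (a + c / (2 * a) / 2 * c) = a\<^sup>2 + c\<^sup>2 / 4"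
      using a by (simp add: field_simps power2_eq_square)
    ultimately have 1: "a\<^sup>2 + c\<^sup>2 / 4 \<le> sqrt (a\<^sup>2 + c\<^sup>2 / 4) * m"
      using a by simp
    have 2: "sqrt (a\<^sup>2 + c\<^sup>2 / 4) > 0" using a by (simp add: add_pos_nonneg)
    have "sqrt (a\<^sup>2 + c\<^sup>2 / 4) * sqrt (a\<^sup>2 + c\<^sup>2 / 4) = a\<^sup>2 + c\<^sup>2 / 4" by simp
    hence "sqrt (a\<^sup>2 + c\<^sup>2 / 4) \<le> m" using 1 2 by (metis mult_le_cancel_left_pos)
    hence "(sqrt (a\<^sup>2 + c\<^sup>2 / 4))\<^sup>2 \<le> m\<^sup>2" by (intro power_mono) (use 2 in auto)
    thus ?thesis by (simp add: a_def c_def)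
  qed
qed

text \<open>The random variable underlying the averages is \<open>0\<close> and a uniform root of unity with
  probability 1/2 each: index \<open>j < N\<close> stands for a root and \<open>N \<le> j < 2 N\<close> for \<open>0\<close>.\<close>

definition sample :: "nat \<Rightarrow> nat \<Rightarrow> complex" where
  "sample N j = (if j < N then root_pt N j else 0)"

lemma norm_sample_le: "cmod (sample N j) \<le> 1"
  by (simp add: sample_def)

lemma sum_sample:
  fixes g :: "complex \<Rightarrow> 'b::semiring_1"
  shows "(\<Sum>j<2 * N. g (sample N j)) = (\<Sum>j<N. g (root_pt N j)) + of_nat N * g 0"
proof -
  have "{..<2 * N} = {..<N} \<union> {N..<2 * N}" by auto
  hence "(\<Sum>j<2 * N. g (sample N j)) = (\<Sum>j<N. g (sample N j)) + (\<Sum>j=N..<2*N. g (sample N j))"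
    by (simp add: sum.union_disjoint ivl_disj_int)
  thus ?thesis by (simp add: sample_def)
qed

text \<open>The outcome 0 contributes \<open>a = cmod (b 0)\<close>, so the mean is
  \<open>(m + a) / 2\<close> with \<open>m\<close> the mean over the roots. As
  \<open>a \<le> m\<close>, the bound \<open>two_coeffs_le_L1\<close> survives this averaging with
  16 in place of 4, and the estimates for the single \<open>k\<close> are combined with weights
  \<open>16 * v k\<close> of total at most 1. That \<open>b 0\<close> keeps the weight 1 is what
  permits tensorisation.\<close>

lemma weighted_coeffs_le_L1_sample:
  fixes b :: "nat \<Rightarrow> complex"
  assumes N: "2 * d < N" and v: "\<And>k. k \<in> {1..d} \<Longrightarrow> v k \<ge> 0" "(\<Sum>k=1..d. v k) \<le> 1 / 16"
  shows "sqrt ((cmod (b 0))\<^sup>2 + (\<Sum>k=1..d. v k * (cmod (b k))\<^sup>2))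
    \<le> (\<Sum>j<2 * N. cmod (\<Sum>k\<le>d. b k * sample N j ^ k)) / (2 * real N)"
proof -
  define m where "m = (\<Sum>j<N. cmod (\<Sum>k\<le>d. b k * root_pt N j ^ k)) / real N"
  define a where "a = cmod (b 0)"
  have N0: "N > 0" using N by simp
  have a0: "a \<ge> 0" by (simp add: a_def)
  have am: "a \<le> m"
  proof -
    have "real N * a = cmod (\<Sum>j<N. (\<Sum>k\<le>d. b k * root_pt N j ^ k) * cnj (root_pt N j) ^ 0)"
      unfolding a_def using N by (subst root_pt_coeff) (auto simp: norm_mult)
    also have "\<dots> \<le> (\<Sum>j<N. cmod (\<Sum>k\<le>d. b k * root_pt N j ^ k))"
      by (rule sum_norm_le) simp
    finally show ?thesis using N0 by (simp add: m_def field_simps)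
  qed
  have "(\<Sum>j<2 * N. cmod (\<Sum>k\<le>d. b k * sample N j ^ k)) =
    (\<Sum>j<N. cmod (\<Sum>k\<le>d. b k * root_pt N j ^ k)) + real N * cmod (\<Sum>k\<le>d. b k * 0 ^ k)"
    by (rule sum_sample)
  also have "(\<Sum>k\<le>d. b k * 0 ^ k) = b 0" by (subst sum.atMost_shift) simp
  finally have E: "(\<Sum>j<2 * N. cmod (\<Sum>k\<le>d. b k * sample N j ^ k)) / (2 * real N) = (m + a) / 2"
    using N0 by (simp add: m_def a_def field_simps)
  have 1: "16 * v k * (a\<^sup>2 + (cmod (b k))\<^sup>2 / 16) \<le> 16 * v k * ((m + a) / 2)\<^sup>2" if k: "k \<in> {1..d}" for k
  proof (rule mult_left_mono)
    have "a\<^sup>2 + (cmod (b k))\<^sup>2 / 4 \<le> m\<^sup>2"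
      unfolding a_def m_def using k N by (intro two_coeffs_le_L1) auto
    moreover have "a * a \<le> m * a" using am a0 by (intro mult_right_mono)
    ultimately show "a\<^sup>2 + (cmod (b k))\<^sup>2 / 16 \<le> ((m + a) / 2)\<^sup>2"
      by (simp add: power2_eq_square field_simps)
  qed (use v(1)[OF k] in simp)
  have "(\<Sum>k=1..d. v k) * 16 * a\<^sup>2 + (\<Sum>k=1..d. v k * (cmod (b k))\<^sup>2) \<le> (\<Sum>k=1..d. v k) * 16 * ((m + a) / 2)\<^sup>2"
    using sum_mono[of "{1..d}", OF 1]
    by (simp add: algebra_simps sum.distrib sum_distrib_left sum_distrib_right)
  moreover have "(1 - (\<Sum>k=1..d. v k) * 16) * a\<^sup>2 \<le> (1 - (\<Sum>k=1..d. v k) * 16) * ((m + a) / 2)\<^sup>2"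
    using v(2) am a0 by (intro mult_left_mono power_mono) auto
  ultimately have "a\<^sup>2 + (\<Sum>k=1..d. v k * (cmod (b k))\<^sup>2) \<le> ((m + a) / 2)\<^sup>2"
    by (simp add: algebra_simps)
  thus ?thesis unfolding E a_def[symmetric]
    using am a0 by (intro real_le_lsqrt) auto
qed

section \<open>The coefficient norm against the mean of the polynomial\<close>

lemma binomial_le_between:
  assumes "a \<le> k" "k + a \<le> d"
  shows "d choose a \<le> d choose k"
proof (cases "2 * k \<le> d")
  case True
  thus ?thesis using assms by (intro binomial_mono) auto
next
  case False
  have "d choose a \<le> d choose (d - k)" using assms False by (intro binomial_mono) auto
  also have "\<dots> = d choose k" using assms by (intro binomial_symmetric[symmetric]) auto
  finally show ?thesis .
qed

text \<open>The terms \<open>k = 1\<close> and \<open>k = d - 1\<close> give \<open>2 / d\<close>.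
  The fewer than \<open>d - 1\<close> others are at most \<open>1 / (d choose 2)\<close> each and
  give at most \<open>2 / d\<close> again.\<close>

lemma sum_inverse_binomial_le:
  assumes "d \<ge> 1"
  shows "(\<Sum>k=1..<d. 1 / real (d choose k)) \<le> 4 / real d"
proof (cases "d \<le> 2")
  case True
  then consider "d = 1" | "d = 2" using assms by linarith
  thus ?thesis by cases (auto simp: numeral_2_eq_2)
next
  case False
  hence d: "d \<ge> 3" by simp
  have dd: "real (d choose 2) = real d * (real d - 1) / 2"
    using d by (simp add: choose_two real_of_nat_div of_nat_diff)
  have bd: "1 / real (d choose k) \<le> 2 / (real d * (real d - 1))" if "k \<in> {2..d-2}" for k
  proof -
    have "d choose 2 \<le> d choose k" using that by (intro binomial_le_between) auto
    hence "real (d choose 2) \<le> real (d choose k)" by simp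
    moreover have "real (d choose 2) > 0" using d by simp
    ultimately have "1 / real (d choose k) \<le> 1 / real (d choose 2)" by (simp add: frac_le)
    thus ?thesis by (simp add: dd)
  qed
  have "{1..<d} = insert 1 (insert (d - 1) {2..d-2})" using d by auto
  moreover have "1 \<noteq> d - 1" "1 \<notin> {2..d-2}" "d - 1 \<notin> {2..d-2}" using d by auto
  moreover have "d choose (d - 1) = d" using d binomial_symmetric[of 1 d] by simp
  ultimately have "(\<Sum>k=1..<d. 1 / real (d choose k)) =
    1 / real d + (1 / real d + (\<Sum>k=2..d-2. 1 / real (d choose k)))"
    by simp
  also have "(\<Sum>k=2..d-2. 1 / real (d choose k)) \<le> (\<Sum>k=2..d-2. 2 / (real d * (real d - 1)))"
    by (rule sum_mono) (rule bd)
  also have "\<dots> = (real d - 3) * (2 / (real d * (real d - 1)))"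
    using d by (simp add: of_nat_diff)
  also have "\<dots> \<le> (real d - 1) * (2 / (real d * (real d - 1)))"
    using d by (intro mult_right_mono) auto
  also have "\<dots> = 2 / real d" using d by (simp add: divide_simps)
  finally show ?thesis by simp
qed

text \<open>Any bounded sequence satisfying the recursive inequality below would do.\<close>

definition bombieri_const :: "nat \<Rightarrow> real" where
  "bombieri_const d = 17 ^ min d 128"

lemma bombieri_const_pos: "bombieri_const d > 0"
  by (simp add: bombieri_const_def)

lemma bombieri_const_le: "bombieri_const d \<le> 17 ^ 128"
  unfolding bombieri_const_def by (intro power_increasing) auto

text \<open>Up to degree 128 the sum is bounded by a geometric one of ratio 17. Beyond that the
  terms \<open>k < d\<close> add up to at most \<open>4 / d\<close> times the maximal constant, and
  \<open>16 * 4 / 128 = 1 / 2\<close> leaves room for the term \<open>k = d\<close>.\<close>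

lemma bombieri_const_recursion:
  assumes "d \<ge> 1"
  shows "16 * (\<Sum>k=1..d. bombieri_const (d - k) / real (d choose k)) \<le> bombieri_const d"
proof (cases "d \<le> 128")
  case True
  have "(\<Sum>k=1..d. bombieri_const (d - k) / real (d choose k)) \<le> (\<Sum>k=1..d. 17 ^ (d - k))"
  proof (rule sum_mono)
    fix k assume k: "k \<in> {1..d}"
    have "real (d choose k) \<ge> 1" using k by (simp add: Suc_leI)
    thus "bombieri_const (d - k) / real (d choose k) \<le> 17 ^ (d - k)"
      using True by (simp add: bombieri_const_def divide_le_eq mult_le_cancel_left1)
  qed
  also have "\<dots> = (\<Sum>k<d. 17 ^ k)"
    by (rule sum.reindex_bij_witness[of _ "\<lambda>k. d - k" "\<lambda>k. d - k"]) auto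
  also have "\<dots> = (17 ^ d - 1) / 16"
    by (subst geometric_sum) auto
  finally show ?thesis using True by (simp add: bombieri_const_def)
next
  case False
  have "{1..d} = insert d {1..<d}" using assms by auto
  hence "(\<Sum>k=1..d. bombieri_const (d - k) / real (d choose k)) =
     bombieri_const 0 + (\<Sum>k=1..<d. bombieri_const (d - k) / real (d choose k))"
    by simp
  also have "\<dots> \<le> 1 + (\<Sum>k=1..<d. 17 ^ 128 * (1 / real (d choose k)))"
    using bombieri_const_le
    by (intro add_mono sum_mono) (auto simp: bombieri_const_def[of 0] intro!: divide_right_mono)
  also have "\<dots> \<le> 1 + 17 ^ 128 * (4 / real d)"
    unfolding sum_distrib_left[symmetric] using assms
    by (intro add_mono mult_left_mono sum_inverse_binomial_le) auto
  also have "\<dots> \<le> 1 + 17 ^ 128 * (4 / 128)"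
    using False by (intro add_mono mult_left_mono divide_left_mono) auto
  also have "16 * \<dots> \<le> bombieri_const d"
    using False by (simp add: bombieri_const_def min_def)
  finally show ?thesis by simp
qed

section \<open>Means over independent samples\<close>

definition samples :: "nat \<Rightarrow> 'i set \<Rightarrow> ('i \<Rightarrow> nat) set" where
  "samples N I = PiE I (\<lambda>_. {..<2 * N})"

text \<open>An expectation over independent coordinates. Outcomes are index functions rather than
  points, so that the value 0 keeps its probability 1/2.\<close>

definition sample_mean :: "nat \<Rightarrow> 'i set \<Rightarrow> (('i \<Rightarrow> complex) \<Rightarrow> real) \<Rightarrow> real" where
  "sample_mean N I g = (\<Sum>\<phi>\<in>samples N I. g (\<lambda>i. sample N (\<phi> i))) / (2 * real N) ^ card I"

lemma sum_samples_insert: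
  fixes g :: "('i \<Rightarrow> nat) \<Rightarrow> 'b::comm_monoid_add"
  assumes "finite I" "i \<notin> I"
  shows "(\<Sum>\<phi>\<in>samples N (insert i I). g \<phi>) = (\<Sum>\<phi>\<in>samples N I. \<Sum>x<2 * N. g (\<phi>(i := x)))"
proof -
  have "(\<Sum>\<phi>\<in>samples N (insert i I). g \<phi>) =
    (\<Sum>(x, \<phi>)\<in>{..<2 * N} \<times> samples N I. g (\<phi>(i := x)))"
    unfolding samples_def PiE_insert_eq
    using inj_combinator[OF assms(2), of "\<lambda>_. {..<2 * N}"]
    by (subst sum.reindex) (auto simp: case_prod_unfold)
  also have "\<dots> = (\<Sum>x<2 * N. \<Sum>\<phi>\<in>samples N I. g (\<phi>(i := x)))"
    by (simp add: sum.cartesian_product)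
  finally show ?thesis by (subst (asm) sum.swap)
qed

lemma sample_mean_nonneg: "(\<And>z. g z \<ge> 0) \<Longrightarrow> sample_mean N I g \<ge> 0"
  by (simp add: sample_mean_def sum_nonneg)

text \<open>Minkowski's inequality, used to pull a mean out of a 2-norm.\<close>

lemma L2_set_sum_le: "L2_set (\<lambda>k. \<Sum>x\<in>X. a x k) K \<le> (\<Sum>x\<in>X. L2_set (a x) K)"
proof (induction X rule: infinite_finite_induct)
  case (insert x X)
  have "L2_set (\<lambda>k. \<Sum>x\<in>insert x X. a x k) K = L2_set (\<lambda>k. a x k + (\<Sum>x\<in>X. a x k)) K"
    using insert by simp
  also have "\<dots> \<le> L2_set (a x) K + L2_set (\<lambda>k. \<Sum>x\<in>X. a x k) K" by (rule L2_set_triangle_ineq)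
  finally show ?case using insert by simp
qed (auto simp: L2_set_0')

text \<open>The left side is the squared Bombieri norm of the polynomial. Induction on the
  variables: expand in powers of the new variable \<open>i\<close> and apply the hypothesis to the
  coefficient of each power. That coefficient carries the factor \<open>d choose k\<close> squared
  while its words occur \<open>d choose k\<close> times, so one binomial is gained; this gives the
  weights \<open>v k\<close>, with \<open>v 0 = 1\<close> and the others of sum at most 1/16 by the
  recursion. The constant depends on the degree only, not on the number of variables.\<close>

lemma coeffs_le_sample_mean:
  fixes t :: "'i list \<Rightarrow> complex"
  assumes "finite I"
  shows "2 * d < N \<Longrightarrow> symmetric_on d I t \<Longrightarrow>
    (\<Sum>J\<in>tuples d I. (cmod (t J))\<^sup>2) \<le> bombieri_const d * (sample_mean N I (\<lambda>z. cmod (hpoly d I t z)))\<^sup>2"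
  using assms
proof (induction I arbitrary: d t rule: finite_induct)
  case empty
  show ?case
  proof (cases "d = 0")
    case True
    thus ?thesis by (simp add: sample_mean_def samples_def hpoly_def bombieri_const_def)
  next
    case False
    thus ?thesis by (simp add: tuples_empty bombieri_const_pos less_imp_le)
  qed
next
  case (insert i I)
  define s where "s k = (\<lambda>J. of_nat (d choose k) * t (replicate k i @ J))" for k
  define f where "f k = hpoly (d - k) I (s k)" for k
  define e where "e k = sample_mean N I (\<lambda>z. cmod (f k z))" for k
  define v where "v k = bombieri_const (d - k) / (bombieri_const d * real (d choose k))" for k
  note N = insert.prems(1)
  have N0: "N > 0" using N by simp
  have e0: "e k \<ge> 0" for k unfolding e_def by (rule sample_mean_nonneg) simp
  have v0: "v k \<ge> 0" for k
    by (simp add: v_def bombieri_const_pos less_imp_le)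
  have sym_s: "symmetric_on (d - k) I (s k)" if "k \<le> d" for k
  proof -
    have "symmetric_on (d - k) I (\<lambda>J. t (replicate k i @ J))"
      using that by (intro symmetric_on_append[OF insert.prems(2), where k = k]) auto
    thus ?thesis unfolding s_def by (rule symmetric_on_comp)
  qed
  have "(\<Sum>J\<in>tuples d (insert i I). (cmod (t J))\<^sup>2) =
    (\<Sum>k\<le>d. real (d choose k) * (\<Sum>J\<in>tuples (d - k) I. (cmod (t (replicate k i @ J)))\<^sup>2))"
  proof (rule sum_tuples_insert)
    show "symmetric_on d (insert i I) (\<lambda>J. (cmod (t J))\<^sup>2)"
      by (rule symmetric_on_comp) (rule insert.prems(2))
  qed (use insert in auto)
  also have "\<dots> \<le> (\<Sum>k\<le>d. bombieri_const d * (v k * (e k)\<^sup>2))"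
  proof (rule sum_mono)
    fix k assume "k \<in> {..d}"
    hence k: "k \<le> d" by simp
    have c: "real (d choose k) > 0" using k by simp
    have "(\<Sum>J\<in>tuples (d - k) I. (cmod (s k J))\<^sup>2) \<le> bombieri_const (d - k) * (e k)\<^sup>2"
      unfolding e_def f_def using k N by (intro insert.IH sym_s) auto
    also have "(\<Sum>J\<in>tuples (d - k) I. (cmod (s k J))\<^sup>2) =
      (real (d choose k))\<^sup>2 * (\<Sum>J\<in>tuples (d - k) I. (cmod (t (replicate k i @ J)))\<^sup>2)"
      by (simp add: s_def norm_mult power_mult_distrib sum_distrib_left)
    finally show "real (d choose k) * (\<Sum>J\<in>tuples (d - k) I. (cmod (t (replicate k i @ J)))\<^sup>2)
        \<le> bombieri_const d * (v k * (e k)\<^sup>2)"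
      using c bombieri_const_pos[of d] by (simp add: v_def field_simps power2_eq_square)
  qed
  also have "\<dots> = bombieri_const d * (L2_set (\<lambda>k. sqrt (v k) * e k) {..d})\<^sup>2"
    by (simp add: L2_set_def sum_nonneg v0 power_mult_distrib sum_distrib_left)
  finally have main: "(\<Sum>J\<in>tuples d (insert i I). (cmod (t J))\<^sup>2) \<le>
    bombieri_const d * (L2_set (\<lambda>k. sqrt (v k) * e k) {..d})\<^sup>2" .
  \<comment> \<open>Minkowski moves the mean over the old variables outside; for each fixed outcome
    of these, the one-variable inequality is applied in the variable \<open>i\<close>.\<close>
  have "L2_set (\<lambda>k. sqrt (v k) * e k) {..d} \<le> sample_mean N (insert i I) (\<lambda>z. cmod (hpoly d (insert i I) t z))"
  proof -
    define D where "D = (2 * real N) ^ card I"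
    have D: "D > 0" using N0 by (simp add: D_def)
    have "L2_set (\<lambda>k. sqrt (v k) * e k) {..d} =
      L2_set (\<lambda>k. \<Sum>\<phi>\<in>samples N I. sqrt (v k) * cmod (f k (\<lambda>i. sample N (\<phi> i))) / D) {..d}"
      by (simp add: e_def sample_mean_def D_def sum_distrib_left sum_divide_distrib)
    also have "\<dots> \<le> (\<Sum>\<phi>\<in>samples N I. L2_set (\<lambda>k. sqrt (v k) * cmod (f k (\<lambda>i. sample N (\<phi> i))) / D) {..d})"
      by (rule L2_set_sum_le)
    also have "\<dots> \<le> (\<Sum>\<phi>\<in>samples N I. (\<Sum>x<2 * N.
      cmod (hpoly d (insert i I) t (\<lambda>j. sample N ((\<phi>(i := x)) j)))) / (2 * real N) / D)"
    proof (rule sum_mono)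
      fix \<phi> assume "\<phi> \<in> samples N I"
      define b where "b k = f k (\<lambda>i. sample N (\<phi> i))" for k
      have h: "hpoly d (insert i I) t (\<lambda>j. sample N ((\<phi>(i := x)) j)) = (\<Sum>k\<le>d. b k * sample N x ^ k)" for x
      proof -
        have "hpoly (d - k) I (s k) (\<lambda>j. sample N ((\<phi>(i := x)) j)) = b k" for k
          unfolding b_def f_def using insert.hyps by (intro hpoly_cong) auto
        thus ?thesis using insert
          by (subst hpoly_insert) (auto simp: s_def mult_ac)
      qed
      have "L2_set (\<lambda>k. sqrt (v k) * cmod (b k) / D) {..d} =
        L2_set (\<lambda>k. sqrt (v k) * cmod (b k)) {..d} / D"
        using L2_set_left_distrib[of "1 / D" "\<lambda>k. sqrt (v k) * cmod (b k)" "{..d}"] D by simp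
      also have "L2_set (\<lambda>k. sqrt (v k) * cmod (b k)) {..d} = sqrt (\<Sum>k\<le>d. v k * (cmod (b k))\<^sup>2)"
        by (simp add: L2_set_def power_mult_distrib v0)
      also have "(\<Sum>k\<le>d. v k * (cmod (b k))\<^sup>2) = (cmod (b 0))\<^sup>2 + (\<Sum>k=1..d. v k * (cmod (b k))\<^sup>2)"
      proof -
        have "{..d} = insert 0 {1..d}" by auto
        thus ?thesis using bombieri_const_pos[of d] by (simp add: v_def)
      qed
      also have "sqrt ((cmod (b 0))\<^sup>2 + (\<Sum>k=1..d. v k * (cmod (b k))\<^sup>2)) \<le>
        (\<Sum>x<2 * N. cmod (\<Sum>k\<le>d. b k * sample N x ^ k)) / (2 * real N)"
      proof (rule weighted_coeffs_le_L1_sample[OF N v0])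
        show "(\<Sum>k=1..d. v k) \<le> 1 / 16"
        proof (cases "d = 0")
          case False
          have "(\<Sum>k=1..d. v k) = (\<Sum>k=1..d. bombieri_const (d - k) / real (d choose k)) / bombieri_const d"
            by (simp add: v_def sum_divide_distrib mult.commute)
          also have "\<dots> \<le> (bombieri_const d / 16) / bombieri_const d"
            using bombieri_const_recursion[of d] False bombieri_const_pos[of d]
            by (intro divide_right_mono) auto
          finally show ?thesis using bombieri_const_pos[of d] by simp
        qed simp
      qed
      finally have "L2_set (\<lambda>k. sqrt (v k) * cmod (b k) / D) {..d} \<le>
        (\<Sum>x<2 * N. cmod (\<Sum>k\<le>d. b k * sample N x ^ k)) / (2 * real N) / D"
        using D by (simp add: divide_right_mono)
      thus "L2_set (\<lambda>k. sqrt (v k) * cmod (f k (\<lambda>i. sample N (\<phi> i))) / D) {..d} \<le>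
        (\<Sum>x<2 * N. cmod (hpoly d (insert i I) t (\<lambda>j. sample N ((\<phi>(i := x)) j)))) / (2 * real N) / D"
        unfolding h b_def .
    qed
    also have "\<dots> = sample_mean N (insert i I) (\<lambda>z. cmod (hpoly d (insert i I) t z))"
      unfolding sample_mean_def sum_samples_insert[OF insert.hyps(1,2)]
      using insert.hyps by (simp add: D_def sum_divide_distrib)
    finally show ?thesis .
  qed
  hence "(L2_set (\<lambda>k. sqrt (v k) * e k) {..d})\<^sup>2 \<le>
    (sample_mean N (insert i I) (\<lambda>z. cmod (hpoly d (insert i I) t z)))\<^sup>2"
    by (intro power_mono) auto
  with main show ?case using bombieri_const_pos[of d]
    by (meson mult_left_mono order.trans less_imp_le)
qed

section \<open>Extraction of pure powers\<close>

lemma prod_list_map_count: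
  fixes f :: "'i \<Rightarrow> 'b::comm_monoid_mult"
  assumes "finite I" "set J \<subseteq> I"
  shows "prod_list (map f J) = (\<Prod>i\<in>I. f i ^ count_list J i)"
  using assms(2)
proof (induction J)
  case (Cons j J)
  have j: "j \<in> I" and IH: "prod_list (map f J) = (\<Prod>i\<in>I. f i ^ count_list J i)"
    using Cons by simp_all
  have "(\<Prod>i\<in>I - {j}. f i ^ count_list (j # J) i) = (\<Prod>i\<in>I - {j}. f i ^ count_list J i)"
    by (rule prod.cong) auto
  moreover have "f j ^ count_list (j # J) j = f j * f j ^ count_list J j" by simp
  ultimately show ?case
    using prod.remove[OF assms(1) j, of "\<lambda>i. f i ^ count_list J i"]
      prod.remove[OF assms(1) j, of "\<lambda>i. f i ^ count_list (j # J) i"]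
    by (simp only: IH list.map prod_list.Cons mult.assoc)
qed simp

lemma count_list_eq_length_iff: "count_list J i = length J \<longleftrightarrow> J = replicate (length J) i"
proof (induction J)
  case (Cons j J)
  thus ?case using count_le_length[of J i] by (auto simp: Suc_le_eq)
qed simp

lemma count_list_replicate: "count_list (replicate k i) j = (if i = j then k else 0)"
  by (induction k) auto

definition polydisc_bound :: "nat \<Rightarrow> 'i set \<Rightarrow> ('i list \<Rightarrow> complex) \<Rightarrow> real \<Rightarrow> bool" where
  "polydisc_bound d I t M \<longleftrightarrow> (\<forall>z. (\<forall>i\<in>I. cmod (z i) \<le> 1) \<longrightarrow> cmod (hpoly d I t z) \<le> M)"

lemma polydisc_boundD:
  "polydisc_bound d I t M \<Longrightarrow> (\<And>i. i \<in> I \<Longrightarrow> cmod (z i) \<le> 1) \<Longrightarrow> cmod (hpoly d I t z) \<le> M"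
  unfolding polydisc_bound_def by blast

lemma polydisc_bound_nonneg: "polydisc_bound d I t M \<Longrightarrow> M \<ge> 0"
  by (rule order.trans[OF norm_ge_zero polydisc_boundD[of d I t M "\<lambda>_. 0"]]) auto

lemma exists_root_phase:
  assumes "k > 0"
  shows "\<exists>e. cmod e = 1 \<and> e ^ k * w = of_real (cmod w)"
proof -
  obtain e where e: "cmod e = 1" "e * w = of_real (cmod w)" using exists_phase by blast
  have "e \<noteq> 0" using e(1) by auto
  hence "e = cis (Arg e)" using e(1) cis_Arg[of e] by (simp add: sgn_eq)
  moreover have "cis (Arg e / real k) ^ k = cis (Arg e)" using assms by (simp add: Complex.DeMoivre)
  ultimately show ?thesis using e(2) by (intro exI[of _ "cis (Arg e / real k)"]) auto
qed

text \<open>Averaging over independent \<open>k\<close>-th roots of unity kills every monomial of degree \<open>k\<close>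
  except the pure powers.\<close>

lemma sum_pure_coeffs_le:
  assumes fin: "finite I" and k: "k > 0" and bound: "polydisc_bound k I s M"
  shows "(\<Sum>i\<in>I. cmod (s (replicate k i))) \<le> M"
proof -
  \<comment> \<open>These phases make every pure coefficient contribute its modulus, so the
    surviving terms cannot cancel.\<close>
  have "\<exists>e. \<forall>i. cmod (e i) = 1 \<and> e i ^ k * s (replicate k i) = of_real (cmod (s (replicate k i)))"
    by (rule choice) (use exists_root_phase[OF k] in blast)
  then obtain e where e: "\<And>i. cmod (e i) = 1"
    "\<And>i. e i ^ k * s (replicate k i) = of_real (cmod (s (replicate k i)))" by blast
  define \<Psi> where "\<Psi> = PiE I (\<lambda>_. {..<k})"
  define y where "y \<psi> i = e i * root_pt k (\<psi> i)" for \<psi> i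
  have fin\<Psi>: "finite \<Psi>" and card\<Psi>: "card \<Psi> = k ^ card I"
    using fin by (simp_all add: \<Psi>_def finite_PiE card_PiE)
  have mono: "(\<Sum>\<psi>\<in>\<Psi>. prod_list (map (y \<psi>) J)) =
    (if \<exists>i. J = replicate k i then of_nat (k ^ card I) * prod_list (map e J) else 0)"
    if J: "J \<in> tuples k I" for J
  proof -
    have sJ: "set J \<subseteq> I" and lJ: "length J = k" using J by (auto simp: tuples_def)
    have "prod_list (map (y \<psi>) J) = prod_list (map e J) * prod_list (map (\<lambda>i. root_pt k (\<psi> i)) J)" for \<psi>
      by (induction J) (auto simp: y_def)
    hence "(\<Sum>\<psi>\<in>\<Psi>. prod_list (map (y \<psi>) J)) =
      prod_list (map e J) * (\<Sum>\<psi>\<in>\<Psi>. \<Prod>i\<in>I. root_pt k (\<psi> i) ^ count_list J i)"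
      by (simp add: sum_distrib_left prod_list_map_count[OF fin sJ, of "\<lambda>i. root_pt k (_ i)"])
    also have "(\<Sum>\<psi>\<in>\<Psi>. \<Prod>i\<in>I. root_pt k (\<psi> i) ^ count_list J i) =
      (\<Prod>i\<in>I. \<Sum>x<k. root_pt k x ^ count_list J i)"
      unfolding \<Psi>_def by (rule prod_sum_PiE[symmetric]) (use fin in auto)
    also have "\<dots> = (\<Prod>i\<in>I. if k dvd count_list J i then of_nat k else 0)"
      using sum_root_pt_powi[OF k, of "int (count_list J _)"] by (intro prod.cong) auto
    also have "\<dots> = (if \<exists>i. J = replicate k i then of_nat (k ^ card I) else 0)"
    proof (cases "\<exists>i. J = replicate k i")
      case True
      then obtain i where i: "J = replicate k i" by blast
      have "k dvd count_list J j" for j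
        by (simp add: i count_list_replicate)
      thus ?thesis using True by simp
    next
      case False
      \<comment> \<open>Some letter occurs, but fewer than \<open>k\<close> times; its sum over the
        roots of unity vanishes, and with it the whole product.\<close>
      obtain i where i: "i \<in> set J" using lJ k by (cases J) auto
      have "count_list J i \<noteq> 0" using i by (simp add: count_list_0_iff)
      moreover have "count_list J i \<le> k" using count_le_length[of J i] lJ by simp
      moreover have "count_list J i \<noteq> k" using False count_list_eq_length_iff[of J i] lJ by auto
      ultimately have "\<not> k dvd count_list J i" by (auto dest: dvd_imp_le)
      hence "(\<Prod>i\<in>I. if k dvd count_list J i then of_nat k else (0::complex)) = 0"
        using i sJ fin by (intro prod_zero) auto
      thus ?thesis by (simp only: if_not_P[OF False])
    qed
    finally show ?thesis by simp
  qed
  have "(\<Sum>\<psi>\<in>\<Psi>. hpoly k I s (y \<psi>)) = (\<Sum>J\<in>tuples k I. s J * (\<Sum>\<psi>\<in>\<Psi>. prod_list (map (y \<psi>) J)))"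
    unfolding hpoly_def by (subst sum.swap) (simp add: sum_distrib_left)
  also have "\<dots> = (\<Sum>J\<in>tuples k I. if J \<in> replicate k ` I
      then s J * (of_nat (k ^ card I) * prod_list (map e J)) else 0)"
  proof (rule sum.cong)
    fix J assume J: "J \<in> tuples k I"
    have "(\<exists>i. J = replicate k i) \<longleftrightarrow> J \<in> replicate k ` I" using J k by auto
    thus "s J * (\<Sum>\<psi>\<in>\<Psi>. prod_list (map (y \<psi>) J)) = (if J \<in> replicate k ` I
      then s J * (of_nat (k ^ card I) * prod_list (map e J)) else 0)" by (simp add: mono[OF J])
  qed simp
  also have "\<dots> = (\<Sum>J\<in>replicate k ` I. s J * (of_nat (k ^ card I) * prod_list (map e J)))"
    using fin by (subst sum.inter_restrict[symmetric]) (auto intro!: sum.cong)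
  also have "\<dots> = (\<Sum>i\<in>I. s (replicate k i) * (of_nat (k ^ card I) * prod_list (map e (replicate k i))))"
    using k by (subst sum.reindex) (auto simp: inj_on_def replicate_eq_replicate)
  also have "\<dots> = (\<Sum>i\<in>I. of_nat (k ^ card I) * (e i ^ k * s (replicate k i)))"
  proof -
    have "prod_list (map e (replicate k i)) = e i ^ k" for i by (induction k) auto
    thus ?thesis by (simp add: mult_ac)
  qed
  also have "\<dots> = of_real (real (k ^ card I) * (\<Sum>i\<in>I. cmod (s (replicate k i))))"
    by (simp add: e sum_distrib_left)
  finally have eq: "(\<Sum>\<psi>\<in>\<Psi>. hpoly k I s (y \<psi>)) =
    of_real (real (k ^ card I) * (\<Sum>i\<in>I. cmod (s (replicate k i))))" .
  have "real (k ^ card I) * (\<Sum>i\<in>I. cmod (s (replicate k i))) = cmod (\<Sum>\<psi>\<in>\<Psi>. hpoly k I s (y \<psi>))"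
    unfolding eq norm_of_real by (simp add: sum_nonneg)
  also have "\<dots> \<le> (\<Sum>\<psi>\<in>\<Psi>. M)"
    by (intro sum_norm_le polydisc_boundD[OF bound]) (simp add: y_def norm_mult e)
  also have "\<dots> = real (k ^ card I) * M" by (simp add: card\<Psi>)
  finally show ?thesis using k by simp
qed

text \<open>The coefficients of the polynomial in the other variables that multiplies
  \<open>z i ^ k\<close>; the binomial counts the positions of the \<open>k\<close> letters
  \<open>i\<close>.\<close>

definition power_coeff :: "nat \<Rightarrow> ('i list \<Rightarrow> complex) \<Rightarrow> nat \<Rightarrow> 'i \<Rightarrow> 'i list \<Rightarrow> complex" where
  "power_coeff d t k i J = of_nat (d choose k) * t (replicate k i @ J)"

text \<open>Replace the vanishing coordinates of \<open>z\<close> by free variables \<open>y\<close>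
  in the polydisc. The part of degree \<open>k\<close> in \<open>y\<close> is still bounded by
  \<open>M\<close> by Cauchy's estimate, and its pure coefficients are exactly the summands, because
  \<open>z\<close> is 0 at the other vanishing coordinates. Hence \<open>sum_pure_coeffs_le\<close>
  applies.\<close>

lemma sum_power_coeff_vanishing_le:
  assumes fin: "finite I" and sym: "symmetric_on d I t" and k: "0 < k" "k \<le> d"
    and bound: "polydisc_bound d I t M" and z: "\<And>i. i \<in> I \<Longrightarrow> cmod (z i) \<le> 1"
  shows "(\<Sum>i\<in>{i \<in> I. z i = 0}. cmod (hpoly (d - k) (I - {i}) (power_coeff d t k i) z)) \<le> M"
proof -
  define B where "B = {i \<in> I. z i = 0}"
  define A where "A = I - B"
  define s where "s l K = of_nat (d choose l) * hpoly (d - l) A (\<lambda>J. t (K @ J)) z" for l K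
  have I: "I = A \<union> B" and disj: "A \<inter> B = {}" and finAB: "finite A" "finite B"
    using fin by (auto simp: A_def B_def)
  have "polydisc_bound k B (s k) M"
    unfolding polydisc_bound_def
  proof (intro allI impI)
    fix y :: "'a \<Rightarrow> complex" assume y: "\<forall>i\<in>B. cmod (y i) \<le> 1"
    have "cmod (\<Sum>l\<le>d. hpoly l B (s l) y * root_pt (Suc d) j ^ l) \<le> M" for j
    proof -
      define w where "w i = (if i \<in> B then root_pt (Suc d) j * y i else z i)" for i
      have "hpoly d (A \<union> B) t w =
        (\<Sum>l\<le>d. hpoly l B (\<lambda>K. of_nat (d choose l) * hpoly (d - l) A (\<lambda>J. t (K @ J)) w) w)"
        by (rule hpoly_Un) (use finAB disj sym I in auto)
      also have "\<dots> = (\<Sum>l\<le>d. hpoly l B (s l) y * root_pt (Suc d) j ^ l)"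
      proof (intro sum.cong refl)
        fix l
        have "hpoly (d - l) A (\<lambda>J. t (K @ J)) w = hpoly (d - l) A (\<lambda>J. t (K @ J)) z" for K
          by (rule hpoly_cong) (use disj in \<open>auto simp: w_def\<close>)
        moreover have "hpoly l B (s l) w = hpoly l B (s l) (\<lambda>i. root_pt (Suc d) j * y i)"
          by (rule hpoly_cong) (auto simp: w_def)
        ultimately show "hpoly l B (\<lambda>K. of_nat (d choose l) * hpoly (d - l) A (\<lambda>J. t (K @ J)) w) w =
          hpoly l B (s l) y * root_pt (Suc d) j ^ l"
          by (simp add: s_def[abs_def] hpoly_scale)
      qed
      finally have "(\<Sum>l\<le>d. hpoly l B (s l) y * root_pt (Suc d) j ^ l) = hpoly d I t w" by (simp add: I)
      moreover have "cmod (hpoly d I t w) \<le> M"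
        by (intro polydisc_boundD[OF bound]) (use z y in \<open>auto simp: w_def norm_mult\<close>)
      ultimately show ?thesis by simp
    qed
    thus "cmod (hpoly k B (s k) y) \<le> M"
      by (intro norm_root_pt_coeff_le[of k d "Suc d" "\<lambda>l. hpoly l B (s l) y"]) (use k in auto)
  qed
  hence "(\<Sum>i\<in>B. cmod (s k (replicate k i))) \<le> M"
    by (rule sum_pure_coeffs_le[OF finAB(2) k(1)])
  moreover have "s k (replicate k i) = hpoly (d - k) (I - {i}) (power_coeff d t k i) z" if "i \<in> B" for i
  proof -
    have "hpoly (d - k) (I - {i}) (power_coeff d t k i) z = hpoly (d - k) A (power_coeff d t k i) z"
      by (rule hpoly_superset) (use fin that in \<open>auto simp: A_def B_def\<close>)
    also have "\<dots> = s k (replicate k i)"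
      by (simp add: s_def power_coeff_def[abs_def] hpoly_scale_coeff)
    finally show ?thesis by simp
  qed
  ultimately show ?thesis by (simp add: B_def)
qed

text \<open>The preceding bound is averaged over random \<open>z\<close>. The summand for
  \<open>i\<close> does not involve \<open>z i\<close>, which vanishes with probability 1/2
  independently of the rest; this accounts for the factor 2.\<close>

lemma sum_sample_mean_power_coeff_le:
  assumes fin: "finite I" and sym: "symmetric_on d I t" and k: "0 < k" "k \<le> d"
    and bound: "polydisc_bound d I t M" and N: "N > 0"
  shows "(\<Sum>i\<in>I. sample_mean N (I - {i}) (\<lambda>z. cmod (hpoly (d - k) (I - {i}) (power_coeff d t k i) z))) \<le> 2 * M"
proof (cases "I = {}")
  case True
  thus ?thesis using polydisc_bound_nonneg[OF bound] by simp
next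
  case False
  define g where "g i \<phi> = cmod (hpoly (d - k) (I - {i}) (power_coeff d t k i) (\<lambda>j. sample N (\<phi> j)))" for i \<phi>
  define D where "D = (2 * real N) ^ card I"
  have D: "D > 0" using N by (simp add: D_def)
  have eq: "(\<Sum>\<phi>\<in>samples N I. if sample N (\<phi> i) = 0 then g i \<phi> else 0) =
    D / 2 * sample_mean N (I - {i}) (\<lambda>z. cmod (hpoly (d - k) (I - {i}) (power_coeff d t k i) z))"
    if i: "i \<in> I" for i
  proof -
    have I: "I = insert i (I - {i})" using i by auto
    have "(\<Sum>\<phi>\<in>samples N (insert i (I - {i})). if sample N (\<phi> i) = 0 then g i \<phi> else 0) =
      (\<Sum>\<phi>\<in>samples N (I - {i}). \<Sum>x<2 * N. if sample N x = 0 then g i (\<phi>(i := x)) else 0)"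
      by (subst sum_samples_insert) (use fin in auto)
    also have "\<dots> = (\<Sum>\<phi>\<in>samples N (I - {i}). \<Sum>x<2 * N. if sample N x = 0 then g i \<phi> else 0)"
    proof -
      have upd: "g i (\<phi>(i := x)) = g i \<phi>" for \<phi> x
        unfolding g_def by (intro arg_cong[where f = cmod] hpoly_cong) auto
      show ?thesis by (simp only: upd)
    qed
    also have "\<dots> = (\<Sum>\<phi>\<in>samples N (I - {i}). real N * g i \<phi>)"
    proof -
      have "(\<Sum>x<2 * N. if sample N x = 0 then c else 0) = real N * c" for c :: real
        using sum_sample[where g = "\<lambda>x. if x = 0 then c else 0" and N = N] by simp
      thus ?thesis by simp
    qed
    also have "\<dots> = D / 2 * ((\<Sum>\<phi>\<in>samples N (I - {i}). g i \<phi>) / (2 * real N) ^ card (I - {i}))"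
    proof -
      have "card I = Suc (card (I - {i}))" using card_Suc_Diff1[OF fin i] by simp
      hence "D = 2 * real N * (2 * real N) ^ card (I - {i})" by (simp add: D_def)
      thus ?thesis using N by (simp add: sum_distrib_left[symmetric])
    qed
    finally show ?thesis using I by (simp add: sample_mean_def g_def)
  qed
  have "D / 2 * (\<Sum>i\<in>I. sample_mean N (I - {i}) (\<lambda>z. cmod (hpoly (d - k) (I - {i}) (power_coeff d t k i) z))) =
    (\<Sum>\<phi>\<in>samples N I. \<Sum>i\<in>I. if sample N (\<phi> i) = 0 then g i \<phi> else 0)"
    unfolding sum_distrib_left by (subst sum.swap) (intro sum.cong refl eq[symmetric])
  also have "\<dots> \<le> (\<Sum>\<phi>\<in>samples N I. M)"
  proof (rule sum_mono)
    fix \<phi> assume "\<phi> \<in> samples N I"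
    have "(\<Sum>i\<in>I. if sample N (\<phi> i) = 0 then g i \<phi> else 0) = (\<Sum>i\<in>{i \<in> I. sample N (\<phi> i) = 0}. g i \<phi>)"
      using fin by (simp add: sum.inter_filter)
    also have "\<dots> \<le> M" unfolding g_def
      by (rule sum_power_coeff_vanishing_le[OF fin sym k bound]) (rule norm_sample_le)
    finally show "(\<Sum>i\<in>I. if sample N (\<phi> i) = 0 then g i \<phi> else 0) \<le> M" .
  qed
  also have "\<dots> = D * M" using fin by (simp add: samples_def card_PiE D_def)
  finally show ?thesis using D by (simp add: field_simps)
qed

section \<open>Row norms\<close>

text \<open>Cauchy-Schwarz and \<open>sum_inverse_binomial_le\<close> bound the terms below
  \<open>k = d\<close> by 2; the last term is 1.\<close>

lemma sum_inverse_sqrt_binomial_le: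
  assumes "d \<ge> 1"
  shows "(\<Sum>k=1..d. 1 / sqrt (real (d choose k))) \<le> 3"
proof -
  have "(\<Sum>k=1..<d. 1 / sqrt (real (d choose k))) \<le> L2_set (\<lambda>k. 1 / sqrt (real (d choose k))) {1..<d} * L2_set (\<lambda>_. 1) {1..<d}"
    using L2_set_mult_ineq[of "\<lambda>k. 1 / sqrt (real (d choose k))" "\<lambda>_. 1" "{1..<d}"] by simp
  also have "L2_set (\<lambda>k. 1 / sqrt (real (d choose k))) {1..<d} = sqrt (\<Sum>k=1..<d. 1 / real (d choose k))"
    by (simp add: L2_set_def power_divide)
  also have "L2_set (\<lambda>_. 1) {1..<d} = sqrt (real (d - 1))"
    by (simp add: L2_set_constant)
  also have "sqrt (\<Sum>k=1..<d. 1 / real (d choose k)) * sqrt (real (d - 1)) \<le> sqrt (4 / real d) * sqrt (real d)"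
    using sum_inverse_binomial_le[OF assms] assms by (intro mult_mono) auto
  also have "\<dots> = sqrt 4" using assms by (simp flip: real_sqrt_mult)
  also have "\<dots> = 2" by simp
  finally have "(\<Sum>k=1..<d. 1 / sqrt (real (d choose k))) \<le> 2" .
  moreover have "{1..d} = insert d {1..<d}" using assms by auto
  ultimately show ?thesis by simp
qed

text \<open>The four outer terms are at most \<open>1 / sqrt d\<close> each. The
  \<open>d - 5\<close> remaining binomials are at least \<open>d choose 3\<close>, which is of cubic
  order, so their terms add up to at most \<open>3 / sqrt d\<close>.\<close>

lemma sum_inverse_sqrt_binomial_interior_le:
  assumes "d \<ge> 6"
  shows "(\<Sum>k=1..<d. 1 / sqrt (real (d choose k))) \<le> 7 / sqrt (real d)"
proof -
  have b1: "d choose (d - 1) = d" using assms binomial_symmetric[of 1 d] by simp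
  have b2: "d choose (d - 2) = d choose 2" using assms binomial_symmetric[of 2 d] by simp
  have c2: "real (d choose 2) = real d * (real d - 1) / 2"
    using assms by (simp add: choose_two real_of_nat_div of_nat_diff)
  have c2': "real (d - 1 choose 2) = (real d - 1) * (real d - 2) / 2"
    using assms by (simp add: choose_two real_of_nat_div of_nat_diff)
  have "3 * (d choose 3) = d * (d - 1 choose 2)"
    using times_binomial_minus1_eq[of 3 d] by simp
  hence "real (3 * (d choose 3)) = real (d * (d - 1 choose 2))" by (simp only:)
  hence "3 * real (d choose 3) = real d * ((real d - 1) * (real d - 2) / 2)"
    by (simp only: of_nat_mult c2' of_nat_numeral)
  hence c3: "real (d choose 3) = real d * ((real d - 1) * (real d - 2)) / 6"
    by simp
  have t2: "1 / sqrt (real (d choose 2)) \<le> 1 / sqrt (real d)"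
  proof -
    have "real d * 2 \<le> real d * (real d - 1)" using assms by (intro mult_left_mono) auto
    hence "real d \<le> real (d choose 2)" by (simp add: c2)
    thus ?thesis using assms by (intro divide_left_mono) auto
  qed
  have t3: "1 / sqrt (real (d choose k)) \<le> 3 / ((real d - 5) * sqrt (real d))" if k: "k \<in> {3..d-3}" "d > 5" for k
  proof -
    have "d choose 3 \<le> d choose k" using k by (intro binomial_le_between) auto
    hence "real (d choose 3) \<le> real (d choose k)" by simp
    moreover have "((real d - 5) / 3)\<^sup>2 * real d \<le> real (d choose 3)"
    proof -
      have "(real d - 5)\<^sup>2 \<le> (real d - 1) * (real d - 2)"
        using assms unfolding power2_eq_square by (intro mult_mono) auto
      moreover have "(real d - 5)\<^sup>2 \<ge> 0" by simp
      ultimately have "(real d - 5)\<^sup>2 / 9 \<le> (real d - 1) * (real d - 2) / 6" by linarith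
      hence "(real d - 5)\<^sup>2 / 9 * real d \<le> (real d - 1) * (real d - 2) / 6 * real d"
        by (intro mult_right_mono) auto
      thus ?thesis by (simp add: c3 power_divide mult_ac)
    qed
    ultimately have "sqrt (((real d - 5) / 3)\<^sup>2 * real d) \<le> sqrt (real (d choose k))" by simp
    hence "(real d - 5) / 3 * sqrt (real d) \<le> sqrt (real (d choose k))"
      using k by (simp add: real_sqrt_mult)
    moreover have "(real d - 5) / 3 * sqrt (real d) > 0" using k by simp
    ultimately have "1 / sqrt (real (d choose k)) \<le> 1 / ((real d - 5) / 3 * sqrt (real d))"
      using k by (intro divide_left_mono mult_pos_pos) auto
    thus ?thesis by simp
  qed
  have dset: "{1..<d} = insert 1 (insert 2 (insert (d - 1) (insert (d - 2) {3..d-3})))" using assms by auto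
  have "1 \<notin> insert 2 (insert (d - 1) (insert (d - 2) {3..d-3}))" "2 \<notin> insert (d - 1) (insert (d - 2) {3..d-3})"
    "d - 1 \<notin> insert (d - 2) {3..d-3}" "d - 2 \<notin> {3..d-3}" using assms by auto
  hence "(\<Sum>k=1..<d. 1 / sqrt (real (d choose k))) = 1 / sqrt (real d) + (1 / sqrt (real (d choose 2)) +
     (1 / sqrt (real d) + (1 / sqrt (real (d choose 2)) + (\<Sum>k=3..d-3. 1 / sqrt (real (d choose k))))))"
    unfolding dset by (simp only: sum.insert finite_insert finite_atLeastAtMost b1 b2 choose_one simp_thms not_False_eq_True)
  also have "\<dots> \<le> 1 / sqrt (real d) + (1 / sqrt (real d) + (1 / sqrt (real d) + (1 / sqrt (real d) +
     (\<Sum>k=3..d-3. 3 / ((real d - 5) * sqrt (real d))))))"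
    by (intro add_mono order.refl t2 sum_mono t3) (use assms in auto)
  also have "(\<Sum>k=3..d-3. 3 / ((real d - 5) * sqrt (real d))) = 3 / sqrt (real d)"
    using assms by (simp add: of_nat_diff divide_simps)
  finally show ?thesis by simp
qed

text \<open>The factor 2 comes from decoupling, the root from the uniform bound on
  \<open>bombieri_const\<close>.\<close>

definition L1_const :: real where "L1_const = 2 * sqrt (17 ^ 128)"

lemma L1_const_pos: "L1_const > 0"
  by (simp add: L1_const_def)

definition row_norm :: "nat \<Rightarrow> 'i set \<Rightarrow> ('i list \<Rightarrow> complex) \<Rightarrow> 'i \<Rightarrow> real" where
  "row_norm d I t i = sqrt (\<Sum>J\<in>tuples (d - 1) I. (cmod (t (i # J)))\<^sup>2)"

definition nonconst :: "('i list \<Rightarrow> complex) \<Rightarrow> 'i list \<Rightarrow> complex" where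
  "nonconst t J = (if \<exists>i. J = replicate (length J) i then 0 else t J)"

text \<open>The share in \<open>row_norm\<close> of the words with exactly \<open>k\<close> letters
  \<open>i\<close>: one stands in front, the other \<open>k - 1\<close> are placed among
  \<open>d - 1\<close> positions.\<close>

definition row_part :: "nat \<Rightarrow> 'i set \<Rightarrow> ('i list \<Rightarrow> complex) \<Rightarrow> nat \<Rightarrow> 'i \<Rightarrow> real" where
  "row_part d I t k i = sqrt (real (d - 1 choose (k - 1)) *
     (\<Sum>J\<in>tuples (d - k) (I - {i}). (cmod (t (replicate k i @ J)))\<^sup>2))"

lemma row_part_nonneg: "row_part d I t k i \<ge> 0"
  by (simp add: row_part_def sum_nonneg)

text \<open>The coefficients in \<open>power_coeff\<close> exceed those of \<open>t\<close> by the
  factor \<open>b = d choose k\<close>, hence their squares by \<open>b\<^sup>2\<close>; counting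
  positions costs at most one \<open>b\<close> back, so \<open>1 / sqrt b\<close> remains after the
  root. The means are then summed over \<open>i\<close> by decoupling.\<close>

lemma sum_row_part_le:
  assumes fin: "finite I" and sym: "symmetric_on d I t" and k: "0 < k" "k \<le> d"
    and bound: "polydisc_bound d I t M"
  shows "(\<Sum>i\<in>I. row_part d I t k i) \<le> L1_const * M * (1 / sqrt (real (d choose k)))"
proof -
  define N where "N = Suc (2 * d)"
  define e where "e i = sample_mean N (I - {i}) (\<lambda>z. cmod (hpoly (d - k) (I - {i}) (power_coeff d t k i) z))" for i
  have e0: "e i \<ge> 0" for i unfolding e_def by (rule sample_mean_nonneg) simp
  define b where "b = real (d choose k)"
  have b: "b > 0" using k by (simp add: b_def)
  have "row_part d I t k i \<le> sqrt (17 ^ 128) * (1 / sqrt b) * e i" if i: "i \<in> I" for i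
  proof -
    have sym': "symmetric_on (d - k) (I - {i}) (power_coeff d t k i)"
      unfolding power_coeff_def
      by (rule symmetric_on_comp, rule symmetric_on_append[OF sym, where k = k]) (use i k in auto)
    have "b\<^sup>2 * (\<Sum>J\<in>tuples (d - k) (I - {i}). (cmod (t (replicate k i @ J)))\<^sup>2) =
      (\<Sum>J\<in>tuples (d - k) (I - {i}). (cmod (power_coeff d t k i J))\<^sup>2)"
      by (simp add: power_coeff_def norm_mult power_mult_distrib sum_distrib_left b_def)
    also have "\<dots> \<le> bombieri_const (d - k) * (e i)\<^sup>2"
      unfolding e_def by (rule coeffs_le_sample_mean) (use fin sym' in \<open>auto simp: N_def\<close>)
    also have "\<dots> \<le> 17 ^ 128 * (e i)\<^sup>2"
      by (intro mult_right_mono bombieri_const_le) simp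
    finally have 1: "b\<^sup>2 * (\<Sum>J\<in>tuples (d - k) (I - {i}). (cmod (t (replicate k i @ J)))\<^sup>2) \<le> 17 ^ 128 * (e i)\<^sup>2" .
    have "k * (d choose k) = d * (d - 1 choose (k - 1))" using times_binomial_minus1_eq[OF k(1), of d] .
    moreover have "k * (d choose k) \<le> d * (d choose k)" using k by (intro mult_right_mono) auto
    ultimately have "d * (d - 1 choose (k - 1)) \<le> d * (d choose k)" by simp
    hence b': "real (d - 1 choose (k - 1)) \<le> b" using k by (simp add: b_def)
    have "real (d - 1 choose (k - 1)) * (\<Sum>J\<in>tuples (d - k) (I - {i}). (cmod (t (replicate k i @ J)))\<^sup>2)
      \<le> b * (\<Sum>J\<in>tuples (d - k) (I - {i}). (cmod (t (replicate k i @ J)))\<^sup>2)"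
      by (intro mult_right_mono b') (simp add: sum_nonneg)
    also have "\<dots> \<le> 17 ^ 128 * (e i)\<^sup>2 / b"
      using 1 b by (simp add: field_simps power2_eq_square)
    finally have "row_part d I t k i \<le> sqrt (17 ^ 128 * (e i)\<^sup>2 / b)"
      unfolding row_part_def by (rule real_sqrt_le_mono)
    also have "\<dots> = sqrt (17 ^ 128) * (1 / sqrt b) * e i"
      using e0 by (simp add: real_sqrt_mult real_sqrt_divide)
    finally show ?thesis .
  qed
  hence "(\<Sum>i\<in>I. row_part d I t k i) \<le> (\<Sum>i\<in>I. sqrt (17 ^ 128) * (1 / sqrt b) * e i)"
    by (rule sum_mono)
  also have "\<dots> = sqrt (17 ^ 128) * (1 / sqrt b) * (\<Sum>i\<in>I. e i)"
    by (simp only: sum_distrib_left)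
  also have "\<dots> \<le> sqrt (17 ^ 128) * (1 / sqrt b) * (2 * M)"
    unfolding e_def using b
    by (intro mult_left_mono sum_sample_mean_power_coeff_le[OF fin sym k bound]) (auto simp: N_def)
  finally show ?thesis by (simp add: L1_const_def b_def)
qed

lemma row_norm_eq_row_parts:
  assumes fin: "finite I" and sym: "symmetric_on d I t" and d: "d > 0" and i: "i \<in> I"
  shows "row_norm d I t i = L2_set (\<lambda>k. row_part d I t k i) {1..d}"
proof -
  have I: "I = insert i (I - {i})" using i by auto
  have "symmetric_on (d - 1) I (\<lambda>J. t (i # J))"
    using sym d i by (intro symmetric_on_Cons) auto
  hence sym': "symmetric_on (d - 1) (insert i (I - {i})) (\<lambda>J. (cmod (t (i # J)))\<^sup>2)"
    unfolding I[symmetric] by (rule symmetric_on_comp)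
  have "(\<Sum>J\<in>tuples (d - 1) (insert i (I - {i})). (cmod (t (i # J)))\<^sup>2) = (\<Sum>l\<le>d-1. real (d - 1 choose l) *
    (\<Sum>J\<in>tuples (d - 1 - l) (I - {i}). (cmod (t (i # replicate l i @ J)))\<^sup>2))"
    by (rule sum_tuples_insert[where F = "\<lambda>J. (cmod (t (i # J)))\<^sup>2"])
       (use fin sym' in auto)
  also have "\<dots> = (\<Sum>k=1..d. real (d - 1 choose (k - 1)) *
    (\<Sum>J\<in>tuples (d - k) (I - {i}). (cmod (t (replicate k i @ J)))\<^sup>2))"
  proof (rule sum.reindex_bij_witness[of _ "\<lambda>k. k - 1" Suc], goal_cases)
    case (5 l)
    thus ?case by simp
  qed (use d in auto)
  also have "\<dots> = (\<Sum>k=1..d. (row_part d I t k i)\<^sup>2)"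
    by (simp add: row_part_def sum_nonneg)
  finally show ?thesis using I by (simp add: row_norm_def L2_set_def)
qed

lemma symmetric_on_nonconst: "symmetric_on d I t \<Longrightarrow> symmetric_on d I (nonconst t)"
proof -
  assume sym: "symmetric_on d I t"
  \<comment> \<open>Being constant is rephrased through the set of letters, which is invariant under
    rearrangement.\<close>
  have c: "(\<exists>i. J = replicate (length J) i) \<longleftrightarrow> (\<exists>i. set J \<subseteq> {i})" for J :: "'a list"
  proof
    assume "\<exists>i. J = replicate (length J) i"
    then obtain i where "J = replicate (length J) i" by blast
    from arg_cong[OF this, of set] show "\<exists>i. set J \<subseteq> {i}" by (auto split: if_splits)
  next
    assume "\<exists>i. set J \<subseteq> {i}"
    then obtain i where "set J \<subseteq> {i}" by blast
    hence "replicate (length J) i = J" by (intro replicate_length_same) auto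
    thus "\<exists>i. J = replicate (length J) i" by (intro exI[of _ i]) (rule HOL.sym)
  qed
  show ?thesis unfolding symmetric_on_def nonconst_def c
  proof (intro ballI allI impI)
    fix J J' assume J: "J \<in> tuples d I" "mset J' = mset J"
    have "set J' = set J" using J(2) by (rule mset_eq_setD)
    moreover have "t J' = t J" by (rule symmetric_onD[OF sym J])
    ultimately show "(if \<exists>i. set J' \<subseteq> {i} then 0 else t J') = (if \<exists>i. set J \<subseteq> {i} then 0 else t J)"
      by (simp only:)
  qed
qed

lemma norm_nonconst_le: "cmod (nonconst t J) \<le> cmod (t J)"
  by (simp add: nonconst_def)

lemma row_part_nonconst_le: "row_part d I (nonconst t) k i \<le> row_part d I t k i"
  unfolding row_part_def
  by (intro real_sqrt_le_mono mult_left_mono sum_mono power_mono norm_nonconst_le) auto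

lemma row_part_nonconst_top: "row_part d I (nonconst t) d i = 0"
  by (simp add: row_part_def nonconst_def)

lemma sum_row_norm_le:
  assumes fin: "finite I" and sym: "symmetric_on d I t" and d: "d > 0"
    and bound: "polydisc_bound d I t M"
  shows "(\<Sum>i\<in>I. row_norm d I t i) \<le> 3 * L1_const * M"
proof -
  note M0 = polydisc_bound_nonneg[OF bound]
  have "(\<Sum>i\<in>I. row_norm d I t i) \<le> (\<Sum>i\<in>I. \<Sum>k=1..d. row_part d I t k i)"
    by (intro sum_mono, subst row_norm_eq_row_parts[OF fin sym d])
       (auto intro!: L2_set_le_sum row_part_nonneg)
  also have "\<dots> = (\<Sum>k=1..d. \<Sum>i\<in>I. row_part d I t k i)" by (rule sum.swap)
  also have "\<dots> \<le> (\<Sum>k=1..d. L1_const * M * (1 / sqrt (real (d choose k))))"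
    by (intro sum_mono sum_row_part_le fin sym bound) auto
  also have "\<dots> = L1_const * M * (\<Sum>k=1..d. 1 / sqrt (real (d choose k)))"
    by (simp only: sum_distrib_left)
  also have "\<dots> \<le> L1_const * M * 3"
    using M0 L1_const_pos d by (intro mult_left_mono sum_inverse_sqrt_binomial_le) auto
  finally show ?thesis by simp
qed

text \<open>Deleting the constant words deletes the part \<open>k = d\<close>, the one that does not
  decay with \<open>d\<close>. The remaining parts are compared with those of \<open>t\<close>,
  since only \<open>t\<close> is known to satisfy the polydisc bound.\<close>

lemma sum_row_norm_nonconst_le:
  assumes fin: "finite I" and sym: "symmetric_on d I t" and d: "d \<ge> 6"
    and bound: "polydisc_bound d I t M"
  shows "(\<Sum>i\<in>I. row_norm d I (nonconst t) i) \<le> 7 * L1_const / sqrt (real d) * M"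
proof -
  note M0 = polydisc_bound_nonneg[OF bound]
  have dset: "{1..d} = insert d {1..<d}" using d by auto
  have "(\<Sum>i\<in>I. row_norm d I (nonconst t) i) \<le> (\<Sum>i\<in>I. \<Sum>k=1..d. row_part d I (nonconst t) k i)"
    by (intro sum_mono, subst row_norm_eq_row_parts[OF fin symmetric_on_nonconst[OF sym]])
       (use d in \<open>auto intro!: L2_set_le_sum row_part_nonneg\<close>)
  also have "\<dots> = (\<Sum>i\<in>I. \<Sum>k=1..<d. row_part d I (nonconst t) k i)"
    by (simp only: dset) (simp add: row_part_nonconst_top)
  also have "\<dots> \<le> (\<Sum>i\<in>I. \<Sum>k=1..<d. row_part d I t k i)"
    by (intro sum_mono row_part_nonconst_le)
  also have "\<dots> = (\<Sum>k=1..<d. \<Sum>i\<in>I. row_part d I t k i)" by (rule sum.swap)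
  also have "\<dots> \<le> (\<Sum>k=1..<d. L1_const * M * (1 / sqrt (real (d choose k))))"
    by (intro sum_mono sum_row_part_le fin sym bound) auto
  also have "\<dots> = L1_const * M * (\<Sum>k=1..<d. 1 / sqrt (real (d choose k)))"
    by (simp only: sum_distrib_left)
  also have "\<dots> \<le> L1_const * M * (7 / sqrt (real d))"
    using M0 L1_const_pos d by (intro mult_left_mono sum_inverse_sqrt_binomial_interior_le) auto
  finally show ?thesis by (simp add: mult_ac)
qed

section \<open>The entropy argument\<close>

text \<open>Jensen's inequality for the logarithm, from \<open>ln x \<le> x - 1\<close> at the
  ratios of the values to their mean.\<close>

lemma sum_ln_le_ln_sum:
  fixes w y :: "'b \<Rightarrow> real"
  assumes fin: "finite S" and w: "\<And>s. s \<in> S \<Longrightarrow> w s > 0" and y: "\<And>s. s \<in> S \<Longrightarrow> y s > 0"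
    and sum1: "(\<Sum>s\<in>S. w s) = 1"
  shows "(\<Sum>s\<in>S. w s * ln (y s)) \<le> ln (\<Sum>s\<in>S. w s * y s)"
proof -
  define Y where "Y = (\<Sum>s\<in>S. w s * y s)"
  have "S \<noteq> {}" using sum1 by auto
  hence Y: "Y > 0" unfolding Y_def using fin w y by (intro sum_pos) auto
  have "(\<Sum>s\<in>S. w s * (ln (y s) - ln Y)) \<le> (\<Sum>s\<in>S. w s * (y s / Y - 1))"
  proof (intro sum_mono mult_left_mono)
    fix s assume s: "s \<in> S"
    have "ln (y s / Y) \<le> y s / Y - 1" using y[OF s] Y by (intro ln_le_minus_one) auto
    thus "ln (y s) - ln Y \<le> y s / Y - 1" using y[OF s] Y by (simp add: ln_div)
  qed (use w in \<open>simp add: less_imp_le\<close>)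
  also have "\<dots> = (\<Sum>s\<in>S. w s * y s) / Y - 1"
    by (simp add: right_diff_distrib sum_subtractf sum1 sum_divide_distrib)
  also have "\<dots> = 0" using Y by (simp add: Y_def)
  finally show ?thesis
    using Y sum1 by (simp add: right_diff_distrib sum_subtractf Y_def flip: sum_distrib_right)
qed

lemma sum_prod_list_tuples:
  fixes u :: "'i \<Rightarrow> 'b::comm_semiring_1"
  shows "(\<Sum>J\<in>tuples d I. prod_list (map u J)) = (\<Sum>i\<in>I. u i) ^ d"
proof (induction d)
  case (Suc d)
  have "(\<Sum>J\<in>tuples (Suc d) I. prod_list (map u J)) = (\<Sum>i\<in>I. u i * (\<Sum>J\<in>tuples d I. prod_list (map u J)))"
    by (simp add: sum_tuples_Suc sum_distrib_left)
  thus ?case by (simp only: Suc sum_distrib_right[symmetric] power_Suc)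
qed simp

lemma prod_list_pos: "(\<And>x. x \<in> set xs \<Longrightarrow> f x > 0) \<Longrightarrow> prod_list (map f xs) > (0::real)"
  by (induction xs) auto

lemma prod_list_nonneg: "(\<And>x. x \<in> set xs \<Longrightarrow> f x \<ge> 0) \<Longrightarrow> prod_list (map f xs) \<ge> (0::real)"
  by (induction xs) auto

lemma ln_prod_list: "(\<And>x. x \<in> set xs \<Longrightarrow> f x > 0) \<Longrightarrow> ln (prod_list (map f xs)) = (\<Sum>x\<leftarrow>xs. ln (f x :: real))"
proof (induction xs)
  case (Cons a xs)
  have pos: "f a > 0" "prod_list (map f xs) > 0" using Cons.prems by (auto intro!: prod_list_pos)
  have "ln (prod_list (map f xs)) = (\<Sum>x\<leftarrow>xs. ln (f x))" using Cons by simp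
  thus ?case using pos by (simp add: ln_mult)
qed simp

text \<open>Swapping position \<open>l\<close> with the first one preserves a symmetric weight, so
  all positions have the same marginal.\<close>

lemma sum_tuples_position:
  fixes w :: "'i list \<Rightarrow> real"
  assumes "symmetric_on d I w" "l < d" "finite I"
  shows "(\<Sum>J\<in>tuples d I. w J * g (J ! l)) = (\<Sum>J\<in>tuples d I. w J * g (hd J))"
proof -
  define sw where "sw J = J[0 := J ! l, l := J ! 0]" for J :: "'i list"
  have ms: "mset (sw J) = mset J" if "J \<in> tuples d I" for J
    unfolding sw_def using that assms(2) by (intro mset_swap) (auto simp: tuples_def)
  have sw: "sw J \<in> tuples d I" "sw (sw J) = J" "J ! l = hd (sw J)" if "J \<in> tuples d I" for J
  proof -
    show "sw J \<in> tuples d I" using tuples_mset[OF that ms[OF that]] .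
    have len: "length (sw K) = length K" for K by (simp add: sw_def)
    have n: "sw K ! i = (if i = 0 then K ! l else if i = l then K ! 0 else K ! i)"
      if "i < length K" "l < length K" for K i
      using that by (auto simp: sw_def nth_list_update)
    have J: "length J = d" using that by (simp add: tuples_def)
    show "sw (sw J) = J"
      by (rule nth_equalityI) (use assms(2) J in \<open>auto simp: len n\<close>)
    have "sw J \<noteq> []" using len[of J] J assms(2) by auto
    thus "J ! l = hd (sw J)" using assms(2) J by (simp add: hd_conv_nth n)
  qed
  show ?thesis
  proof (rule sum.reindex_bij_witness[of _ sw sw], goal_cases)
    case (5 J)
    thus ?case using sw(3)[OF 5] symmetric_onD[OF assms(1) 5 ms[OF 5]] by simp
  qed (use sw in auto)
qed

text \<open>Jensen's inequality is applied with the probability \<open>\<mu>\<close> proportional to \<open>|t|\<^sup>q\<close> and with its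
  marginal \<open>u\<close>; what remains is that the entropy of \<open>\<mu>\<close> is at most \<open>d\<close> times that of \<open>u\<close>.\<close>

lemma exists_weights_coeff_le_row_norms:
  fixes t :: "'i list \<Rightarrow> complex" and p :: real
  assumes fin: "finite I" and sym: "symmetric_on d I t" and d: "d > 0" and p: "p \<ge> 2 * real d"
    and q: "q = 2 * real d * p / (real d * p + p - 2 * real d)"
    and nz: "\<exists>J\<in>tuples d I. t J \<noteq> 0"
  shows "\<exists>x. (\<forall>i. x i \<ge> 0) \<and> (\<Sum>i\<in>I. x i powr p) = 1 \<and>
    (\<Sum>J\<in>tuples d I. cmod (t J) powr q) powr (1 / q) \<le>
    (\<Sum>i\<in>I. row_norm d I (\<lambda>J. t J * of_real (prod_list (map x J))) i)"
proof -
  have p0: "p > 0" using p d by linarith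
  have den: "real d * p + p - 2 * real d > 0"
  proof -
    have "real d * p > 0" using p0 d by simp
    thus ?thesis using p by linarith
  qed
  have q0: "q > 0" unfolding q using den p0 d by simp
  have q2: "2 / q - 1 = (p - 2 * real d) / (real d * p)"
    unfolding q using den p0 d by (simp add: field_simps)
  define a where "a J = cmod (t J)" for J
  define \<Omega> where "\<Omega> = {J \<in> tuples d I. t J \<noteq> 0}"
  define S where "S = (\<Sum>J\<in>tuples d I. a J powr q)"
  define \<mu> where "\<mu> J = a J powr q / S" for J
  define u where "u i = (\<Sum>J\<in>{J \<in> \<Omega>. hd J = i}. \<mu> J)" for i
  \<comment> \<open>The \<open>p\<close>-th powers of the coordinates are the marginal
    probabilities, so \<open>x\<close> lies on the unit sphere.\<close>
  define x where "x i = u i powr (1 / p)" for i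
  define X where "X i = row_norm d I (\<lambda>J. t J * of_real (prod_list (map x J))) i" for i
  define L where "L = (\<Sum>J\<in>\<Omega>. \<mu> J * ln (u (hd J)))"
  define H where "H = (\<Sum>J\<in>\<Omega>. \<mu> J * ln (\<mu> J))"
  have fin\<Omega>: "finite \<Omega>" using fin by (simp add: \<Omega>_def)
  have ne\<Omega>: "\<Omega> \<noteq> {}" using nz by (auto simp: \<Omega>_def)
  have a: "a J > 0" if "J \<in> \<Omega>" for J using that by (simp add: a_def \<Omega>_def)
  have out: "a J powr q = 0" if "J \<in> tuples d I - \<Omega>" for J using that by (auto simp: a_def \<Omega>_def)
  have S\<Omega>: "S = (\<Sum>J\<in>\<Omega>. a J powr q)"
    unfolding S_def using out fin by (intro sum.mono_neutral_right) (auto simp: \<Omega>_def)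
  have "a J powr q > 0" if "J \<in> \<Omega>" for J using a[OF that] by simp
  hence S: "S > 0" unfolding S\<Omega> using fin\<Omega> ne\<Omega> by (intro sum_pos) auto
  have \<mu>: "\<mu> J > 0" if "J \<in> \<Omega>" for J using a[OF that] S by (simp add: \<mu>_def)
  have sum\<mu>: "(\<Sum>J\<in>\<Omega>. \<mu> J) = 1"
    using S by (simp add: \<mu>_def S\<Omega> flip: sum_divide_distrib)
  have sym\<mu>: "symmetric_on d I \<mu>"
    unfolding \<mu>_def a_def by (rule symmetric_on_comp[OF sym])
  have hdI: "hd J \<in> I" if "J \<in> \<Omega>" for J
    using that d by (cases J) (auto simp: \<Omega>_def tuples_def)
  have u0: "u i \<ge> 0" for i unfolding u_def using \<mu> by (intro sum_nonneg) (auto intro: less_imp_le)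
  have u_hd: "u (hd J) > 0" if "J \<in> \<Omega>" for J
    unfolding u_def using that \<mu> fin\<Omega> by (intro sum_pos) auto
  have sum_u: "(\<Sum>i\<in>I. u i) = 1"
  proof -
    have "(\<Sum>i\<in>I. u i) = (\<Sum>J\<in>\<Omega>. \<mu> J)"
      unfolding u_def using fin fin\<Omega> hdI by (intro sum.group) auto
    thus ?thesis by (simp add: sum\<mu>)
  qed
  \<comment> \<open>By symmetry, any letter of a word in the support can be moved to the front
    within the support.\<close>
  have u_pos: "u j > 0" if J: "J \<in> \<Omega>" and j: "j \<in> set J" for J j
  proof -
    have Jt: "J \<in> tuples d I" "t J \<noteq> 0" using J by (auto simp: \<Omega>_def)
    have ms: "mset (j # remove1 j J) = mset J" using j by simp
    have "t (j # remove1 j J) = t J" by (rule symmetric_onD[OF sym Jt(1) ms])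
    moreover have "j # remove1 j J \<in> tuples d I" by (rule tuples_mset[OF Jt(1) ms])
    ultimately have "j # remove1 j J \<in> \<Omega>" unfolding \<Omega>_def using Jt(2) by (intro CollectI conjI) simp_all
    from u_hd[OF this] show ?thesis by simp
  qed
  have \<mu>_out: "\<mu> J = 0" if "J \<in> tuples d I - \<Omega>" for J using out[OF that] by (simp add: \<mu>_def)
  have sum_ln: "(\<Sum>J\<in>\<Omega>. \<mu> J * ln (prod_list (map u J))) = real d * L"
  proof -
    have ext: "(\<Sum>J\<in>\<Omega>. \<mu> J * g J) = (\<Sum>J\<in>tuples d I. \<mu> J * g J)" for g :: "'i list \<Rightarrow> real"
      using fin \<mu>_out by (intro sum.mono_neutral_left) (auto simp: \<Omega>_def)
    have "(\<Sum>J\<in>\<Omega>. \<mu> J * ln (prod_list (map u J))) = (\<Sum>J\<in>\<Omega>. \<mu> J * (\<Sum>l<d. ln (u (J ! l))))"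
    proof (intro sum.cong refl arg_cong2[where f = "(*)"])
      fix J assume J: "J \<in> \<Omega>"
      hence "length J = d" by (auto simp: \<Omega>_def tuples_def)
      thus "ln (prod_list (map u J)) = (\<Sum>l<d. ln (u (J ! l)))"
        using u_pos[OF J] by (simp add: ln_prod_list sum_list_sum_nth atLeast0LessThan)
    qed
    also have "\<dots> = (\<Sum>l<d. \<Sum>J\<in>tuples d I. \<mu> J * ln (u (J ! l)))"
      unfolding ext by (subst sum.swap) (simp add: sum_distrib_left)
    also have "\<dots> = (\<Sum>l<d. \<Sum>J\<in>tuples d I. \<mu> J * ln (u (hd J)))"
      by (intro sum.cong refl sum_tuples_position[OF sym\<mu> _ fin]) auto
    also have "\<dots> = real d * L" by (simp add: L_def ext)
    finally show ?thesis .
  qed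
  \<comment> \<open>Subadditivity of entropy: the relative entropy of \<open>\<mu>\<close> with
    respect to the \<open>d\<close>-fold product of its marginal is nonnegative. Both
    \<open>H\<close> and \<open>L\<close> are negated entropies.\<close>
  have gibbs: "real d * L \<le> H"
  proof -
    have pu: "prod_list (map u J) > 0" if "J \<in> \<Omega>" for J
      using u_pos[OF that] by (rule prod_list_pos)
    have "(\<Sum>J\<in>\<Omega>. \<mu> J * ln (prod_list (map u J) / \<mu> J)) \<le> ln (\<Sum>J\<in>\<Omega>. \<mu> J * (prod_list (map u J) / \<mu> J))"
      using fin\<Omega> \<mu> pu sum\<mu> by (intro sum_ln_le_ln_sum) auto
    also have "(\<Sum>J\<in>\<Omega>. \<mu> J * (prod_list (map u J) / \<mu> J)) = (\<Sum>J\<in>\<Omega>. prod_list (map u J))"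
      by (intro sum.cong refl) (use \<mu> in force)
    also have "ln \<dots> \<le> ln 1"
    proof (rule ln_mono)
      have "(\<Sum>J\<in>\<Omega>. prod_list (map u J)) \<le> (\<Sum>J\<in>tuples d I. prod_list (map u J))"
        using fin u0 by (intro sum_mono2 prod_list_nonneg) (auto simp: \<Omega>_def)
      thus "(\<Sum>J\<in>\<Omega>. prod_list (map u J)) \<le> 1" by (simp add: sum_prod_list_tuples sum_u)
      show "0 < (\<Sum>J\<in>\<Omega>. prod_list (map u J))" using fin\<Omega> ne\<Omega> pu by (intro sum_pos) auto
    qed
    finally have "(\<Sum>J\<in>\<Omega>. \<mu> J * ln (prod_list (map u J) / \<mu> J)) \<le> 0" by simp
    moreover have "(\<Sum>J\<in>\<Omega>. \<mu> J * ln (prod_list (map u J) / \<mu> J)) = real d * L - H"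
      unfolding sum_ln[symmetric] H_def sum_subtractf[symmetric]
    proof (intro sum.cong refl)
      fix J assume J: "J \<in> \<Omega>"
      thus "\<mu> J * ln (prod_list (map u J) / \<mu> J) = \<mu> J * ln (prod_list (map u J)) - \<mu> J * ln (\<mu> J)"
        using pu[OF J] \<mu>[OF J] by (simp add: ln_div right_diff_distrib)
    qed
    ultimately show ?thesis by simp
  qed
  define y where "y J = (a J)\<^sup>2 * (prod_list (map u J)) powr (2 / p)" for J
  have y: "y J > 0" if "J \<in> \<Omega>" for J
    using a[OF that] prod_list_pos[of J u] u_pos[OF that] by (simp add: y_def)
  have X2: "(X i)\<^sup>2 = (\<Sum>J\<in>{J \<in> \<Omega>. hd J = i}. y J)" if i: "i \<in> I" for i
  proof -
    have px: "(prod_list (map x J))\<^sup>2 = (prod_list (map u J)) powr (2 / p)" for J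
    proof -
      have "prod_list (map x J) = (prod_list (map u J)) powr (1 / p)"
        unfolding x_def using u0 by (induction J) (auto simp: powr_mult prod_list_nonneg)
      thus ?thesis by (simp add: power2_eq_square flip: powr_add)
    qed
    have "(X i)\<^sup>2 = (\<Sum>J\<in>tuples (d - 1) I. y (i # J))"
      by (simp only: X_def row_norm_def norm_mult power_mult_distrib norm_of_real power2_abs px y_def a_def)
         (simp add: sum_nonneg)
    also have "\<dots> = (\<Sum>J\<in>{J \<in> tuples d I. hd J = i}. y J)"
    proof (rule sum.reindex_bij_witness[of _ tl "(#) i"], goal_cases)
      case (3 J) thus ?case using d by (cases J) (auto simp: tuples_def)
    next
      case (4 J) thus ?case using d by (cases J) (auto simp: tuples_def)
    next
      case (2 J) thus ?case using d i by (auto simp: tuples_def)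
    qed auto
    also have "\<dots> = (\<Sum>J\<in>{J \<in> \<Omega>. hd J = i}. y J)"
      using fin by (intro sum.mono_neutral_right) (auto simp: \<Omega>_def y_def a_def)
    finally show ?thesis .
  qed
  \<comment> \<open>Letters of marginal 0 are dropped so that all logarithms below have positive
    arguments.\<close>
  define I0 where "I0 = {i \<in> I. u i > 0}"
  have finI0: "finite I0" using fin by (simp add: I0_def)
  have X0: "X i \<ge> 0" for i by (simp add: X_def row_norm_def sum_nonneg)
  have sum_u0: "(\<Sum>i\<in>I0. u i) = 1"
    unfolding sum_u[symmetric] using fin u0
    by (intro sum.mono_neutral_left) (auto simp: I0_def intro: antisym)
  \<comment> \<open>First use of Jensen, conditionally on the first letter \<open>i\<close>, with
    the probabilities \<open>\<mu> J / u i\<close>. The factor 1/2 comes from the square root in the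
    row norm. The second use, over \<open>i\<close> with weights \<open>u\<close>, ends the chain of
    inequalities.\<close>
  have Xpos: "X i > 0" and row: "u i * ln (X i / u i) \<ge> 1 / 2 * (\<Sum>J\<in>{J \<in> \<Omega>. hd J = i}. \<mu> J * ln (y J / (u i * \<mu> J)))"
    if i: "i \<in> I0" for i
  proof -
    let ?\<Omega>i = "{J \<in> \<Omega>. hd J = i}"
    have iI: "i \<in> I" and ui: "u i > 0" using i by (auto simp: I0_def)
    have ne: "?\<Omega>i \<noteq> {}" using ui unfolding u_def by (metis less_irrefl sum.empty)
    have "(X i)\<^sup>2 > 0" unfolding X2[OF iI] using fin\<Omega> ne y by (intro sum_pos) auto
    thus Xi: "X i > 0" using X0[of i] by (metis less_eq_real_def power2_less_0 zero_eq_power2 less_irrefl)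
    have "(\<Sum>J\<in>?\<Omega>i. \<mu> J / u i * ln (y J / (u i * \<mu> J))) \<le> ln (\<Sum>J\<in>?\<Omega>i. \<mu> J / u i * (y J / (u i * \<mu> J)))"
    proof (rule sum_ln_le_ln_sum)
      have "(\<Sum>J\<in>?\<Omega>i. \<mu> J / u i) = u i / u i" unfolding u_def by (simp only: sum_divide_distrib)
      thus "(\<Sum>J\<in>?\<Omega>i. \<mu> J / u i) = 1" using ui by simp
    qed (use fin\<Omega> \<mu> y ui in auto)
    also have "(\<Sum>J\<in>?\<Omega>i. \<mu> J / u i * (y J / (u i * \<mu> J))) = (\<Sum>J\<in>?\<Omega>i. y J / (u i)\<^sup>2)"
    proof (intro sum.cong refl)
      fix J assume "J \<in> ?\<Omega>i"
      hence "\<mu> J > 0" using \<mu> by simp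
      thus "\<mu> J / u i * (y J / (u i * \<mu> J)) = y J / (u i)\<^sup>2" using ui by (simp add: field_simps power2_eq_square)
    qed
    also have "\<dots> = (X i / u i)\<^sup>2" by (simp add: X2[OF iI] power_divide flip: sum_divide_distrib)
    also have "ln \<dots> = 2 * ln (X i / u i)" using Xi ui by (simp add: ln_realpow)
    finally have "u i * (\<Sum>J\<in>?\<Omega>i. \<mu> J / u i * ln (y J / (u i * \<mu> J))) \<le> u i * (2 * ln (X i / u i))"
      using ui by (intro mult_left_mono) auto
    moreover have "u i * (\<Sum>J\<in>?\<Omega>i. \<mu> J / u i * ln (y J / (u i * \<mu> J))) = (\<Sum>J\<in>?\<Omega>i. \<mu> J * ln (y J / (u i * \<mu> J)))"
      unfolding sum_distrib_left using ui by (intro sum.cong) auto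
    ultimately show "u i * ln (X i / u i) \<ge> 1 / 2 * (\<Sum>J\<in>?\<Omega>i. \<mu> J * ln (y J / (u i * \<mu> J)))" by simp
  qed
  have I0ne: "I0 \<noteq> {}" using sum_u0 by auto
  have Xsum: "(\<Sum>i\<in>I0. X i) > 0" using finI0 I0ne Xpos by (intro sum_pos) auto
  \<comment> \<open>The exponent is designed for this step: \<open>(2 / q - 1) * d\<close> equals
    \<open>1 - 2 * d / p\<close>, so \<open>gibbs\<close> makes the entropy terms balance. The sign
    of \<open>2 / q - 1\<close> uses \<open>p \<ge> 2 * d\<close>.\<close>
  have "1 / q * ln S \<le> 1 / 2 * ((2 / q - 1) * H + 2 / q * ln S + (2 * real d / p - 1) * L)"
  proof -
    have "(2 / q - 1) * H \<ge> (2 / q - 1) * (real d * L)"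
      using gibbs p p0 by (intro mult_left_mono) (auto simp: q2)
    also have "(2 / q - 1) * (real d * L) = (1 - 2 * real d / p) * L"
      unfolding q2 using d p0 by (simp add: field_simps)
    finally have "(2 / q - 1) * H + (2 * real d / p - 1) * L \<ge> 0" by (simp add: left_diff_distrib)
    thus ?thesis by (simp add: mult.commute)
  qed
  also have "\<dots> = 1 / 2 * (\<Sum>J\<in>\<Omega>. \<mu> J * ln (y J / (u (hd J) * \<mu> J)))"
  proof -
    have "(\<Sum>J\<in>\<Omega>. \<mu> J * ln (y J / (u (hd J) * \<mu> J))) =
      (\<Sum>J\<in>\<Omega>. (2 / q - 1) * (\<mu> J * ln (\<mu> J)) + 2 / q * ln S * \<mu> J + 2 / p * (\<mu> J * ln (prod_list (map u J)))
         - \<mu> J * ln (u (hd J)))"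
    proof (intro sum.cong refl)
      fix J assume J: "J \<in> \<Omega>"
      have pu: "prod_list (map u J) > 0" using u_pos[OF J] by (rule prod_list_pos)
      have "ln (\<mu> J) = q * ln (a J) - ln S" using a[OF J] S by (simp add: \<mu>_def ln_div ln_powr)
      hence la: "ln (a J) = 1 / q * (ln (\<mu> J) + ln S)" using q0 by (simp add: field_simps)
      have "ln (y J / (u (hd J) * \<mu> J)) = 2 * ln (a J) + 2 / p * ln (prod_list (map u J)) - ln (u (hd J)) - ln (\<mu> J)"
        using a[OF J] pu u_hd[OF J] \<mu>[OF J]
        by (simp add: y_def ln_div ln_mult ln_powr ln_realpow)
      hence eq: "ln (y J / (u (hd J) * \<mu> J)) = (2 / q - 1) * ln (\<mu> J) + 2 / q * ln S
          + 2 / p * ln (prod_list (map u J)) - ln (u (hd J))"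
        unfolding la by (simp add: algebra_simps)
      show "\<mu> J * ln (y J / (u (hd J) * \<mu> J)) = (2 / q - 1) * (\<mu> J * ln (\<mu> J)) + 2 / q * ln S * \<mu> J +
        2 / p * (\<mu> J * ln (prod_list (map u J))) - \<mu> J * ln (u (hd J))"
        unfolding eq by (simp add: algebra_simps)
    qed
    also have "\<dots> = (2 / q - 1) * H + 2 / q * ln S * (\<Sum>J\<in>\<Omega>. \<mu> J) + 2 / p * (real d * L) - L"
      by (simp only: sum.distrib sum_subtractf sum_distrib_left[symmetric] sum_ln H_def[symmetric] L_def[symmetric])
    finally show ?thesis by (simp add: sum\<mu> left_diff_distrib)
  qed
  also have "\<dots> = (\<Sum>i\<in>I0. 1 / 2 * (\<Sum>J\<in>{J \<in> \<Omega>. hd J = i}. \<mu> J * ln (y J / (u i * \<mu> J))))"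
  proof -
    have "(\<Sum>i\<in>I0. \<Sum>J\<in>{J \<in> \<Omega>. hd J = i}. \<mu> J * ln (y J / (u (hd J) * \<mu> J))) =
      (\<Sum>J\<in>\<Omega>. \<mu> J * ln (y J / (u (hd J) * \<mu> J)))"
      using fin\<Omega> finI0 hdI u_hd by (intro sum.group) (auto simp: I0_def)
    moreover have "(\<Sum>i\<in>I0. \<Sum>J\<in>{J \<in> \<Omega>. hd J = i}. \<mu> J * ln (y J / (u (hd J) * \<mu> J))) =
      (\<Sum>i\<in>I0. \<Sum>J\<in>{J \<in> \<Omega>. hd J = i}. \<mu> J * ln (y J / (u i * \<mu> J)))"
      by (intro sum.cong refl) auto
    ultimately show ?thesis by (simp only: sum_distrib_left[symmetric])
  qed
  also have "\<dots> \<le> (\<Sum>i\<in>I0. u i * ln (X i / u i))" by (intro sum_mono row)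
  also have "\<dots> \<le> ln (\<Sum>i\<in>I0. u i * (X i / u i))"
    using finI0 Xpos sum_u0 by (intro sum_ln_le_ln_sum) (auto simp: I0_def)
  also have "(\<Sum>i\<in>I0. u i * (X i / u i)) = (\<Sum>i\<in>I0. X i)"
    by (intro sum.cong) (auto simp: I0_def)
  finally have "exp (1 / q * ln S) \<le> exp (ln (\<Sum>i\<in>I0. X i))" by simp
  hence "S powr (1 / q) \<le> (\<Sum>i\<in>I0. X i)" using S Xsum by (simp add: powr_def)
  also have "\<dots> \<le> (\<Sum>i\<in>I. X i)" using fin X0 by (intro sum_mono2) (auto simp: I0_def)
  finally have "S powr (1 / q) \<le> (\<Sum>i\<in>I. X i)" .
  moreover have "(\<Sum>i\<in>I. x i powr p) = 1"
    using sum_u p0 u0 by (simp add: x_def powr_powr)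
  moreover have "\<forall>i. x i \<ge> 0" by (simp add: x_def)
  ultimately show ?thesis unfolding S_def X_def a_def by blast
qed

section \<open>Bounds on the unit ball of the p-norm\<close>

definition lp_bound :: "real \<Rightarrow> nat \<Rightarrow> 'i set \<Rightarrow> ('i list \<Rightarrow> complex) \<Rightarrow> real \<Rightarrow> bool" where
  "lp_bound p d I t M \<longleftrightarrow> (\<forall>z. (\<Sum>i\<in>I. cmod (z i) powr p) \<le> 1 \<longrightarrow> cmod (hpoly d I t z) \<le> M)"

lemma lp_boundD: "lp_bound p d I t M \<Longrightarrow> (\<Sum>i\<in>I. cmod (z i) powr p) \<le> 1 \<Longrightarrow> cmod (hpoly d I t z) \<le> M"
  unfolding lp_bound_def by blast

lemma lp_bound_nonneg: "lp_bound p d I t M \<Longrightarrow> M \<ge> 0"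
  by (rule order.trans[OF norm_ge_zero lp_boundD[of p d I t M "\<lambda>_. 0"]]) auto

lemma hpoly_weights:
  "hpoly d I (\<lambda>J. t J * of_real (prod_list (map x J))) z = hpoly d I t (\<lambda>i. of_real (x i) * z i)"
proof -
  have "of_real (prod_list (map x J)) * prod_list (map z J) = prod_list (map (\<lambda>i. of_real (x i) * z i) J)" for J
    by (induction J) (auto simp: mult_ac)
  thus ?thesis by (simp add: hpoly_def mult.assoc)
qed

text \<open>Multiplication by a nonnegative point of the unit ball maps the polydisc into that
  ball.\<close>

lemma polydisc_bound_weights:
  assumes "lp_bound p d I t M" "p > 0" "\<And>i. x i \<ge> 0" "(\<Sum>i\<in>I. x i powr p) \<le> 1"
  shows "polydisc_bound d I (\<lambda>J. t J * of_real (prod_list (map x J))) M"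
  unfolding polydisc_bound_def hpoly_weights
proof (intro allI impI lp_boundD[OF assms(1)])
  fix z :: "'a \<Rightarrow> complex" assume z: "\<forall>i\<in>I. cmod (z i) \<le> 1"
  have "(\<Sum>i\<in>I. cmod (of_real (x i) * z i) powr p) \<le> (\<Sum>i\<in>I. x i powr p)"
    using z assms(2,3) by (intro sum_mono powr_mono2) (auto simp: norm_mult mult_left_le)
  thus "(\<Sum>i\<in>I. cmod (of_real (x i) * z i) powr p) \<le> 1" using assms(4) by simp
qed

definition hl_exponent :: "real \<Rightarrow> nat \<Rightarrow> real" where
  "hl_exponent p d = 2 * real d * p / (real d * p + p - 2 * real d)"

lemma inverse_hl_exponent:
  assumes "d > 0" "p > 0"
  shows "1 / hl_exponent p d = 1 / 2 + 1 / (2 * real d) - 1 / p"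
  using assms by (simp add: hl_exponent_def field_simps)

lemma hl_exponent_pos:
  assumes "d > 0" "p \<ge> 2 * real d"
  shows "hl_exponent p d > 0"
proof -
  have p: "p > 0" and dp: "real d * p > 0" using assms by (auto intro!: mult_pos_pos)
  hence "real d * p + p - 2 * real d > 0" using assms by linarith
  thus ?thesis unfolding hl_exponent_def using p assms(1) by (intro divide_pos_pos) auto
qed

lemma symmetric_on_weights:
  "symmetric_on d I t \<Longrightarrow> symmetric_on d I (\<lambda>J. t J * complex_of_real (prod_list (map x J)))"
  by (intro symmetric_on_mult symmetric_on_comp[OF symmetric_on_prod_list])

lemma nonconst_mult: "nonconst (\<lambda>J. t J * c J) = (\<lambda>J. nonconst t J * c J)"
  by (auto simp: nonconst_def)

text \<open>A Hardy-Littlewood inequality with an absolute constant: the entropy argument supplies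
  the weights that transfer the problem to the polydisc, where the row norms are summable.\<close>

lemma coeff_norm_le:
  assumes "finite I" "symmetric_on d I t" "d > 0" "p \<ge> 2 * real d" "lp_bound p d I t M"
  shows "(\<Sum>J\<in>tuples d I. cmod (t J) powr hl_exponent p d) powr (1 / hl_exponent p d) \<le> 3 * L1_const * M"
proof (cases "\<exists>J\<in>tuples d I. t J \<noteq> 0")
  case True
  have "p > 0" using assms(3,4) by linarith
  obtain x where x: "\<And>i. x i \<ge> 0" "(\<Sum>i\<in>I. x i powr p) = 1" and
    le: "(\<Sum>J\<in>tuples d I. cmod (t J) powr hl_exponent p d) powr (1 / hl_exponent p d) \<le>
      (\<Sum>i\<in>I. row_norm d I (\<lambda>J. t J * of_real (prod_list (map x J))) i)"
    using exists_weights_coeff_le_row_norms[OF assms(1-4) hl_exponent_def True] by blast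
  note le
  also have "(\<Sum>i\<in>I. row_norm d I (\<lambda>J. t J * of_real (prod_list (map x J))) i) \<le> 3 * L1_const * M"
    using x \<open>p > 0\<close>
    by (intro sum_row_norm_le symmetric_on_weights polydisc_bound_weights[OF assms(5)] assms) auto
  finally show ?thesis .
next
  case False
  have "(\<Sum>J\<in>tuples d I. cmod (t J) powr hl_exponent p d) = 0"
    by (intro sum.neutral) (use False in auto)
  thus ?thesis using L1_const_pos lp_bound_nonneg[OF assms(5)] by simp
qed

text \<open>The weights are built from \<open>nonconst t\<close>, but the bound on the ball is that
  of \<open>t\<close>; this works because \<open>nonconst\<close> commutes with weighting.\<close>

lemma coeff_norm_nonconst_le:
  assumes "finite I" "symmetric_on d I t" "d \<ge> 6" "p \<ge> 2 * real d" "lp_bound p d I t M"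
  shows "(\<Sum>J\<in>tuples d I. cmod (nonconst t J) powr hl_exponent p d) powr (1 / hl_exponent p d)
    \<le> 7 * L1_const / sqrt (real d) * M"
proof (cases "\<exists>J\<in>tuples d I. nonconst t J \<noteq> 0")
  case True
  have d: "d > 0" and "p > 0" using assms(3,4) by linarith+
  obtain x where x: "\<And>i. x i \<ge> 0" "(\<Sum>i\<in>I. x i powr p) = 1" and
    le: "(\<Sum>J\<in>tuples d I. cmod (nonconst t J) powr hl_exponent p d) powr (1 / hl_exponent p d) \<le>
      (\<Sum>i\<in>I. row_norm d I (\<lambda>J. nonconst t J * of_real (prod_list (map x J))) i)"
    using exists_weights_coeff_le_row_norms[OF assms(1) symmetric_on_nonconst[OF assms(2)] d assms(4) hl_exponent_def True]
    by blast
  note le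
  also have "(\<Sum>i\<in>I. row_norm d I (\<lambda>J. nonconst t J * of_real (prod_list (map x J))) i) \<le>
    7 * L1_const / sqrt (real d) * M"
    unfolding nonconst_mult[symmetric] using x \<open>p > 0\<close>
    by (intro sum_row_norm_nonconst_le symmetric_on_weights polydisc_bound_weights[OF assms(5)] assms) auto
  finally show ?thesis .
next
  case False
  have "(\<Sum>J\<in>tuples d I. cmod (nonconst t J) powr hl_exponent p d) = 0"
    by (intro sum.neutral) (use False in auto)
  thus ?thesis using L1_const_pos lp_bound_nonneg[OF assms(5)] by simp
qed

text \<open>The exponents \<open>p / d\<close> and \<open>p / (p - d)\<close> are conjugate.
  Evaluating the pure coefficients at the extremal point \<open>x\<close> of Hoelder's inequality
  turns the polydisc estimate into the dual norm.\<close>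

lemma sum_pure_powr_le:
  assumes fin: "finite I" and d: "d > 0" and p: "p > real d" and bound: "lp_bound p d I t 1"
  shows "(\<Sum>i\<in>I. cmod (t (replicate d i)) powr (p / (p - real d))) \<le> 1"
proof (cases "\<forall>i\<in>I. t (replicate d i) = 0")
  case True
  thus ?thesis by simp
next
  case False
  define r where "r = p / (p - real d)"
  define a where "a i = cmod (t (replicate d i))" for i
  define s where "s = (\<Sum>i\<in>I. a i powr r)"
  have p0: "p > 0" using p d by linarith
  have s: "s > 0"
  proof -
    obtain i where "i \<in> I" "a i > 0" using False by (auto simp: a_def)
    hence "0 < a i powr r" "a i powr r \<le> s" unfolding s_def using fin by (auto intro!: member_le_sum)
    thus ?thesis by linarith
  qed
  define x where "x i = (a i powr r / s) powr (1 / p)" for i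
  have "(\<Sum>i\<in>I. x i powr p) = (\<Sum>i\<in>I. a i powr r / s)"
    using p0 s by (simp add: x_def powr_powr)
  also have "\<dots> = 1" using s by (simp add: s_def flip: sum_divide_distrib)
  finally have "polydisc_bound d I (\<lambda>J. t J * of_real (prod_list (map x J))) 1"
    using p0 by (intro polydisc_bound_weights[OF bound]) (auto simp: x_def)
  from sum_pure_coeffs_le[OF fin d this]
  have "(\<Sum>i\<in>I. a i * x i ^ d) \<le> 1"
  proof -
    have "prod_list (map x (replicate d i)) = x i ^ d" for i by (induction d) auto
    hence "cmod (t (replicate d i) * of_real (prod_list (map x (replicate d i)))) = a i * x i ^ d" for i
      by (simp add: norm_mult a_def norm_power x_def)
    thus ?thesis using \<open>(\<Sum>i\<in>I. cmod (t (replicate d i) * of_real (prod_list (map x (replicate d i))))) \<le> 1\<close>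
      by simp
  qed
  moreover have "a i * x i ^ d = a i powr r / s powr (real d / p)" for i
  proof (cases "a i = 0")
    case False
    hence ai: "a i > 0" by (simp add: a_def)
    have "x i ^ d = x i powr real d" using ai s by (simp add: powr_realpow x_def)
    also have "\<dots> = (a i powr r / s) powr (real d / p)" by (simp add: x_def powr_powr)
    also have "\<dots> = a i powr (r * real d / p) / s powr (real d / p)"
      using s by (simp add: powr_divide powr_powr)
    finally have "a i * x i ^ d = a i powr (1 + r * real d / p) / s powr (real d / p)"
      using ai by (simp add: powr_add)
    also have "1 + r * real d / p = r" using p p0 by (simp add: r_def field_simps)
    finally show ?thesis .
  qed simp
  ultimately have "s / s powr (real d / p) \<le> 1"
    by (simp add: s_def flip: sum_divide_distrib)
  hence "s powr (1 - real d / p) \<le> 1" using s by (simp add: powr_diff)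
  moreover have "1 - real d / p > 0" using p p0 by simp
  ultimately have "s \<le> 1" using s by (metis gr_one_powr linorder_not_le)
  thus ?thesis by (simp add: s_def r_def a_def)
qed

section \<open>Forms with a coefficient close to the supremum\<close>

text \<open>Pairing the nonnegative function \<open>1 - Re f\<close> with \<open>1 + cos\<close>.\<close>

lemma bounded_coeff_le:
  fixes b :: "nat \<Rightarrow> complex"
  assumes k: "0 < k" "k \<le> d" and N: "2 * d < N"
    and bound: "\<And>j. cmod (\<Sum>l\<le>d. b l * root_pt N j ^ l) \<le> 1"
  shows "cmod (b k) \<le> 2 * (1 - cmod (b 0))"
proof -
  obtain e0 where e0: "cmod e0 = 1" "e0 * b 0 = of_real (cmod (b 0))" using exists_phase by blast
  obtain e1 where e1: "cmod e1 = 1" "e1 * (e0 * b k) = of_real (cmod (e0 * b k))" using exists_phase by blast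
  define f where "f j = (\<Sum>l\<le>d. b l * root_pt N j ^ l)" for j
  \<comment> \<open>With these phases the mean of \<open>1 - e0 * f\<close> against \<open>g\<close>
    has real part \<open>1 - cmod (b 0) - cmod (b k) / 2\<close>, and it is nonnegative because
    \<open>g\<close> and the real part of \<open>1 - e0 * f\<close> are.\<close>
  define g where "g j = 1 + Re (e1 * cnj (root_pt N j) ^ k)" for j
  have N0: "N > 0" using N by simp
  define h where "h = e1 / 2"
  have g: "of_real (g j) = 1 + (h * cnj (root_pt N j) ^ k + cnj h * root_pt N j ^ k)" for j
  proof -
    have "2 * complex_of_real (Re w) = w + cnj w" for w by (simp add: complex_eq_iff)
    from this[of "e1 * cnj (root_pt N j) ^ k"] show ?thesis by (simp add: g_def h_def field_simps)
  qed
  have sum_root: "(\<Sum>j<N. root_pt N j ^ k) = 0"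
    using root_pt_orthogonal[of k N 0] k N by simp
  hence "cnj (\<Sum>j<N. root_pt N j ^ k) = cnj 0" by (simp only:)
  hence sum_cnj: "(\<Sum>j<N. cnj (root_pt N j) ^ k) = 0" by simp
  have "(\<Sum>j<N. (1 - e0 * f j) * of_real (g j)) =
    of_nat N - e0 * (\<Sum>j<N. f j * cnj (root_pt N j) ^ 0)
    + (h * (\<Sum>j<N. cnj (root_pt N j) ^ k) + cnj h * (\<Sum>j<N. root_pt N j ^ k))
    - e0 * (h * (\<Sum>j<N. f j * cnj (root_pt N j) ^ k) + cnj h * (\<Sum>j<N. f j * root_pt N j ^ k))"
    unfolding g by (simp add: algebra_simps sum.distrib sum_subtractf sum_distrib_left)
  also have "(\<Sum>j<N. f j * cnj (root_pt N j) ^ 0) = of_nat N * b 0"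
    unfolding f_def using N by (intro root_pt_coeff) auto
  also have "(\<Sum>j<N. f j * cnj (root_pt N j) ^ k) = of_nat N * b k"
    unfolding f_def using k N by (intro root_pt_coeff) auto
  also have "(\<Sum>j<N. f j * root_pt N j ^ k) = 0"
    unfolding f_def using k N by (intro root_pt_coeff_zero) auto
  finally have "(\<Sum>j<N. (1 - e0 * f j) * of_real (g j)) = of_nat N * (1 - e0 * b 0 - e1 * (e0 * b k) / 2)"
    by (simp add: sum_root sum_cnj h_def field_simps)
  also have "\<dots> = of_real (real N * (1 - cmod (b 0) - cmod (b k) / 2))"
    by (simp add: e0 e1 norm_mult)
  finally have "Re (\<Sum>j<N. (1 - e0 * f j) * of_real (g j)) = real N * (1 - cmod (b 0) - cmod (b k) / 2)"
    by simp
  moreover have "Re (\<Sum>j<N. (1 - e0 * f j) * of_real (g j)) \<ge> 0"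
  proof -
    have "Re ((1 - e0 * f j) * of_real (g j)) \<ge> 0" for j
    proof -
      have "Re (e0 * f j) \<le> 1"
        using complex_Re_le_cmod[of "e0 * f j"] bound[of j] by (simp add: norm_mult e0 f_def)
      moreover have "g j \<ge> 0"
        using abs_Re_le_cmod[of "e1 * cnj (root_pt N j) ^ k"]
        by (simp add: g_def norm_mult norm_power e1 abs_le_iff)
      ultimately show ?thesis by simp
    qed
    thus ?thesis unfolding Re_sum by (intro sum_nonneg)
  qed
  ultimately show ?thesis using N0 by (simp add: zero_le_mult_iff)
qed

text \<open>The index \<open>l\<close> is the degree in the variables other than \<open>i\<close>,
  complementary to the power of \<open>z i\<close>.\<close>

definition slice :: "nat \<Rightarrow> ('i list \<Rightarrow> complex) \<Rightarrow> 'i \<Rightarrow> nat \<Rightarrow> 'i list \<Rightarrow> complex" where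
  "slice m t i l = power_coeff m t (m - l) i"

lemma symmetric_on_slice:
  "symmetric_on m (insert i I) t \<Longrightarrow> l \<le> m \<Longrightarrow> symmetric_on l I (slice m t i l)"
  unfolding slice_def power_coeff_def
  by (rule symmetric_on_comp, rule symmetric_on_append[where k = "m - l" and d = m]) auto

text \<open>If the coefficient of \<open>z\<^sub>i\<^sup>m\<close> is at least \<open>1 - \<epsilon>\<close>, the remaining variables are given the
  mass \<open>\<epsilon>\<close>.\<close>

lemma lp_bound_slice:
  fixes t :: "'i list \<Rightarrow> complex"
  assumes fin: "finite I" and i: "i \<notin> I" and sym: "symmetric_on m (insert i I) t"
    and bound: "lp_bound p m (insert i I) t 1" and p: "p \<ge> 2 * real m"
    and \<epsilon>: "0 < \<epsilon>" "\<epsilon> \<le> 1 / 2" and big: "cmod (t (replicate m i)) \<ge> 1 - \<epsilon>"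
    and l: "0 < l" "l \<le> m"
  shows "lp_bound p l I (slice m t i l) (8 * \<epsilon> powr (1 - real l / p))"
  unfolding lp_bound_def
proof (intro allI impI)
  fix y :: "'i \<Rightarrow> complex" assume y: "(\<Sum>i\<in>I. cmod (y i) powr p) \<le> 1"
  have p0: "p > 0" using p l by linarith
  define \<rho> where "\<rho> = (1 - \<epsilon>) powr (1 / p)"
  define \<tau> where "\<tau> = \<epsilon> powr (1 / p)"
  have \<rho>: "\<rho> > 0" and \<tau>: "\<tau> > 0" using \<epsilon> by (auto simp: \<rho>_def \<tau>_def)
  have \<rho>p: "\<rho> powr p = 1 - \<epsilon>" and \<tau>p: "\<tau> powr p = \<epsilon>"
    using p0 \<epsilon> by (auto simp: \<rho>_def \<tau>_def powr_powr)
  have \<rho>_ge: "\<rho> ^ k \<ge> 1 - \<epsilon>" if "k \<le> m" for k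
  proof -
    have "(1 - \<epsilon>) powr 1 \<le> (1 - \<epsilon>) powr (real k / p)"
      using \<epsilon> p p0 that by (intro powr_mono') auto
    also have "\<dots> = \<rho> powr real k" by (simp add: \<rho>_def powr_powr)
    also have "\<dots> = \<rho> ^ k" using \<rho> by (simp add: powr_realpow)
    finally show ?thesis using \<epsilon> by simp
  qed
  \<comment> \<open>The coefficients in the single variable \<open>w\<close> that rotates all
    variables other than \<open>i\<close>; the mass is \<open>1 - \<epsilon>\<close> at
    \<open>i\<close> and at most \<open>\<epsilon>\<close> elsewhere.\<close>
  define b where "b k = of_real (\<rho> ^ (m - k) * \<tau> ^ k) * hpoly k I (slice m t i k) y" for k
  have "cmod (b l) \<le> 2 * (1 - cmod (b 0))"
  proof (rule bounded_coeff_le)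
    fix j
    define w where "w = root_pt (Suc (2 * m)) j"
    define z where "z a = (if a = i then of_real \<rho> else of_real \<tau> * w * y a)" for a
    have "(\<Sum>a\<in>insert i I. cmod (z a) powr p) = \<rho> powr p + (\<Sum>a\<in>I. cmod (z a) powr p)"
      using fin i \<rho> by (simp add: z_def)
    also have "(\<Sum>a\<in>I. cmod (z a) powr p) = (\<Sum>a\<in>I. \<tau> powr p * cmod (y a) powr p)"
      using i \<tau> by (intro sum.cong) (auto simp: z_def norm_mult w_def powr_mult)
    also have "\<dots> = \<epsilon> * (\<Sum>a\<in>I. cmod (y a) powr p)" by (simp add: \<tau>p sum_distrib_left)
    also have "\<rho> powr p + \<dots> \<le> 1"
      using mult_left_mono[OF y, of \<epsilon>] \<epsilon> by (simp add: \<rho>p)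
    finally have "cmod (hpoly m (insert i I) t z) \<le> 1" by (rule lp_boundD[OF bound])
    moreover have "hpoly m (insert i I) t z = (\<Sum>k\<le>m. b k * w ^ k)"
    proof -
      have "hpoly m (insert i I) t z = (\<Sum>k\<le>m. z i ^ k * hpoly (m - k) I (power_coeff m t k i) z)"
        unfolding power_coeff_def[abs_def] by (rule hpoly_insert[OF fin i sym])
      also have "\<dots> = (\<Sum>k\<le>m. z i ^ (m - k) * hpoly k I (slice m t i k) z)"
        by (rule sum.reindex_bij_witness[of _ "\<lambda>k. m - k" "\<lambda>k. m - k"]) (auto simp: slice_def)
      also have "\<dots> = (\<Sum>k\<le>m. b k * w ^ k)"
      proof (intro sum.cong refl)
        fix k
        have "hpoly k I (slice m t i k) z = hpoly k I (slice m t i k) (\<lambda>a. (of_real \<tau> * w) * y a)"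
          by (rule hpoly_cong) (use i in \<open>auto simp: z_def\<close>)
        thus "z i ^ (m - k) * hpoly k I (slice m t i k) z = b k * w ^ k"
          by (simp add: hpoly_scale b_def z_def power_mult_distrib)
      qed
      finally show ?thesis .
    qed
    ultimately show "cmod (\<Sum>k\<le>m. b k * root_pt (Suc (2 * m)) j ^ k) \<le> 1" by (simp add: w_def)
  qed (use l in auto)
  also have "\<dots> \<le> 4 * \<epsilon>"
  proof -
    have "cmod (b 0) = \<rho> ^ m * cmod (t (replicate m i))"
      using \<rho> by (simp add: b_def hpoly_def slice_def power_coeff_def norm_mult norm_power)
    also have "\<dots> \<ge> (1 - \<epsilon>) * (1 - \<epsilon>)"
      using \<epsilon> \<rho> by (intro mult_mono \<rho>_ge big) auto
    finally have "cmod (b 0) \<ge> (1 - \<epsilon>) * (1 - \<epsilon>)" .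
    moreover have "(1 - \<epsilon>) * (1 - \<epsilon>) \<ge> 1 - 2 * \<epsilon>" by (simp add: algebra_simps)
    ultimately have "cmod (b 0) \<ge> 1 - 2 * \<epsilon>" by (rule order.trans[rotated])
    thus ?thesis by simp
  qed
  finally have bl: "cmod (b l) \<le> 4 * \<epsilon>" .
  \<comment> \<open>The remaining power of \<open>\<rho>\<close> is at least 1/2, which turns the
    bound 4 into 8.\<close>
  have "(1 / 2) * (\<tau> ^ l * cmod (hpoly l I (slice m t i l) y)) \<le>
    \<rho> ^ (m - l) * (\<tau> ^ l * cmod (hpoly l I (slice m t i l) y))"
    using \<rho>_ge[of "m - l"] \<epsilon> \<tau> by (intro mult_right_mono) auto
  also have "\<dots> = cmod (b l)"
    using \<rho> \<tau> by (simp add: b_def norm_mult norm_power)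
  also note bl
  finally have 1: "\<tau> ^ l * cmod (hpoly l I (slice m t i l) y) \<le> 8 * \<epsilon>" by simp
  have \<tau>l: "\<tau> ^ l = \<epsilon> powr (real l / p)"
    using \<epsilon> by (simp add: \<tau>_def powr_powr powr_realpow[symmetric])
  have "cmod (hpoly l I (slice m t i l) y) \<le> 8 * \<epsilon> / \<epsilon> powr (real l / p)"
    using 1 \<epsilon> unfolding \<tau>l by (subst pos_le_divide_eq) (auto simp: mult.commute)
  also have "\<dots> = 8 * \<epsilon> powr (1 - real l / p)" using \<epsilon> by (simp add: powr_diff)
  finally show "cmod (hpoly l I (slice m t i l) y) \<le> 8 * \<epsilon> powr (1 - real l / p)" .
qed

section \<open>Comparison of exponents and of powers\<close>

lemma sum_powr_le_of_norm_le:
  fixes f :: "'b \<Rightarrow> real"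
  assumes fin: "finite A" and f: "\<And>x. f x \<ge> 0" and q: "0 < q" "q \<le> q'" and C: "C > 0"
    and le: "(\<Sum>x\<in>A. f x powr q) powr (1 / q) \<le> C"
  shows "(\<Sum>x\<in>A. f x powr q') \<le> C powr q'"
proof -
  have "((\<Sum>x\<in>A. f x powr q) powr (1 / q)) powr q \<le> C powr q"
    using q by (intro powr_mono2 le) auto
  hence S: "(\<Sum>x\<in>A. f x powr q) \<le> C powr q" using q by (simp add: powr_powr sum_nonneg)
  \<comment> \<open>Every single term is at most \<open>C\<close>, which pays for the surplus
    \<open>q' - q\<close> of the exponent.\<close>
  have "f x powr q' \<le> f x powr q * C powr (q' - q)" if x: "x \<in> A" for x
  proof -
    have "f x powr q \<le> (\<Sum>x\<in>A. f x powr q)" using fin x by (intro member_le_sum) auto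
    also note S
    finally have "\<not> C powr q < f x powr q" by simp
    hence "f x \<le> C" using q C powr_less_mono2[of q C "f x"] by fastforce
    hence "f x powr (q' - q) \<le> C powr (q' - q)" using q f[of x] by (intro powr_mono2) auto
    hence "f x powr q * f x powr (q' - q) \<le> f x powr q * C powr (q' - q)" by (intro mult_left_mono) auto
    thus ?thesis by (simp add: powr_add[symmetric])
  qed
  hence "(\<Sum>x\<in>A. f x powr q') \<le> (\<Sum>x\<in>A. f x powr q) * C powr (q' - q)"
    unfolding sum_distrib_right by (rule sum_mono)
  also have "\<dots> \<le> C powr q * C powr (q' - q)" by (intro mult_right_mono S) auto
  also have "\<dots> = C powr q'" by (simp add: powr_add[symmetric])
  finally show ?thesis .
qed

lemma hl_exponent_le_2:
  assumes "d > 0" "p \<ge> 2 * real d"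
  shows "hl_exponent p d \<le> 2"
proof -
  have "1 / p \<le> 1 / (2 * real d)" using assms by (intro divide_left_mono) auto
  hence "1 / hl_exponent p d \<ge> 1 / 2" using assms by (subst inverse_hl_exponent) auto
  thus ?thesis using hl_exponent_pos[OF assms] by (simp add: field_simps)
qed

lemma hl_exponent_ge:
  assumes "d > 0" "p \<ge> 2 * real d"
  shows "2 * real d / (real d + 1) \<le> hl_exponent p d"
proof -
  have p: "p > 0" using assms by linarith
  have "1 / hl_exponent p d \<le> 1 / 2 + 1 / (2 * real d)"
    using assms p by (subst inverse_hl_exponent) auto
  also have "\<dots> = (real d + 1) / (2 * real d)" using assms by (simp add: field_simps)
  finally show ?thesis using hl_exponent_pos[OF assms] assms by (simp add: field_simps)
qed

lemma hl_exponent_mono: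
  assumes "0 < l" "l \<le> d" "p \<ge> 2 * real d"
  shows "hl_exponent p l \<le> hl_exponent p d"
proof -
  have p: "p > 0" and d: "d > 0" using assms by linarith+
  have "1 / (2 * real d) \<le> 1 / (2 * real l)" using assms by (intro divide_left_mono) auto
  hence "1 / hl_exponent p d \<le> 1 / hl_exponent p l"
    using assms p by (simp add: inverse_hl_exponent)
  moreover have "hl_exponent p l > 0" "hl_exponent p d > 0"
    using assms d by (auto intro!: hl_exponent_pos)
  ultimately show ?thesis by (simp add: field_simps)
qed

text \<open>Ensures that the factor \<open>\<epsilon> powr (1 - l / p)\<close> of a slice is at most
  \<open>\<epsilon>\<close> once raised to the power \<open>hl_exponent p d\<close>. The worst case
  is \<open>l = d\<close>, which amounts to
  \<open>(d - 1) / p \<le> (d - 1) / (2 * d)\<close>.\<close>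

lemma hl_exponent_slice_ge_1:
  assumes "0 < l" "l \<le> d" "p \<ge> 2 * real d"
  shows "(1 - real l / p) * hl_exponent p d \<ge> 1"
proof -
  have p: "p > 0" and d: "d > 0" using assms by linarith+
  have q: "hl_exponent p d > 0" using assms d by (intro hl_exponent_pos)
  have "(real d - 1) / p \<le> (real d - 1) / (2 * real d)"
    using assms d by (intro divide_left_mono) auto
  also have "\<dots> = 1 / 2 - 1 / (2 * real d)" using d by (simp add: field_simps)
  finally have "1 / hl_exponent p d \<le> 1 - real d / p"
    using inverse_hl_exponent[OF d p] by (simp add: diff_divide_distrib)
  also have "\<dots> \<le> 1 - real l / p" using assms p by (simp add: divide_right_mono)
  finally show ?thesis using q by (simp add: field_simps)
qed

text \<open>The exponent is below 2 by at most \<open>2 / (m + 1)\<close>, and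
  \<open>m powr (1 / (m + 1)) \<le> 2\<close>, so the power decays like a square up to a factor
  2.\<close>

lemma powr_div_sqrt_le:
  assumes c: "c \<ge> 1" and m: "m > 0" and q: "2 * real m / (real m + 1) \<le> q" "q \<le> 2"
  shows "(c / sqrt (real m)) powr q \<le> 2 * c\<^sup>2 / real m"
proof -
  have m1: "real m \<ge> 1" using m by simp
  have "(c / sqrt (real m)) powr q = c powr q * real m powr (- (q / 2))"
    using c m by (simp add: powr_divide powr_half_sqrt[symmetric] powr_powr powr_minus_divide)
  also have "\<dots> \<le> c powr 2 * real m powr (1 / (real m + 1) - 1)"
  proof (intro mult_mono powr_mono)
    have "q / 2 \<ge> real m / (real m + 1)" using q(1) by (simp add: mult.commute)
    moreover have "real m / (real m + 1) = 1 - 1 / (real m + 1)" by (simp add: field_simps)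
    ultimately show "- (q / 2) \<le> 1 / (real m + 1) - 1" by linarith
  qed (use c q m1 in auto)
  also have "real m powr (1 / (real m + 1) - 1) = real m powr (1 / (real m + 1)) / real m"
    using m by (simp add: powr_diff)
  also have "c powr 2 * \<dots> \<le> c powr 2 * (2 / real m)"
  proof (intro mult_left_mono divide_right_mono)
    have "m < 2 ^ (m + 1)" using less_exp[of "m + 1"] by linarith
    hence "real m < real (2 ^ (m + 1))" by (simp only: of_nat_less_iff)
    hence "real m \<le> 2 powr (real m + 1)" by (simp add: powr_add powr_realpow)
    hence "real m powr (1 / (real m + 1)) \<le> (2 powr (real m + 1)) powr (1 / (real m + 1))"
      by (intro powr_mono2) auto
    also have "\<dots> = 2" unfolding powr_powr by simp
    finally show "real m powr (1 / (real m + 1)) \<le> 2" .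
  qed auto
  finally show ?thesis using c by (simp add: mult.commute)
qed

lemma powr_slice_le:
  fixes c \<epsilon> q e :: real
  assumes "c \<ge> 1" "0 < \<epsilon>" "\<epsilon> \<le> 1" "q \<le> 2" "e * q \<ge> 1"
  shows "(c * \<epsilon> powr e) powr q \<le> c\<^sup>2 * \<epsilon>"
proof -
  have "(c * \<epsilon> powr e) powr q = c powr q * \<epsilon> powr (e * q)"
    using assms by (simp add: powr_mult powr_powr)
  also have "\<dots> \<le> c powr 2 * \<epsilon> powr 1"
    using assms by (intro mult_mono powr_mono powr_mono') auto
  finally show ?thesis using assms by simp
qed

text \<open>The same closeness of \<open>q\<close> to 2 applies: the binomial is at most
  \<open>2 ^ m\<close>, so its power \<open>2 - q\<close> is at most 4.\<close>

lemma binomial_powr_le: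
  assumes m: "m > 0" and k: "k \<le> m" and q: "2 * real m / (real m + 1) \<le> q"
  shows "real (m choose k) powr (1 - q) \<le> 4 / real (m choose k)"
proof -
  define b where "b = real (m choose k)"
  have b1: "b \<ge> 1" using k by (simp add: b_def Suc_leI)
  have "(m choose k) \<le> 2 ^ m" by (simp add: binomial_le_pow2)
  hence "real (m choose k) \<le> real (2 ^ m)" by (simp only: of_nat_le_iff)
  hence b2: "b \<le> 2 powr real m" by (simp add: b_def powr_realpow)
  have "2 * real m / (real m + 1) = 2 - 2 / (real m + 1)" by (simp add: field_simps)
  hence "b powr (2 - q) \<le> b powr (2 / (real m + 1))" using q b1 by (intro powr_mono) auto
  also have "\<dots> \<le> (2 powr real m) powr (2 / (real m + 1))" using b1 b2 by (intro powr_mono2) auto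
  also have "\<dots> = 2 powr (2 * real m / (real m + 1))" by (simp add: powr_powr mult.commute)
  also have "\<dots> \<le> 2 powr 2" by (intro powr_mono) (auto simp: field_simps)
  finally have "b powr (2 - q) \<le> 4" by simp
  moreover have "b powr (1 - q) = b powr (2 - q) / b"
    using b1 by (simp add: powr_diff power2_eq_square)
  ultimately show ?thesis using b1 by (simp add: b_def[symmetric] divide_right_mono)
qed

text \<open>Here 24 is \<open>3 * 8\<close> and 56 is \<open>7 * 8\<close>, from the coefficient
  bounds and the slice bound. The first summand comes from the words containing the distinguished
  letter, the second from those avoiding it.\<close>

definition off_const :: real where
  "off_const = 16 * (24 * L1_const)\<^sup>2 + 2 * (56 * L1_const)\<^sup>2"

lemma L1_const_ge_1: "L1_const \<ge> 1"
proof -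
  have "sqrt (17 ^ 128) \<ge> (1::real)" by (intro real_sqrt_ge_one one_le_power) simp
  thus ?thesis by (simp add: L1_const_def)
qed

text \<open>Words are sorted by the number \<open>k\<close> of letters \<open>i\<close>. For
  \<open>k = 0\<close> the bound for nonconstant words gives the factor \<open>1 / m\<close>. For
  \<open>0 < k < m\<close> there are \<open>b = m choose k\<close> placements, but the slice
  coefficients carry a factor \<open>b\<close> each, so \<open>b powr (1 - q) \<le> 4 / b\<close>
  remains, and the reciprocal binomials sum to \<open>4 / m\<close>.\<close>

lemma sum_nonconst_powr_le_near_extremal:
  fixes t :: "'i list \<Rightarrow> complex"
  assumes fin: "finite I" and i: "i \<notin> I" and sym: "symmetric_on m (insert i I) t"
    and bound: "lp_bound p m (insert i I) t 1" and m: "m \<ge> 6" and p: "p \<ge> 2 * real m"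
    and \<epsilon>: "0 < \<epsilon>" "\<epsilon> \<le> 1 / 2" and big: "cmod (t (replicate m i)) \<ge> 1 - \<epsilon>"
  defines "q \<equiv> hl_exponent p m"
  shows "(\<Sum>J\<in>tuples m (insert i I). cmod (nonconst t J) powr q) \<le> off_const / real m * \<epsilon>"
proof -
  note L = L1_const_ge_1
  have m0: "m > 0" and p0: "p > 0" using m p by linarith+
  have q0: "q > 0" and q2: "q \<le> 2" and qge: "2 * real m / (real m + 1) \<le> q"
    unfolding q_def using m0 p by (auto intro!: hl_exponent_pos hl_exponent_le_2 hl_exponent_ge)
  have slice: "lp_bound p l I (slice m t i l) (8 * \<epsilon> powr (1 - real l / p))" if "0 < l" "l \<le> m" for l
    by (rule lp_bound_slice[OF fin i sym bound p \<epsilon> big that])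
  have one: "(1 - real l / p) * q \<ge> 1" if "0 < l" "l \<le> m" for l
    unfolding q_def by (rule hl_exponent_slice_ge_1[OF that p])
  define G where "G k = (\<Sum>J\<in>tuples (m - k) I. cmod (nonconst t (replicate k i @ J)) powr q)" for k
  have G0: "G 0 \<le> 2 * (56 * L1_const)\<^sup>2 / real m * \<epsilon>"
  proof -
    have sl: "slice m t i m = t" by (simp add: fun_eq_iff slice_def power_coeff_def)
    define C where "C = 7 * L1_const / sqrt (real m) * (8 * \<epsilon> powr (1 - real m / p))"
    have "(\<Sum>J\<in>tuples m I. cmod (nonconst t J) powr q) powr (1 / q) \<le> C"
      unfolding q_def C_def
      by (rule coeff_norm_nonconst_le[OF fin _ m p])
         (use symmetric_on_slice[OF sym order.refl] slice[OF m0 order.refl] in \<open>simp_all add: sl\<close>)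
    hence "G 0 \<le> C powr q"
      unfolding G_def using \<epsilon> m0 L q0
      by (intro sum_powr_le_of_norm_le[where q = q]) (auto simp: fin C_def)
    also have "C = (56 * L1_const / sqrt (real m)) * (1 * \<epsilon> powr (1 - real m / p))" by (simp add: C_def)
    also have "\<dots> powr q = (56 * L1_const / sqrt (real m)) powr q * (1 * \<epsilon> powr (1 - real m / p)) powr q"
      by (rule powr_mult)
    also have "\<dots> \<le> 2 * (56 * L1_const)\<^sup>2 / real m * (1\<^sup>2 * \<epsilon>)"
      using L m0 qge q2 \<epsilon> one[OF m0 order.refl]
      by (intro mult_mono powr_div_sqrt_le powr_slice_le) auto
    finally show ?thesis by simp
  qed
  have Gm: "G m = 0"
    by (simp add: G_def nonconst_def)
  have Gk: "real (m choose k) * G k \<le> (4 * (24 * L1_const)\<^sup>2 * \<epsilon>) * (1 / real (m choose k))"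
    if k: "k \<in> {1..<m}" for k
  proof -
    define l where "l = m - k"
    define b where "b = real (m choose k)"
    have b: "b > 0" using k by (simp add: b_def)
    have l: "0 < l" "l \<le> m" "m - l = k" using k by (auto simp: l_def)
    define C where "C = 3 * L1_const * (8 * \<epsilon> powr (1 - real l / p))"
    have pl: "2 * real l \<le> p" using l p by linarith
    have "(\<Sum>J\<in>tuples l I. cmod (slice m t i l J) powr hl_exponent p l) powr (1 / hl_exponent p l) \<le> C"
      unfolding C_def
      by (rule coeff_norm_le[OF fin symmetric_on_slice[OF sym l(2)] l(1) pl slice[OF l(1,2)]])
    \<comment> \<open>A slice of degree \<open>l\<close> comes with the exponent of its own degree,
      which is at most \<open>q\<close>.\<close>
    hence "(\<Sum>J\<in>tuples l I. cmod (slice m t i l J) powr q) \<le> C powr q"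
      unfolding q_def using l p \<epsilon> L pl
      by (intro sum_powr_le_of_norm_le[where q = "hl_exponent p l"] hl_exponent_mono hl_exponent_pos)
         (auto simp: fin C_def)
    also have "C powr q \<le> (24 * L1_const)\<^sup>2 * \<epsilon>"
      unfolding C_def using powr_slice_le[of "24 * L1_const" \<epsilon> q "1 - real l / p"] L \<epsilon> q2 one[OF l(1,2)]
      by (simp add: mult.assoc)
    finally have S: "(\<Sum>J\<in>tuples l I. cmod (slice m t i l J) powr q) \<le> (24 * L1_const)\<^sup>2 * \<epsilon>" .
    have "G k \<le> (\<Sum>J\<in>tuples l I. cmod (t (replicate k i @ J)) powr q)"
      unfolding G_def l_def using q0 by (intro sum_mono powr_mono2 norm_nonconst_le) auto
    also have "\<dots> = (\<Sum>J\<in>tuples l I. b powr (- q) * cmod (slice m t i l J) powr q)"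
    proof (intro sum.cong refl)
      fix J
      have "cmod (slice m t i l J) = b * cmod (t (replicate k i @ J))"
        by (simp add: slice_def power_coeff_def l(3) b_def norm_mult)
      thus "cmod (t (replicate k i @ J)) powr q = b powr (- q) * cmod (slice m t i l J) powr q"
        using b by (simp add: powr_mult powr_minus)
    qed
    also have "\<dots> = b powr (- q) * (\<Sum>J\<in>tuples l I. cmod (slice m t i l J) powr q)"
      by (simp only: sum_distrib_left)
    also have "\<dots> \<le> b powr (- q) * ((24 * L1_const)\<^sup>2 * \<epsilon>)"
      by (intro mult_left_mono S) simp
    finally have "b * G k \<le> b * (b powr (- q) * ((24 * L1_const)\<^sup>2 * \<epsilon>))"
      using b by (intro mult_left_mono) auto
    also have "\<dots> = b powr (1 - q) * ((24 * L1_const)\<^sup>2 * \<epsilon>)"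
      using b by (simp add: powr_diff powr_minus field_simps)
    also have "\<dots> \<le> 4 / b * ((24 * L1_const)\<^sup>2 * \<epsilon>)"
      unfolding b_def using k \<epsilon> m0 qge by (intro mult_right_mono binomial_powr_le) auto
    finally show ?thesis by (simp add: b_def mult_ac)
  qed
  have "(\<Sum>J\<in>tuples m (insert i I). cmod (nonconst t J) powr q) = (\<Sum>k\<le>m. real (m choose k) * G k)"
    unfolding G_def
    by (rule sum_tuples_insert[OF fin i]) (rule symmetric_on_comp[OF symmetric_on_nonconst[OF sym]])
  also have "{..m} = insert 0 (insert m {1..<m})" using m0 by auto
  also have "(\<Sum>k\<in>insert 0 (insert m {1..<m}). real (m choose k) * G k) =
    G 0 + (\<Sum>k=1..<m. real (m choose k) * G k)"
    using m0 by (simp add: Gm)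
  also have "\<dots> \<le> 2 * (56 * L1_const)\<^sup>2 / real m * \<epsilon> +
    (\<Sum>k=1..<m. (4 * (24 * L1_const)\<^sup>2 * \<epsilon>) * (1 / real (m choose k)))"
    by (intro add_mono G0 sum_mono Gk)
  also have "\<dots> = 2 * (56 * L1_const)\<^sup>2 / real m * \<epsilon> +
    4 * (24 * L1_const)\<^sup>2 * \<epsilon> * (\<Sum>k=1..<m. 1 / real (m choose k))"
    by (simp only: sum_distrib_left)
  also have "\<dots> \<le> 2 * (56 * L1_const)\<^sup>2 / real m * \<epsilon> + 4 * (24 * L1_const)\<^sup>2 * \<epsilon> * (4 / real m)"
    using \<epsilon> m0 by (intro add_mono mult_left_mono sum_inverse_binomial_le) auto
  also have "\<dots> = off_const / real m * \<epsilon>"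
    by (simp add: off_const_def add_divide_distrib algebra_simps)
  finally show ?thesis .
qed

text \<open>When \<open>\<epsilon>\<close> exceeds 1/2 the general bound for nonconstant words is
  already strong enough.\<close>

lemma sum_nonconst_powr_le:
  fixes t :: "'i list \<Rightarrow> complex"
  assumes fin: "finite I" and i: "i \<in> I" and sym: "symmetric_on m I t"
    and bound: "lp_bound p m I t 1" and m: "m \<ge> 6" and p: "p \<ge> 2 * real m"
    and \<epsilon>: "0 < \<epsilon>" and big: "cmod (t (replicate m i)) \<ge> 1 - \<epsilon>"
  shows "(\<Sum>J\<in>tuples m I. cmod (nonconst t J) powr hl_exponent p m) \<le> off_const / real m * \<epsilon>"
proof (cases "\<epsilon> \<le> 1 / 2")
  case True
  have "I = insert i (I - {i})" using i by auto
  thus ?thesis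
    using sum_nonconst_powr_le_near_extremal[of "I - {i}" i m t p \<epsilon>] assms True by simp
next
  case False
  note L = L1_const_ge_1
  have m0: "m > 0" using m by linarith
  let ?q = "hl_exponent p m"
  have "(\<Sum>J\<in>tuples m I. cmod (nonconst t J) powr ?q) \<le> (7 * L1_const / sqrt (real m)) powr ?q"
    using coeff_norm_nonconst_le[OF fin sym m p bound] hl_exponent_pos[OF m0 p] m0 L
    by (intro sum_powr_le_of_norm_le[where q = ?q]) (auto simp: fin)
  also have "\<dots> \<le> 2 * (7 * L1_const)\<^sup>2 / real m"
    using L m0 p by (intro powr_div_sqrt_le hl_exponent_ge hl_exponent_le_2) auto
  also have "\<dots> \<le> off_const / real m * (1 / 2)"
    using m0 L by (simp add: off_const_def divide_right_mono power_mult_distrib)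
  also have "\<dots> \<le> off_const / real m * \<epsilon>"
    using False m0 by (intro mult_left_mono) (auto simp: off_const_def)
  finally show ?thesis .
qed

section \<open>The contractive inequality\<close>

lemma sum_pure_plus_nonconst:
  assumes fin: "finite I" and m: "m > 0"
  shows "(\<Sum>J\<in>tuples m I. cmod (t J) powr q) =
    (\<Sum>i\<in>I. cmod (t (replicate m i)) powr q) + (\<Sum>J\<in>tuples m I. cmod (nonconst t J) powr q)"
proof -
  have "(\<Sum>J\<in>tuples m I. cmod (t J) powr q) =
    (\<Sum>J\<in>tuples m I. (if J \<in> replicate m ` I then cmod (t J) powr q else 0) + cmod (nonconst t J) powr q)"
  proof (intro sum.cong refl)
    fix J assume J: "J \<in> tuples m I"
    have "(\<exists>i. J = replicate (length J) i) \<longleftrightarrow> J \<in> replicate m ` I"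
    proof -
      have "length J = m" using J by (simp add: tuples_def)
      moreover have "i \<in> I" if "J = replicate m i" for i using J m that by simp
      ultimately show ?thesis by auto
    qed
    thus "cmod (t J) powr q = (if J \<in> replicate m ` I then cmod (t J) powr q else 0) + cmod (nonconst t J) powr q"
      by (simp add: nonconst_def)
  qed
  also have "(\<Sum>J\<in>tuples m I. (if J \<in> replicate m ` I then cmod (t J) powr q else 0) + cmod (nonconst t J) powr q) =
    (\<Sum>J\<in>replicate m ` I. cmod (t J) powr q) + (\<Sum>J\<in>tuples m I. cmod (nonconst t J) powr q)"
  proof -
    have "tuples m I \<inter> replicate m ` I = replicate m ` I" by auto
    thus ?thesis using fin by (simp add: sum.distrib sum.inter_restrict[symmetric])
  qed
  also have "(\<Sum>J\<in>replicate m ` I. cmod (t J) powr q) = (\<Sum>i\<in>I. cmod (t (replicate m i)) powr q)"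
    using m by (subst sum.reindex) (auto simp: inj_on_def replicate_eq_replicate)
  finally show ?thesis .
qed

text \<open>With \<open>x = s * e\<close> in the unit interval, the power is at most
  \<open>exp (- x) \<le> 1 / (1 + x) \<le> 1 - x / 2\<close>.\<close>

lemma one_minus_powr_le:
  fixes e s :: real
  assumes "0 \<le> e" "e \<le> 1" "0 < s" "s \<le> 1"
  shows "(1 - e) powr s \<le> 1 - s * e / 2"
proof (cases "e = 1")
  case False
  define x where "x = s * e"
  have x: "0 \<le> x" "x \<le> 1" using assms by (auto simp: x_def mult_le_one)
  have "s * ln (1 - e) \<le> s * (- e)"
    using assms False ln_le_minus_one[of "1 - e"] by (intro mult_left_mono) auto
  hence "(1 - e) powr s \<le> exp (- x)" using assms False by (simp add: powr_def x_def)
  also have "\<dots> = 1 / exp x" by (simp add: exp_minus field_simps)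
  also have "\<dots> \<le> 1 / (1 + x)" using x by (intro divide_left_mono) auto
  also have "\<dots> \<le> 1 - x / 2"
  proof -
    have "x * x \<le> x * 1" using x by (intro mult_left_mono) auto
    hence "1 \<le> (1 - x / 2) * (1 + x)" by (simp add: algebra_simps)
    thus ?thesis using x by (simp add: pos_divide_le_eq)
  qed
  finally show ?thesis by (simp add: x_def)
qed (use assms in auto)

text \<open>The difference factors. The first factor is at least 1/2 because
  \<open>m \<ge> 3\<close>; the second is at least \<open>A / (m + A)\<close>, hence at least
  \<open>A / (2 * m)\<close> because \<open>A \<le> m\<close>.\<close>

lemma hl_exponent_gap:
  assumes m: "m \<ge> 3" and A: "0 < A" "A \<le> real m" and p: "p \<ge> 2 * real m + A"
  shows "A / (4 * real m) \<le> hl_exponent p m - p / (p - real m)"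
    and "hl_exponent p m - p / (p - real m) \<le> 1"
proof -
  have m3: "real m \<ge> 3" using m by simp
  have p0: "p > 0" and pm: "p - real m > 0" "p - 2 * real m > 0" using p A m by linarith+
  have "real m * p > 0" using p0 m3 by (intro mult_pos_pos) auto
  hence D: "real m * p + p - 2 * real m > 0" using pm by linarith
  have eq: "hl_exponent p m - p / (p - real m) =
    (p * (real m - 1) / (real m * p + p - 2 * real m)) * ((p - 2 * real m) / (p - real m))"
    unfolding hl_exponent_def using D pm by (simp add: field_simps)
  have "p * (real m - 1) * 2 \<ge> real m * p + p - 2 * real m"
  proof -
    have "p * (real m - 3) \<ge> 0" using p0 m3 by simp
    thus ?thesis using m3 by (simp add: algebra_simps)
  qed
  hence 1: "p * (real m - 1) / (real m * p + p - 2 * real m) \<ge> 1 / 2"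
    using D by (simp add: field_simps)
  have "A / (real m + A) \<le> (p - 2 * real m) / (p - real m)"
  proof -
    have "(p - 2 * real m) * (real m + A) - A * (p - real m) = real m * (p - 2 * real m - A)"
      by (simp add: algebra_simps)
    also have "\<dots> \<ge> 0" using p m3 by simp
    finally show ?thesis using pm A m3 by (simp add: frac_le_eq divide_simps)
  qed
  moreover have "A / (2 * real m) \<le> A / (real m + A)"
    using A m3 by (intro divide_left_mono) auto
  ultimately have 2: "A / (2 * real m) \<le> (p - 2 * real m) / (p - real m)" by linarith
  have "1 / 2 * (A / (2 * real m)) \<le> hl_exponent p m - p / (p - real m)"
    unfolding eq
  proof (intro mult_mono 1 2)
    show "0 \<le> p * (real m - 1) / (real m * p + p - 2 * real m)" using 1 by linarith
  qed (use A in auto)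
  thus "A / (4 * real m) \<le> hl_exponent p m - p / (p - real m)" by simp
  have "hl_exponent p m \<le> 2" using m pm by (intro hl_exponent_le_2) auto
  moreover have "p / (p - real m) \<ge> 1" using pm by simp
  ultimately show "hl_exponent p m - p / (p - real m) \<le> 1" by linarith
qed

text \<open>The diagonal loses \<open>gap_const * e / (8 * m)\<close>: 4 from the exponent gap, 2
  from \<open>one_minus_powr_le\<close>. The added 1 makes the loss strictly exceed the off-diagonal
  contribution.\<close>

definition gap_const :: real where "gap_const = 8 * off_const + 1"

lemma off_const_nonneg: "off_const \<ge> 0"
  by (simp add: off_const_def)

lemma coeff_sum_le_1:
  fixes t :: "'i list \<Rightarrow> complex"
  assumes fin: "finite I" and sym: "symmetric_on m I t" and bound: "lp_bound p m I t 1"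
    and m: "m \<ge> 6" "real m \<ge> gap_const" and p: "p \<ge> 2 * real m + gap_const"
  defines "S \<equiv> (\<Sum>J\<in>tuples m I. cmod (t J) powr hl_exponent p m)"
  shows "S \<le> 1"
    and "S = 1 \<Longrightarrow> \<exists>j\<in>I. cmod (t (replicate m j)) = 1 \<and> (\<forall>J\<in>tuples m I. J \<noteq> replicate m j \<longrightarrow> t J = 0)"
proof -
  define q where "q = hl_exponent p m"
  define r where "r = p / (p - real m)"
  define a where "a i = cmod (t (replicate m i))" for i
  define S' where "S' = (\<Sum>J\<in>tuples m I. cmod (nonconst t J) powr q)"
  have A: "gap_const > 0" using off_const_nonneg by (simp add: gap_const_def)
  have m0: "m > 0" and p2: "p \<ge> 2 * real m" and pm: "p > real m" using m p A by linarith+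
  have q0: "q > 0" unfolding q_def by (rule hl_exponent_pos[OF m0 p2])
  have gap: "gap_const / (4 * real m) \<le> q - r" "q - r \<le> 1"
    unfolding q_def r_def using m A p by (auto intro!: hl_exponent_gap)
  have "gap_const / (4 * real m) > 0" using A m0 by simp
  hence gap0: "q - r > 0" using gap(1) by linarith
  have S: "S = (\<Sum>i\<in>I. a i powr q) + S'"
    unfolding S_def S'_def a_def q_def by (rule sum_pure_plus_nonconst[OF fin m0])
  have pure: "(\<Sum>i\<in>I. a i powr r) \<le> 1"
    unfolding a_def r_def by (rule sum_pure_powr_le[OF fin m0 pm bound])
  have main: "S \<le> 1 \<and> (S = 1 \<longrightarrow> (\<exists>j\<in>I. a j = 1 \<and> (\<forall>J\<in>tuples m I. J \<noteq> replicate m j \<longrightarrow> t J = 0)))"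
  proof (cases "I = {}")
    case True
    thus ?thesis using m0 by (simp add: S_def tuples_empty)
  next
    case False
    have "Max (a ` I) \<in> a ` I" using fin False by (intro Max_in) auto
    then obtain i where i: "i \<in> I" "a i = Max (a ` I)" by auto
    have ai: "a j \<le> a i" if "j \<in> I" for j unfolding i(2) using fin that by simp
    have a0: "a j \<ge> 0" for j by (simp add: a_def)
    have r0: "r > 0" using pm p2 m0 by (simp add: r_def)
    have "a i powr r \<le> (\<Sum>i\<in>I. a i powr r)" using fin i by (intro member_le_sum) auto
    hence "a i powr r \<le> 1" using pure by linarith
    hence ai1: "a i \<le> 1" using r0 a0[of i] by (metis gr_one_powr linorder_not_le)
    define e where "e = 1 - a i"
    have e: "0 \<le> e" "e \<le> 1" using ai1 a0[of i] by (auto simp: e_def)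
    have "(\<Sum>j\<in>I. a j powr q) \<le> (\<Sum>j\<in>I. a i powr (q - r) * a j powr r)"
    proof (rule sum_mono)
      fix j assume j: "j \<in> I"
      have "a j powr q = a j powr (q - r) * a j powr r" by (simp flip: powr_add)
      also have "\<dots> \<le> a i powr (q - r) * a j powr r"
        using gap0 ai[OF j] a0 by (intro mult_right_mono powr_mono2) auto
      finally show "a j powr q \<le> a i powr (q - r) * a j powr r" .
    qed
    also have "\<dots> = a i powr (q - r) * (\<Sum>j\<in>I. a j powr r)" by (simp only: sum_distrib_left)
    also have "\<dots> \<le> a i powr (q - r) * 1" by (intro mult_left_mono pure) simp
    also have "a i powr (q - r) = (1 - e) powr (q - r)" by (simp add: e_def)
    also have "\<dots> \<le> 1 - (q - r) * e / 2" using gap0 gap(2) e by (intro one_minus_powr_le)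
    finally have diag: "(\<Sum>j\<in>I. a j powr q) \<le> 1 - (q - r) * e / 2" by simp
    have S'_le: "S' \<le> off_const / real m * x" if "x > 0" "e \<le> x" for x
      unfolding S'_def q_def
      using that by (intro sum_nonconst_powr_le[OF fin i(1) sym bound m(1) p2]) (auto simp: e_def a_def)
    have S'0: "S' \<ge> 0" by (simp add: S'_def sum_nonneg)
    show ?thesis
    proof (cases "e = 0")
      case False
      hence e0: "e > 0" using e by simp
      have "gap_const / (4 * real m) * e / 2 \<le> (q - r) * e / 2"
        using gap(1) e by (intro divide_right_mono mult_right_mono) auto
      moreover have "gap_const / (4 * real m) * e / 2 = off_const / real m * e + e / (8 * real m)"
        using m0 by (simp add: gap_const_def field_simps)
      moreover have "e / (8 * real m) > 0" using e0 m0 by simp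
      moreover have "S' \<le> off_const / real m * e" using e0 by (intro S'_le) auto
      ultimately have "S < 1" using diag S by linarith
      thus ?thesis by simp
    next
      case True
      \<comment> \<open>The off-diagonal estimate requires a positive defect, so it is used for all
        \<open>x > 0\<close> and followed by a limit.\<close>
      have "S' \<le> 0"
      proof (rule field_le_epsilon)
        fix \<delta> :: real assume \<delta>: "\<delta> > 0"
        define x where "x = \<delta> * real m / (off_const + 1)"
        have x: "x > 0" using \<delta> m0 off_const_nonneg by (simp add: x_def)
        have "S' \<le> off_const / real m * x" using x True by (intro S'_le) auto
        also have "\<dots> = \<delta> * (off_const / (off_const + 1))" using m0 by (simp add: x_def)
        also have "\<dots> \<le> \<delta> * 1" using \<delta> off_const_nonneg by (intro mult_left_mono) auto
        finally show "S' \<le> 0 + \<delta>" by simp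
      qed
      hence S'_eq: "S' = 0" using S'0 by simp
      have ai_eq: "a i = 1" using True by (simp add: e_def)
      have "t J = 0" if J: "J \<in> tuples m I" "J \<noteq> replicate m i" for J
      proof (cases "\<exists>j. J = replicate m j")
        case True
        then obtain j where j: "J = replicate m j" by blast
        have jI: "j \<in> I" "j \<noteq> i" using J m0 by (auto simp: j)
        \<comment> \<open>The coefficient \<open>a i = 1\<close> already exhausts the sum of
          \<open>r\<close>-th powers, which excludes a second pure power.\<close>
        have "a i powr r + a j powr r = (\<Sum>l\<in>{i, j}. a l powr r)" using jI by simp
        also have "\<dots> \<le> (\<Sum>l\<in>I. a l powr r)" using fin i(1) jI by (intro sum_mono2) auto
        finally have "a i powr r + a j powr r \<le> 1" using pure by linarith
        moreover have "a i powr r = 1" by (simp add: ai_eq)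
        ultimately have "\<not> a j powr r > 0" by linarith
        hence "a j = 0" by simp
        thus ?thesis by (simp add: a_def j)
      next
        case False
        have "\<forall>J\<in>tuples m I. cmod (nonconst t J) powr q = 0"
          using S'_eq fin unfolding S'_def by (subst (asm) sum_nonneg_eq_0_iff) auto
        hence "nonconst t J = 0" using J(1) by simp
        moreover have "length J = m" using J(1) by (simp add: tuples_def)
        ultimately show ?thesis using False by (simp add: nonconst_def)
      qed
      thus ?thesis using diag S S'_eq True i(1) ai_eq by auto
    qed
  qed
  thus "S \<le> 1" by simp
  show "S = 1 \<Longrightarrow> \<exists>j\<in>I. cmod (t (replicate m j)) = 1 \<and> (\<forall>J\<in>tuples m I. J \<noteq> replicate m j \<longrightarrow> t J = 0)"
    using main by (simp add: a_def)
qed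

lemma coeff_norm_le_bound:
  fixes t :: "'i list \<Rightarrow> complex"
  assumes fin: "finite I" and sym: "symmetric_on m I t" and bound: "lp_bound p m I t M" and M: "M > 0"
    and m: "m \<ge> 6" "real m \<ge> gap_const" and p: "p \<ge> 2 * real m + gap_const"
  defines "N \<equiv> (\<Sum>J\<in>tuples m I. cmod (t J) powr hl_exponent p m) powr (1 / hl_exponent p m)"
  shows "N \<le> M"
    and "N = M \<Longrightarrow> \<exists>j\<in>I. cmod (t (replicate m j)) = M \<and> (\<forall>J\<in>tuples m I. J \<noteq> replicate m j \<longrightarrow> t J = 0)"
proof -
  define q where "q = hl_exponent p m"
  define s where "s J = of_real (1 / M) * t J" for J
  define S where "S = (\<Sum>J\<in>tuples m I. cmod (t J) powr q)"
  have "gap_const > 0" using off_const_nonneg by (simp add: gap_const_def)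
  hence q0: "q > 0" unfolding q_def using m p by (intro hl_exponent_pos) auto
  have sym_s: "symmetric_on m I s" unfolding s_def by (rule symmetric_on_comp[OF sym])
  have bound_s: "lp_bound p m I s 1"
    unfolding lp_bound_def s_def hpoly_scale_coeff
    using M lp_boundD[OF bound] by (auto simp: norm_mult norm_divide field_simps)
  have Ss: "(\<Sum>J\<in>tuples m I. cmod (s J) powr q) = S / M powr q"
    using M by (simp add: s_def norm_mult norm_divide S_def powr_divide sum_divide_distrib)
  have S0: "S \<ge> 0" by (simp add: S_def sum_nonneg)
  have N: "N = S powr (1 / q)" by (simp add: N_def S_def q_def)
  have "S / M powr q \<le> 1"
    using coeff_sum_le_1(1)[OF fin sym_s bound_s m p] Ss by (simp add: q_def)
  hence "S \<le> M powr q" using M by (simp add: field_simps)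
  hence "S powr (1 / q) \<le> (M powr q) powr (1 / q)" using S0 q0 by (intro powr_mono2) auto
  also have "\<dots> = M" using M q0 by (simp add: powr_powr)
  finally show "N \<le> M" by (simp add: N)
  assume "N = M"
  hence "M powr q = S" using q0 S0 by (simp add: N[symmetric] flip: \<open>N = M\<close>) (simp add: N powr_powr)
  hence "(\<Sum>J\<in>tuples m I. cmod (s J) powr q) = 1"
    unfolding Ss using M by (metis div_self powr_eq_0_iff less_irrefl)
  then obtain j where "j \<in> I" "cmod (s (replicate m j)) = 1" "\<forall>J\<in>tuples m I. J \<noteq> replicate m j \<longrightarrow> s J = 0"
    using coeff_sum_le_1(2)[OF fin sym_s bound_s m p] by (auto simp: q_def)
  thus "\<exists>j\<in>I. cmod (t (replicate m j)) = M \<and> (\<forall>J\<in>tuples m I. J \<noteq> replicate m j \<longrightarrow> t J = 0)"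
    using M by (intro bexI[of _ j]) (auto simp: s_def norm_mult norm_divide field_simps)
qed

section \<open>Multilinear forms\<close>

lemma multilinear_slot:
  assumes ml: "multilinear_form m n T" and xs: "xs \<in> tuples m (carrier_vec n)" and k: "k < m"
    and v: "v \<in> carrier_vec n"
  shows "T (xs[k := v]) = (\<Sum>i<n. v $ i * T (xs[k := unit_vec n i]))"
proof -
  define L where "L u = T (xs[k := u])" for u
  have add: "L (u + w) = L u + L w" and scale: "L (c \<cdot>\<^sub>v u) = c * L u"
    if "u \<in> carrier_vec n" "w \<in> carrier_vec n" for u w c
    using ml xs k that unfolding multilinear_form_def L_def by blast+
  \<comment> \<open>Truncations of \<open>v\<close> to its first \<open>j\<close> coordinates, so
    that additivity is used one coordinate at a time.\<close>
  define w where "w j = vec n (\<lambda>i. if i < j then v $ i else 0)" for j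
  have w: "w j \<in> carrier_vec n" for j by (simp add: w_def)
  have sum: "L (w j) = (\<Sum>i<j. v $ i * L (unit_vec n i))" if "j \<le> n" for j
    using that
  proof (induction j)
    case 0
    have "w 0 = 0 \<cdot>\<^sub>v w 0" by (rule eq_vecI) (auto simp: w_def)
    hence "L (w 0) = L (0 \<cdot>\<^sub>v w 0)" by simp
    also have "\<dots> = 0" using scale[OF w w, of 0] by simp
    finally show ?case by simp
  next
    case (Suc j)
    have "w (Suc j) = w j + v $ j \<cdot>\<^sub>v unit_vec n j"
      using Suc.prems by (intro eq_vecI) (auto simp: w_def less_Suc_eq)
    hence "L (w (Suc j)) = L (w j) + L (v $ j \<cdot>\<^sub>v unit_vec n j)"
      using add[OF w, of "v $ j \<cdot>\<^sub>v unit_vec n j" j] by simp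
    also have "L (v $ j \<cdot>\<^sub>v unit_vec n j) = v $ j * L (unit_vec n j)"
      by (rule scale[OF _ w[of 0]]) auto
    finally show ?case using Suc by simp
  qed
  have "w n = v" using v by (intro eq_vecI) (auto simp: w_def)
  with sum[OF order.refl] show ?thesis by (simp only: L_def)
qed

definition basis_coeff :: "nat \<Rightarrow> (complex vec list \<Rightarrow> complex) \<Rightarrow> nat list \<Rightarrow> complex" where
  "basis_coeff n T J = T (map (unit_vec n) J)"

lemma multilinear_expand:
  assumes ml: "multilinear_form m n T" and xs: "xs \<in> tuples m (carrier_vec n)"
  shows "T xs = (\<Sum>J\<in>tuples m {..<n}. prod_list (map2 (\<lambda>x i. x $ i) xs J) * basis_coeff n T J)"
proof -
  have len: "length xs = m" and car: "set xs \<subseteq> carrier_vec n" using xs by (auto simp: tuples_def)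
  \<comment> \<open>The last \<open>j\<close> slots are expanded; proceeding from the back puts each
    new index at the head of \<open>J\<close>.\<close>
  have "T xs = (\<Sum>J\<in>tuples j {..<n}. prod_list (map2 (\<lambda>x i. x $ i) (drop (m - j) xs) J) *
    T (take (m - j) xs @ map (unit_vec n) J))" if "j \<le> m" for j
    using that
  proof (induction j)
    case 0
    thus ?case using len by simp
  next
    case (Suc j)
    define k where "k = m - Suc j"
    have k: "k < m" "m - j = Suc k" using Suc.prems by (auto simp: k_def)
    have dr: "drop k xs = xs ! k # drop (Suc k) xs" using k len by (simp add: Cons_nth_drop_Suc)
    have step: "T (take (Suc k) xs @ map (unit_vec n) J) =
      (\<Sum>i<n. xs ! k $ i * T (take k xs @ map (unit_vec n) (i # J)))" if J: "J \<in> tuples j {..<n}" for J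
    proof -
      define ys where "ys = take (Suc k) xs @ map (unit_vec n) J"
      have "length ys = m" using J k len Suc.prems by (simp add: ys_def tuples_def k_def)
      moreover have "set ys \<subseteq> carrier_vec n"
        using car set_take_subset[of "Suc k" xs] by (auto simp: ys_def)
      ultimately have ys: "ys \<in> tuples m (carrier_vec n)" by (simp add: tuples_def)
      have upd: "ys[k := u] = take k xs @ u # map (unit_vec n) J" for u
        using k len by (simp add: ys_def take_Suc_conv_app_nth list_update_append)
      have "xs ! k \<in> carrier_vec n" using car k len by (auto simp: subset_iff)
      from multilinear_slot[OF ml ys k(1) this] show ?thesis
        unfolding upd using k len by (simp add: ys_def take_Suc_conv_app_nth)
    qed
    have "T xs = (\<Sum>J\<in>tuples j {..<n}. prod_list (map2 (\<lambda>x i. x $ i) (drop (Suc k) xs) J) *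
      T (take (Suc k) xs @ map (unit_vec n) J))"
      using Suc k by simp
    also have "\<dots> = (\<Sum>J\<in>tuples j {..<n}. \<Sum>i<n. prod_list (map2 (\<lambda>x i. x $ i) (drop k xs) (i # J)) *
      T (take k xs @ map (unit_vec n) (i # J)))"
      by (intro sum.cong refl) (simp add: step sum_distrib_left dr mult_ac)
    also have "\<dots> = (\<Sum>J\<in>tuples (Suc j) {..<n}. prod_list (map2 (\<lambda>x i. x $ i) (drop k xs) J) *
      T (take k xs @ map (unit_vec n) J))"
      unfolding sum_tuples_Suc by (rule sum.swap)
    finally show ?case by (simp add: k_def)
  qed
  from this[of m] show ?thesis by (simp add: basis_coeff_def)
qed

lemma multilinear_diag:
  assumes ml: "multilinear_form m n T" and z: "z \<in> carrier_vec n"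
  shows "T (replicate m z) = hpoly m {..<n} (basis_coeff n T) (\<lambda>i. z $ i)"
proof -
  have xs: "replicate m z \<in> tuples m (carrier_vec n)" using z by simp
  have "prod_list (map2 (\<lambda>x i. x $ i) (replicate (length J) z) J) = prod_list (map (\<lambda>i. z $ i) J)" for J
    by (induction J) auto
  hence "prod_list (map2 (\<lambda>x i. x $ i) (replicate m z) J) = prod_list (map (\<lambda>i. z $ i) J)"
    if "J \<in> tuples m {..<n}" for J
    using that by (auto simp: tuples_def)
  thus ?thesis unfolding multilinear_expand[OF ml xs] hpoly_def
    by (intro sum.cong refl) (simp add: mult.commute)
qed

lemma symmetric_on_basis_coeff:
  assumes "symmetric_form m n T"
  shows "symmetric_on m {..<n} (basis_coeff n T)"
  unfolding symmetric_on_def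
proof (intro ballI allI impI)
  fix J J' :: "nat list" assume J: "J \<in> tuples m {..<n}" and ms: "mset J' = mset J"
  obtain \<pi> where \<pi>: "\<pi> permutes {..<length J}" "permute_list \<pi> J = J'"
    using mset_eq_permutation[OF ms] by blast
  have len: "length J = m" using J by (simp add: tuples_def)
  have \<pi>': "\<pi> permutes {..<m}" using \<pi>(1) by (simp only: len)
  have eq: "map (unit_vec n) J' = permute_list \<pi> (map (unit_vec n) J)"
    using \<pi> by (simp add: permute_list_map)
  have "map (unit_vec n) J \<in> tuples m (carrier_vec n)"
    using len by (auto simp: tuples_def)
  hence "T (permute_list \<pi> (map (unit_vec n) J)) = T (map (unit_vec n) J)"
    using assms \<pi>' unfolding symmetric_form_def by blast
  thus "basis_coeff n T J' = basis_coeff n T J" by (simp only: basis_coeff_def eq)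
qed

section \<open>The unit ball and the supremum\<close>

lemma lp_norm_le_1_iff:
  assumes "p > 0"
  shows "lp_norm p z \<le> 1 \<longleftrightarrow> (\<Sum>i<dim_vec z. cmod (z $ i) powr p) \<le> 1"
proof -
  define s where "s = (\<Sum>i<dim_vec z. cmod (z $ i) powr p)"
  have s: "s \<ge> 0" by (simp add: s_def sum_nonneg)
  have "s powr (1 / p) \<le> 1 \<longleftrightarrow> s \<le> 1"
  proof
    assume "s \<le> 1"
    hence "s powr (1 / p) \<le> 1 powr (1 / p)" using assms s by (intro powr_mono2) auto
    thus "s powr (1 / p) \<le> 1" by simp
  next
    assume "s powr (1 / p) \<le> 1"
    thus "s \<le> 1" using assms by (metis gr_one_powr linorder_not_le zero_less_divide_1_iff)
  qed
  thus ?thesis by (simp add: lp_norm_def s_def)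
qed

lemma norm_coord_le_1:
  assumes "p > 0" "z \<in> carrier_vec n" "lp_norm p z \<le> 1" "i < n"
  shows "cmod (z $ i) \<le> 1"
proof -
  have "cmod (z $ i) powr p \<le> (\<Sum>i<n. cmod (z $ i) powr p)"
    using assms(4) by (intro member_le_sum) auto
  also have "\<dots> \<le> 1" using assms(1-3) by (simp add: lp_norm_le_1_iff)
  finally show ?thesis using assms(1) by (metis gr_one_powr linorder_not_le)
qed

text \<open>A real supremum dominates only when the set is bounded. Coordinates in the unit ball
  have modulus at most 1, so the sum of the moduli of all coefficients is a bound.\<close>

lemma norm_le_diag_sup:
  assumes ml: "multilinear_form m n T" and p: "p > 0"
    and z: "z \<in> carrier_vec n" "lp_norm p z \<le> 1"
  shows "cmod (T (replicate m z)) \<le> diag_sup p m n T"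
  unfolding diag_sup_def
proof (rule cSUP_upper)
  show "bdd_above ((\<lambda>z. cmod (T (replicate m z))) ` {z \<in> carrier_vec n. lp_norm p z \<le> 1})"
  proof (rule bdd_aboveI2)
    fix z assume "z \<in> {z \<in> carrier_vec n. lp_norm p z \<le> 1}"
    hence z: "z \<in> carrier_vec n" "lp_norm p z \<le> 1" by auto
    have "cmod (hpoly m {..<n} (basis_coeff n T) (\<lambda>i. z $ i)) \<le> (\<Sum>J\<in>tuples m {..<n}. cmod (basis_coeff n T J))"
      unfolding hpoly_def
    proof (rule sum_norm_le)
      fix J assume J: "J \<in> tuples m {..<n}"
      have "cmod (prod_list (map (\<lambda>i. z $ i) J)) \<le> 1" if "set J \<subseteq> {..<n}" for J
        using that norm_coord_le_1[OF p z]
        by (induction J) (auto simp: norm_mult intro!: mult_le_one)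
      thus "cmod (basis_coeff n T J * prod_list (map (\<lambda>i. z $ i) J)) \<le> cmod (basis_coeff n T J)"
        using J by (simp add: norm_mult mult_left_le tuples_def)
    qed
    thus "cmod (T (replicate m z)) \<le> (\<Sum>J\<in>tuples m {..<n}. cmod (basis_coeff n T J))"
      by (simp add: multilinear_diag[OF ml z(1)])
  qed
qed (use z in auto)

lemma lp_bound_diag_sup:
  assumes ml: "multilinear_form m n T" and p: "p > 0"
  shows "lp_bound p m {..<n} (basis_coeff n T) (diag_sup p m n T)"
  unfolding lp_bound_def
proof (intro allI impI)
  fix z :: "nat \<Rightarrow> complex" assume z: "(\<Sum>i<n. cmod (z i) powr p) \<le> 1"
  have "hpoly m {..<n} (basis_coeff n T) z = hpoly m {..<n} (basis_coeff n T) (\<lambda>i. vec n z $ i)"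
    by (rule hpoly_cong) auto
  also have "\<dots> = T (replicate m (vec n z))"
    by (rule multilinear_diag[OF ml, symmetric]) auto
  also have "cmod \<dots> \<le> diag_sup p m n T"
    using z p by (intro norm_le_diag_sup ml) (auto simp: lp_norm_le_1_iff)
  finally show "cmod (hpoly m {..<n} (basis_coeff n T) z) \<le> diag_sup p m n T" .
qed

lemma coeff_norm_eq:
  "coeff_norm p m n T =
     (\<Sum>J\<in>tuples m {..<n}. cmod (basis_coeff n T J) powr hl_exponent p m) powr (1 / hl_exponent p m)"
  by (simp add: coeff_norm_def hl_exponent_def basis_coeff_def)

lemma lp_norm_unit_vec: "j < n \<Longrightarrow> p > 0 \<Longrightarrow> lp_norm p (unit_vec n j) \<le> 1"
proof -
  assume j: "j < n" and p: "p > 0"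
  have "(\<Sum>i<n. cmod (unit_vec n j $ i) powr p) = (\<Sum>i<n. if i = j then 1 else 0)"
    using j by (intro sum.cong) (auto simp: unit_vec_def)
  thus ?thesis using j p by (simp add: lp_norm_le_1_iff)
qed

theorem corollary1p2:
  "\<exists>(A::real) > 0. \<exists>m\<^sub>0::nat. \<forall>m \<ge> m\<^sub>0. \<forall>p::real. p \<ge> 2 * real m + A \<longrightarrow>
     (\<forall>(n::nat) (T :: complex vec list \<Rightarrow> complex).
        multilinear_form m n T \<and> symmetric_form m n T \<longrightarrow>
        coeff_norm p m n T \<le> diag_sup p m n T \<and>
        ((\<exists>xs \<in> tuples m (carrier_vec n). T xs \<noteq> 0) \<longrightarrow>
           (coeff_norm p m n T = diag_sup p m n T \<longleftrightarrow>
              (\<exists>j < n. \<exists>c. c \<noteq> 0 \<and>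
                 (\<forall>z \<in> carrier_vec n. T (replicate m z) = c * (z $ j) ^ m)))))"
proof (rule exI[of _ gap_const], rule conjI)
  show "gap_const > 0" using off_const_nonneg by (simp add: gap_const_def)
  note A = this
  \<comment> \<open>Degree at least 6 is needed for the row norms without constant words, degree at
    least \<open>gap_const\<close> for the exponent gap.\<close>
  have "coeff_norm p m n T \<le> diag_sup p m n T \<and>
        ((\<exists>xs \<in> tuples m (carrier_vec n). T xs \<noteq> 0) \<longrightarrow>
           (coeff_norm p m n T = diag_sup p m n T \<longleftrightarrow>
              (\<exists>j < n. \<exists>c. c \<noteq> 0 \<and>
                 (\<forall>z \<in> carrier_vec n. T (replicate m z) = c * (z $ j) ^ m))))"
    if m': "m \<ge> max 6 (nat \<lceil>gap_const\<rceil>)" and p: "p \<ge> 2 * real m + gap_const"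
      and ml: "multilinear_form m n T" and sym: "symmetric_form m n T"
    for m n :: nat and p :: real and T :: "complex vec list \<Rightarrow> complex"
  proof -
    define t where "t = basis_coeff n T"
    define q where "q = hl_exponent p m"
    define M where "M = diag_sup p m n T"
    have m: "m \<ge> 6" "real m \<ge> gap_const" using m' by linarith+
    have m0: "m > 0" and p0: "p > 0" and p2: "p \<ge> 2 * real m" using m p A by linarith+
    have q0: "q > 0" unfolding q_def by (rule hl_exponent_pos[OF m0 p2])
    have symt: "symmetric_on m {..<n} t" unfolding t_def by (rule symmetric_on_basis_coeff[OF sym])
    have bound: "lp_bound p m {..<n} t M" unfolding t_def M_def by (rule lp_bound_diag_sup[OF ml p0])
    have N: "coeff_norm p m n T = (\<Sum>J\<in>tuples m {..<n}. cmod (t J) powr q) powr (1 / q)"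
      by (simp add: coeff_norm_eq t_def q_def)
    \<comment> \<open>Normalisation divides by the bound, and \<open>M\<close> may be 0; hence the
      detour over positive \<open>x\<close> and a limit.\<close>
    have le': "coeff_norm p m n T \<le> x" if "x > 0" "M \<le> x" for x
    proof -
      have "lp_bound p m {..<n} t x" using bound that unfolding lp_bound_def by (meson order.trans)
      thus ?thesis unfolding N q_def by (intro coeff_norm_le_bound symt m p that) auto
    qed
    have M0: "M \<ge> 0" by (rule lp_bound_nonneg[OF bound])
    have le: "coeff_norm p m n T \<le> M"
      by (rule field_le_epsilon) (use M0 in \<open>auto intro!: le'\<close>)
    have eq: "coeff_norm p m n T = M \<longleftrightarrow> (\<exists>j < n. \<exists>c. c \<noteq> 0 \<and>
        (\<forall>z \<in> carrier_vec n. T (replicate m z) = c * (z $ j) ^ m))"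
      if nz: "\<exists>xs \<in> tuples m (carrier_vec n). T xs \<noteq> 0"
    proof
      assume eqM: "coeff_norm p m n T = M"
      \<comment> \<open>A nonzero coefficient makes the coefficient norm, and with it
        \<open>M\<close>, positive.\<close>
      obtain J where J: "J \<in> tuples m {..<n}" "t J \<noteq> 0"
      proof -
        obtain xs where xs: "xs \<in> tuples m (carrier_vec n)" "T xs \<noteq> 0" using nz by blast
        have "\<exists>J\<in>tuples m {..<n}. t J \<noteq> 0"
        proof (rule ccontr)
          assume "\<not> ?thesis"
          hence "T xs = 0" unfolding multilinear_expand[OF ml xs(1)] t_def by (intro sum.neutral) auto
          thus False using xs(2) by simp
        qed
        thus ?thesis using that by blast
      qed
      have "cmod (t J) powr q \<le> (\<Sum>J\<in>tuples m {..<n}. cmod (t J) powr q)"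
        using J by (intro member_le_sum) auto
      moreover have "cmod (t J) powr q > 0" using J by simp
      ultimately have "(\<Sum>J\<in>tuples m {..<n}. cmod (t J) powr q) > 0" by linarith
      hence "M > 0" unfolding eqM[symmetric] N by simp
      then obtain j where j: "j < n" "cmod (t (replicate m j)) = M"
        "\<forall>J\<in>tuples m {..<n}. J \<noteq> replicate m j \<longrightarrow> t J = 0"
        using coeff_norm_le_bound(2)[OF _ symt bound _ m p] eqM unfolding N q_def by auto
      have "T (replicate m z) = t (replicate m j) * (z $ j) ^ m" if z: "z \<in> carrier_vec n" for z
      proof -
        have "T (replicate m z) = (\<Sum>J\<in>tuples m {..<n}. t J * prod_list (map (\<lambda>i. z $ i) J))"
          unfolding multilinear_diag[OF ml z] hpoly_def t_def ..
        also have "\<dots> = (\<Sum>J\<in>{replicate m j}. t J * prod_list (map (\<lambda>i. z $ i) J))"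
          using j by (intro sum.mono_neutral_right) auto
        also have "\<dots> = t (replicate m j) * (z $ j) ^ m" by (simp add: prod_list_replicate)
        finally show ?thesis .
      qed
      thus "\<exists>j < n. \<exists>c. c \<noteq> 0 \<and> (\<forall>z \<in> carrier_vec n. T (replicate m z) = c * (z $ j) ^ m)"
        using j \<open>M > 0\<close> by (intro exI[of _ j] conjI exI[of _ "t (replicate m j)"]) auto
    next
      assume "\<exists>j < n. \<exists>c. c \<noteq> 0 \<and> (\<forall>z \<in> carrier_vec n. T (replicate m z) = c * (z $ j) ^ m)"
      then obtain j c where j: "j < n" and
        T: "\<And>z. z \<in> carrier_vec n \<Longrightarrow> T (replicate m z) = c * (z $ j) ^ m" by blast
      \<comment> \<open>The modulus of \<open>c\<close> is squeezed between the supremum and the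
        coefficient norm, whose term at the constant word \<open>j\<close> alone has this
        size.\<close>
      have "M \<le> cmod c"
        unfolding M_def diag_sup_def
      proof (rule cSUP_least)
        have "unit_vec n j \<in> {z \<in> carrier_vec n. lp_norm p z \<le> 1}"
          using lp_norm_unit_vec[OF j p0] by simp
        thus "{z \<in> carrier_vec n. lp_norm p z \<le> 1} \<noteq> {}" by blast
      next
        fix z assume "z \<in> {z \<in> carrier_vec n. lp_norm p z \<le> 1}"
        hence z: "z \<in> carrier_vec n" "lp_norm p z \<le> 1" by auto
        have "cmod (z $ j) ^ m \<le> 1" using norm_coord_le_1[OF p0 z j] by (intro power_le_one) auto
        thus "cmod (T (replicate m z)) \<le> cmod c"
          by (simp add: T[OF z(1)] norm_mult norm_power mult_left_le)
      qed
      moreover have "cmod c \<le> coeff_norm p m n T"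
      proof -
        have "t (replicate m j) = T (replicate m (unit_vec n j))" by (simp add: t_def basis_coeff_def)
        also have "\<dots> = c" using j by (subst T) auto
        finally have "cmod c powr q = cmod (t (replicate m j)) powr q" by simp
        also have "\<dots> \<le> (\<Sum>J\<in>tuples m {..<n}. cmod (t J) powr q)"
          using j by (intro member_le_sum) auto
        finally have "(cmod c powr q) powr (1 / q) \<le> coeff_norm p m n T"
          unfolding N using q0 by (intro powr_mono2) auto
        thus ?thesis using q0 by (simp add: powr_powr)
      qed
      ultimately show "coeff_norm p m n T = M" using le by linarith
    qed
    show ?thesis using le eq by (simp add: M_def)
  qed
  thus "\<exists>m\<^sub>0::nat. \<forall>m \<ge> m\<^sub>0. \<forall>p::real. p \<ge> 2 * real m + gap_const \<longrightarrow>
     (\<forall>(n::nat) (T :: complex vec list \<Rightarrow> complex).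
        multilinear_form m n T \<and> symmetric_form m n T \<longrightarrow>
        coeff_norm p m n T \<le> diag_sup p m n T \<and>
        ((\<exists>xs \<in> tuples m (carrier_vec n). T xs \<noteq> 0) \<longrightarrow>
           (coeff_norm p m n T = diag_sup p m n T \<longleftrightarrow>
              (\<exists>j < n. \<exists>c. c \<noteq> 0 \<and>
                 (\<forall>z \<in> carrier_vec n. T (replicate m z) = c * (z $ j) ^ m)))))"
    by (intro exI[of _ "max 6 (nat \<lceil>gap_const\<rceil>)"]) blast
qed

end
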